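(* Let $p\in(1,\infty)$, $L>0$, $w_0,\dot w_0\in\mathbb{R}$, and let $k:[0,L]\to\mathbb{R}$ be a solution, with some $\lambda\in\mathbb{R}$, of the Cauchy problem $$p\big(|k|^{p-2}k\big)''+(p-1)|k|^pk-\lambda k=0,\qquad |k(0)|^{p-2}k(0)=w_0,\quad \tfrac{d}{ds}\big|_{s=0}\big(|k(s)|^{p-2}k(s)\big)=\dot w_0$$ (in the sense given in the context). Then $k$ is given by either of the following cases: (I) $k(s)\equiv0$. (II) $k(s)=A\,\mathrm{cn}_p(\alpha s+\beta,q)$ for some constants $A,\beta\in\mathbb{R}$, $\alpha>0$, $q\in(0,1)$ such that $A^2=4\alpha^2q^2$, $\lambda=2(p-1)|A|^{p-2}\alpha^2(2q^2-1)$, $A\,\mathrm{cn}_p(\beta,q)=|w_0|^{\frac{2-p}{p-1}}w_0$, and $\frac{d}{ds}\big|_{s=0}\big(|A\,\mathrm{cn}_p(\alpha s+\beta,q)|^{p-2}A\,\mathrm{cn}_p(\alpha s+\beta,q)\big)=\dot w_0$. (III) ($1<p\le2$) $\lambda>0$ and $k(s)=2\,\mathrm{sign}(w_0)A_{p,\lambda}\,\mathrm{sech}_p(A_{p,\lambda}s+\beta)$ for some $\beta\in\mathbb{R}$ such that $(2A_{p,\lambda}\,\mathrm{sech}_p\beta)^{p-1}=|w_0|$. (III') ($p>2$) $k$ is of flat-core type. (IV) $k(s)=A\,\mathrm{dn}_p(\alpha s+\beta,q)$ for some constants $A,\beta\in\mathbb{R}$, $\alpha>0$, $q\in(0,1)$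 such that $A^2=4\alpha^2$, $\lambda=2(p-1)|A|^{p-2}\alpha^2(2-q^2)$, $A\,\mathrm{dn}_p(\beta,q)=|w_0|^{\frac{2-p}{p-1}}w_0$, and $\frac{d}{ds}\big|_{s=0}\big(|A\,\mathrm{dn}_p(\alpha s+\beta,q)|^{p-2}A\,\mathrm{dn}_p(\alpha s+\beta,q)\big)=\dot w_0$. (V) $k(s)\equiv k_0$ for some constant $k_0\ne0$. Furthermore, let $D_0=D_0(w_0,\dot w_0)$ be given by $$D_0:=p^2\dot w_0^2+F(w_0),\qquad F(x):=(p-1)^2|x|^{\frac{2p}{p-1}}-2\lambda(p-1)|x|^{\frac p{p-1}}.$$ Then each of the cases (I), (II), (III), (III'), (IV), (V) is attained if and only if the corresponding one of the following mutually exclusive conditions (i), (ii), (iii), (iii'), (iv), (v) holds: (i) ($1<p\le2$) $w_0=\dot w_0=0$; ($p>2$) $k\equiv0$. (ii) $D_0>0$. (iii) ($1<p\le2$) $D_0=0$ and $(w_0,\dot w_0)\ne(0,0)$. (iii') ($p>2$) $D_0=0$ and $k\not\equiv0$. (iv) $\min F<D_0<0$. (v) $D_0=\min F<0$.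
   Context: **Solution of the Cauchy problem.** $k$ is a solution with multiplier $\lambda$ if $k\in L^\infty(0,L)$ and $w:=|k|^{p-2}k\in L^\infty(0,L)$ satisfies $$\int_0^L\Big(p\,w\varphi''+(p-1)|w|^{\frac2{p-1}}w\varphi-\lambda|w|^{\frac{2-p}{p-1}}w\varphi\Big)ds=0\quad\text{for all }\varphi\in C^\infty_{\rm c}(0,L)$$ (which implies $w\in C^2([0,L])$), together with $w(0)=w_0$ and $w'(0)=\dot w_0$. Expressions $|x|^ax$ with $a>-1$ are read as $0$ at $x=0$. **$p$-elliptic functions.** For $q\in[0,1)$, $x\in\mathbb{R}$, let $\mathrm{F}_{1,p}(x,q)=\int_0^x\frac{|\cos\theta|^{1-2/p}}{\sqrt{1-q^2\sin^2\theta}}d\theta$ and $\mathrm{F}_{2,p}(x,q)=\int_0^x\frac{d\theta}{\sqrt[p]{1-q^2\sin^2\theta}}$. For $q=1$, $\mathrm{F}_{1,p}(x,1)=\mathrm{F}_{2,p}(x,1)=\int_0^x|\cos\theta|^{-2/p}d\theta$ for $x\in(-\frac\pi2,\frac\pi2)$ if $p\le2$, $x\in\mathbb{R}$ if $p>2$; $\mathrm{K}_p(1)=\infty$ if $p\le2$ and $\mathrm{K}_p(1)=\int_0^{\pi/2}(\cos\theta)^{-2/p}d\theta<\infty$ if $p>2$. Let $\mathrm{am}_{i,p}(\cdot,q):\mathbb{R}\to\mathbb{R}$ be the inverse function of $\mathrm{F}_{i,p}(\cdot,q)$. Then $\mathrm{cn}_p(x,q)=|\cos\mathrm{am}_{1,p}(x,q)|^{\frac2p-1}\cos\mathrm{am}_{1,p}(x,q)$,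 $\mathrm{dn}_p(x,q)=\sqrt[p]{1-q^2\sin^2(\mathrm{am}_{2,p}(x,q))}$, and $\mathrm{sech}_px=\mathrm{cn}_p(x,1)=\mathrm{dn}_p(x,1)$ for $|x|<\mathrm{K}_p(1)$, $\mathrm{sech}_px=0$ for $|x|\ge\mathrm{K}_p(1)$ (no such $x$ when $p\le2$). **Constants and flat-core type.** For $\lambda>0$, $A_{p,\lambda}:=\frac12\big(\frac{2\lambda}{p-1}\big)^{1/p}$, and for $p>2$, $T_{p,\lambda}:=\mathrm{K}_p(1)/A_{p,\lambda}$. For $p>2$, a function $k:[0,L]\to\mathbb{R}$ is of flat-core type if there exist $\lambda>0$, $N\in\{1,2,\dots\}$, $\{\sigma_i\}_{i=1}^N\subset\{-1,1\}$ and $\{s_i\}_{i=1}^N\subset(-T_{p,\lambda},L+T_{p,\lambda})$ with $s_{i+1}\ge s_i+2T_{p,\lambda}$ ($i=1,\dots,N-1$) such that $k(s)=\sum_{i=1}^N\sigma_i\,2A_{p,\lambda}\,\mathrm{sech}_p\big(A_{p,\lambda}(s-s_i)\big)$. *)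

theory Defs
  imports "HOL-Analysis.Analysis"
begin

(* Since 0 powr a = 0 and x / 0 = 0, expressions of the form \<bar>x\<bar> powr a * x vanish at
   x = 0 for every exponent a, in particular for negative ones. *)
definition sgn_pow :: "real \<Rightarrow> real \<Rightarrow> real" where
  "sgn_pow a x = \<bar>x\<bar> powr a * x"

definition Linf :: "real \<Rightarrow> (real \<Rightarrow> real) set" where
  "Linf L = {f. f \<in> borel_measurable (lebesgue_on {0<..<L}) \<and>
                (\<exists>C. AE s in lebesgue_on {0<..<L}. \<bar>f s\<bar> \<le> C)}"

definition test_function :: "real \<Rightarrow> (real \<Rightarrow> real) \<Rightarrow> bool" where
  "test_function L \<phi> \<longleftrightarrow>
     (\<forall>n x. (deriv ^^ n) \<phi> differentiable (at x)) \<and>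
     compact (closure {x. \<phi> x \<noteq> 0}) \<and> closure {x. \<phi> x \<noteq> 0} \<subseteq> {0<..<L}"

definition weak_equation :: "real \<Rightarrow> real \<Rightarrow> real \<Rightarrow> (real \<Rightarrow> real) \<Rightarrow> bool" where
  "weak_equation p L lam w \<longleftrightarrow>
     (\<forall>\<phi>. test_function L \<phi> \<longrightarrow>
        (LINT s|lebesgue_on {0<..<L}.
            p * w s * deriv (deriv \<phi>) s
            + (p - 1) * sgn_pow (2 / (p - 1)) (w s) * \<phi> s
            - lam * sgn_pow ((2 - p) / (p - 1)) (w s) * \<phi> s) = 0)"

(* g is the (on the closed interval unique) continuous representative of the a.e. class of f. *)
definition continuous_rep :: "real \<Rightarrow> (real \<Rightarrow> real) \<Rightarrow> (real \<Rightarrow> real) \<Rightarrow> bool" where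
  "continuous_rep L f g \<longleftrightarrow>
     continuous_on {0..L} g \<and> (AE s in lebesgue_on {0<..<L}. g s = f s)"

(* As k is only determined almost everywhere, the initial values of w = \<bar>k\<bar> powr (p - 2) * k
   are those of its continuous representative W (which exists by the weak equation). *)
definition is_solution ::
    "real \<Rightarrow> real \<Rightarrow> real \<Rightarrow> real \<Rightarrow> real \<Rightarrow> (real \<Rightarrow> real) \<Rightarrow> bool" where
  "is_solution p L lam w0 w1 k \<longleftrightarrow>
     (let w = (\<lambda>s. sgn_pow (p - 2) (k s)) in
        k \<in> Linf L \<and> w \<in> Linf L \<and> weak_equation p L lam w \<and>
        (\<exists>W. continuous_rep L w W \<and> W 0 = w0 \<and>
             (W has_real_derivative w1) (at 0 within {0..L})))"

definition F1 :: "real \<Rightarrow> real \<Rightarrow> real \<Rightarrow> real" where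
  "F1 p x q =
     (if q = 1 then LBINT t=0..ereal x. \<bar>cos t\<bar> powr (- 2 / p)
      else LBINT t=0..ereal x. \<bar>cos t\<bar> powr (1 - 2 / p) / sqrt (1 - q\<^sup>2 * (sin t)\<^sup>2))"

definition F2 :: "real \<Rightarrow> real \<Rightarrow> real \<Rightarrow> real" where
  "F2 p x q =
     (if q = 1 then LBINT t=0..ereal x. \<bar>cos t\<bar> powr (- 2 / p)
      else LBINT t=0..ereal x. 1 / (1 - q\<^sup>2 * (sin t)\<^sup>2) powr (1 / p))"

(* Domain of F1 p _ q and F2 p _ q: for q = 1 and p \<le> 2 the integrand is not integrable
   across the zeros of the cosine. *)
definition F_dom :: "real \<Rightarrow> real \<Rightarrow> real set" where
  "F_dom p q = (if q = 1 \<and> p \<le> 2 then {- pi / 2<..<pi / 2} else UNIV)"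

definition am1 :: "real \<Rightarrow> real \<Rightarrow> real \<Rightarrow> real" where
  "am1 p x q = inv_into (F_dom p q) (\<lambda>t. F1 p t q) x"

definition am2 :: "real \<Rightarrow> real \<Rightarrow> real \<Rightarrow> real" where
  "am2 p x q = inv_into (F_dom p q) (\<lambda>t. F2 p t q) x"

definition cn_p :: "real \<Rightarrow> real \<Rightarrow> real \<Rightarrow> real" where
  "cn_p p x q = sgn_pow (2 / p - 1) (cos (am1 p x q))"

definition dn_p :: "real \<Rightarrow> real \<Rightarrow> real \<Rightarrow> real" where
  "dn_p p x q = (1 - q\<^sup>2 * (sin (am2 p x q))\<^sup>2) powr (1 / p)"

definition K_p1 :: "real \<Rightarrow> ereal" where
  "K_p1 p = (if p \<le> 2 then \<infinity> else ereal (LBINT t=0..ereal (pi / 2). cos t powr (- 2 / p)))"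

(* For \<bar>x\<bar> < K_p1 p the values cn_p p x 1 and dn_p p x 1 coincide. *)
definition sech_p :: "real \<Rightarrow> real \<Rightarrow> real" where
  "sech_p p x = (if ereal \<bar>x\<bar> < K_p1 p then cn_p p x 1 else 0)"

definition A_p :: "real \<Rightarrow> real \<Rightarrow> real" where
  "A_p p lam = 1 / 2 * (2 * lam / (p - 1)) powr (1 / p)"

(* Only meaningful for p > 2, where K_p1 p is finite. *)
definition T_p :: "real \<Rightarrow> real \<Rightarrow> real" where
  "T_p p lam = real_of_ereal (K_p1 p) / A_p p lam"

definition flat_core_type :: "real \<Rightarrow> real \<Rightarrow> (real \<Rightarrow> real) \<Rightarrow> bool" where
  "flat_core_type p L k \<longleftrightarrow>
     p > 2 \<and>
     (\<exists>lam>0. \<exists>N\<ge>1. \<exists>(\<sigma> :: nat \<Rightarrow> real) (c :: nat \<Rightarrow> real).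
        (\<forall>i\<in>{1..N}. \<sigma> i \<in> {- 1, 1} \<and> c i \<in> {- T_p p lam<..<L + T_p p lam}) \<and>
        (\<forall>i\<in>{1..<N}. c (i + 1) \<ge> c i + 2 * T_p p lam) \<and>
        (\<forall>s\<in>{0..L}. k s =
           (\<Sum>i=1..N. \<sigma> i * (2 * A_p p lam) * sech_p p (A_p p lam * (s - c i)))))"

definition case_I :: "real \<Rightarrow> (real \<Rightarrow> real) \<Rightarrow> bool" where
  "case_I L k \<longleftrightarrow> (\<forall>s\<in>{0..L}. k s = 0)"

definition case_II ::
    "real \<Rightarrow> real \<Rightarrow> real \<Rightarrow> real \<Rightarrow> real \<Rightarrow> (real \<Rightarrow> real) \<Rightarrow> bool" where
  "case_II p L lam w0 w1 k \<longleftrightarrow>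
     (\<exists>A \<beta> \<alpha> q. \<alpha> > 0 \<and> 0 < q \<and> q < 1 \<and>
        (\<forall>s\<in>{0..L}. k s = A * cn_p p (\<alpha> * s + \<beta>) q) \<and>
        A\<^sup>2 = 4 * \<alpha>\<^sup>2 * q\<^sup>2 \<and>
        lam = 2 * (p - 1) * \<bar>A\<bar> powr (p - 2) * \<alpha>\<^sup>2 * (2 * q\<^sup>2 - 1) \<and>
        A * cn_p p \<beta> q = sgn_pow ((2 - p) / (p - 1)) w0 \<and>
        ((\<lambda>s. sgn_pow (p - 2) (A * cn_p p (\<alpha> * s + \<beta>) q)) has_real_derivative w1) (at 0))"

definition case_III ::
    "real \<Rightarrow> real \<Rightarrow> real \<Rightarrow> real \<Rightarrow> (real \<Rightarrow> real) \<Rightarrow> bool" where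
  "case_III p L lam w0 k \<longleftrightarrow>
     p \<le> 2 \<and> lam > 0 \<and>
     (\<exists>\<beta>. (\<forall>s\<in>{0..L}. k s = 2 * sgn w0 * A_p p lam * sech_p p (A_p p lam * s + \<beta>)) \<and>
          (2 * A_p p lam * sech_p p \<beta>) powr (p - 1) = \<bar>w0\<bar>)"

definition case_III' :: "real \<Rightarrow> real \<Rightarrow> (real \<Rightarrow> real) \<Rightarrow> bool" where
  "case_III' p L k \<longleftrightarrow> p > 2 \<and> flat_core_type p L k"

definition case_IV ::
    "real \<Rightarrow> real \<Rightarrow> real \<Rightarrow> real \<Rightarrow> real \<Rightarrow> (real \<Rightarrow> real) \<Rightarrow> bool" where
  "case_IV p L lam w0 w1 k \<longleftrightarrow>
     (\<exists>A \<beta> \<alpha> q. \<alpha> > 0 \<and> 0 < q \<and> q < 1 \<and>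
        (\<forall>s\<in>{0..L}. k s = A * dn_p p (\<alpha> * s + \<beta>) q) \<and>
        A\<^sup>2 = 4 * \<alpha>\<^sup>2 \<and>
        lam = 2 * (p - 1) * \<bar>A\<bar> powr (p - 2) * \<alpha>\<^sup>2 * (2 - q\<^sup>2) \<and>
        A * dn_p p \<beta> q = sgn_pow ((2 - p) / (p - 1)) w0 \<and>
        ((\<lambda>s. sgn_pow (p - 2) (A * dn_p p (\<alpha> * s + \<beta>) q)) has_real_derivative w1) (at 0))"

definition case_V :: "real \<Rightarrow> (real \<Rightarrow> real) \<Rightarrow> bool" where
  "case_V L k \<longleftrightarrow> (\<exists>k0. k0 \<noteq> 0 \<and> (\<forall>s\<in>{0..L}. k s = k0))"

definition F_pot :: "real \<Rightarrow> real \<Rightarrow> real \<Rightarrow> real" where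
  "F_pot p lam x =
     (p - 1)\<^sup>2 * \<bar>x\<bar> powr (2 * p / (p - 1)) - 2 * lam * (p - 1) * \<bar>x\<bar> powr (p / (p - 1))"

definition min_F :: "real \<Rightarrow> real \<Rightarrow> real" where
  "min_F p lam = (LEAST y. y \<in> range (F_pot p lam))"

definition D0 :: "real \<Rightarrow> real \<Rightarrow> real \<Rightarrow> real \<Rightarrow> real" where
  "D0 p lam w0 w1 = p\<^sup>2 * w1\<^sup>2 + F_pot p lam w0"

definition cond_i :: "real \<Rightarrow> real \<Rightarrow> real \<Rightarrow> real \<Rightarrow> (real \<Rightarrow> real) \<Rightarrow> bool" where
  "cond_i p L w0 w1 k \<longleftrightarrow>
     (p \<le> 2 \<and> w0 = 0 \<and> w1 = 0) \<or> (p > 2 \<and> (\<forall>s\<in>{0..L}. k s = 0))"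

definition cond_ii :: "real \<Rightarrow> real \<Rightarrow> real \<Rightarrow> real \<Rightarrow> bool" where
  "cond_ii p lam w0 w1 \<longleftrightarrow> D0 p lam w0 w1 > 0"

definition cond_iii :: "real \<Rightarrow> real \<Rightarrow> real \<Rightarrow> real \<Rightarrow> bool" where
  "cond_iii p lam w0 w1 \<longleftrightarrow> p \<le> 2 \<and> D0 p lam w0 w1 = 0 \<and> (w0, w1) \<noteq> (0, 0)"

definition cond_iii' ::
    "real \<Rightarrow> real \<Rightarrow> real \<Rightarrow> real \<Rightarrow> real \<Rightarrow> (real \<Rightarrow> real) \<Rightarrow> bool" where
  "cond_iii' p L lam w0 w1 k \<longleftrightarrow>
     p > 2 \<and> D0 p lam w0 w1 = 0 \<and> \<not> (\<forall>s\<in>{0..L}. k s = 0)"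

definition cond_iv :: "real \<Rightarrow> real \<Rightarrow> real \<Rightarrow> real \<Rightarrow> bool" where
  "cond_iv p lam w0 w1 \<longleftrightarrow> min_F p lam < D0 p lam w0 w1 \<and> D0 p lam w0 w1 < 0"

definition cond_v :: "real \<Rightarrow> real \<Rightarrow> real \<Rightarrow> real \<Rightarrow> bool" where
  "cond_v p lam w0 w1 \<longleftrightarrow> D0 p lam w0 w1 = min_F p lam \<and> min_F p lam < 0"

end

theory Submission
  imports Defs "HOL-Real_Asymp.Real_Asymp"
begin

text \<open>Testing with combinations of three narrow bumps shows that the continuous representative of
  \<^term>\<open>\<lambda>s. sgn_pow (p - 2) (k s)\<close> is a classical solution \<open>W\<close> of a second-order autonomous equation, whose
  energy \<open>p\<^sup>2 W'\<^sup>2 + F W\<close> is the constant \<^term>\<open>D0 p lam w0 w1\<close>. The nonlinearity fails to be Lipschitz only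
  where \<open>W\<close> vanishes (for \<open>p > 2\<close>), but there the energy identity is a first-order equation with Lipschitz
  right-hand side as long as \<open>W' \<noteq> 0\<close>; hence initial values determine solutions except through the state
  \<open>(0, 0)\<close>, which has energy \<open>0\<close>. The amplitudes of the \<open>p\<close>-elliptic functions parametrise the level sets
  of the energy by an angle, so for nonzero energy (or \<open>p \<le> 2\<close>) the parameters of an explicit solution
  can be fitted to the initial values. For zero energy and \<open>p > 2\<close> this works on each component of
  \<open>W \<noteq> 0\<close>, which is a core of fixed width cut off at the ends of the interval.\<close>

subsection \<open>Signed powers\<close>

text \<open>With z = (p - 1) |W|^(p/(p-1)) the energy reads p^2 W'^2 + (z - lam)^2 - lam^2. So for
  lam > 0 its least value is - lam^2, taken at the nonzero equilibria; a negative energy keeps W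
  away from 0 (dn), a positive one lets W vanish with nonzero velocity (cn), and energy 0 is the
  separatrix q = 1 (sech). Turning points satisfy (z - lam)^2 = lam^2 + D0; with R = sqrt (lam^2 +
  D0) the largest z is lam + R, and this is where A, \<alpha> and q come from. The delicate object
  is the amplitude: the integrand of \<open>F1\<close> may vanish or blow up at the zeros of the
  cosine, so the chain rule through \<open>am1\<close> fails there although |cn|^(p-2) cn is twice
  differentiable. Derivatives are therefore computed off a locally finite set and extended by
  continuity. Passing from an explicit form to its condition is an evaluation of the energy along
  the formula. Only flat cores need more: \<open>flat_core_type\<close> quantifies over its own
  multiplier, which must first be identified with the one in the equation.\<close>

lemma sgn_pow_0 [simp]: "sgn_pow a 0 = 0"
  by (simp add: sgn_pow_def)

lemma sgn_pow_eq_0_iff [simp]: "sgn_pow a x = 0 \<longleftrightarrow> x = 0"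
  by (simp add: sgn_pow_def)

lemma sgn_pow_minus [simp]: "sgn_pow a (- x) = - sgn_pow a x"
  by (simp add: sgn_pow_def)

lemma sgn_pow_mult: "sgn_pow a (x * y) = sgn_pow a x * sgn_pow a y"
  by (simp add: sgn_pow_def abs_mult powr_mult)

lemma abs_sgn_pow: "\<bar>sgn_pow a x\<bar> = \<bar>x\<bar> powr (a + 1)"
  by (simp add: sgn_pow_def abs_mult powr_add)

lemma sgn_sgn_pow [simp]: "sgn (sgn_pow a x) = sgn x"
  by (cases "x = 0") (simp_all add: sgn_pow_def sgn_mult)

lemma sgn_pow_zero_exp [simp]: "sgn_pow 0 x = x"
  by (simp add: sgn_pow_def)

text \<open>On the real line \<open>sgn_pow a\<close> is the odd power with exponent a + 1, so
  composition multiplies the shifted exponents: the new index is (a + 1)(b + 1) - 1.\<close>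

lemma sgn_pow_sgn_pow: "sgn_pow a (sgn_pow b x) = sgn_pow (a * (b + 1) + b) x"
proof (cases "x = 0")
  case False
  then have "sgn_pow a (sgn_pow b x) = \<bar>x\<bar> powr ((b + 1) * a) * (\<bar>x\<bar> powr b * x)"
    by (simp add: sgn_pow_def[of a] abs_sgn_pow powr_powr) (simp add: sgn_pow_def)
  then show ?thesis
    using False by (simp add: sgn_pow_def powr_add mult.commute mult.left_commute)
qed simp

text \<open>The shifted exponents p - 1 and 1/(p - 1) are reciprocal; thus k and W = |k|^(p-2) k
  determine each other pointwise.\<close>

lemma sgn_pow_inverse:
  assumes "p > 1"
  shows "sgn_pow ((2 - p) / (p - 1)) (sgn_pow (p - 2) x) = x"
    and "sgn_pow (p - 2) (sgn_pow ((2 - p) / (p - 1)) x) = x"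
proof -
  have *: "(2 - p) / (p - 1) * (p - 2 + 1) + (p - 2) = 0" "(p - 2) * ((2 - p) / (p - 1) + 1) + (2 - p) / (p - 1) = 0"
    using assms by (auto simp: field_simps)
  show "sgn_pow ((2 - p) / (p - 1)) (sgn_pow (p - 2) x) = x"
    "sgn_pow (p - 2) (sgn_pow ((2 - p) / (p - 1)) x) = x"
    unfolding sgn_pow_sgn_pow * by simp_all
qed

lemma sgn_pow_pos: "x > 0 \<Longrightarrow> sgn_pow a x = x powr (a + 1)"
  by (simp add: sgn_pow_def powr_add)

text \<open>At x = 0 the formula asks for a > 0: the library sets 0 powr 0 = 0, whereas
  \<open>sgn_pow 0\<close> is the identity and has derivative 1.\<close>

lemma DERIV_sgn_pow:
  assumes "x \<noteq> 0 \<or> a > 0"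
  shows "(sgn_pow a has_real_derivative (a + 1) * \<bar>x\<bar> powr a) (at x)"
proof -
  consider "x > 0" | "x < 0" | "x = 0" "a > 0"
    using assms by linarith
  then show ?thesis
  proof cases
    case 1
    have "((\<lambda>x. x powr (a + 1)) has_real_derivative (a + 1) * x powr a) (at x)"
      using 1 by (auto intro!: derivative_eq_intros)
    then have "((\<lambda>x. x powr (a + 1)) has_real_derivative (a + 1) * \<bar>x\<bar> powr a) (at x)"
      using 1 by simp
    then show ?thesis
      by (rule has_field_derivative_transform_within_open[of _ _ _ "{0<..}"])
        (use 1 in \<open>auto simp: sgn_pow_pos\<close>)
  next
    case 2
    have "((\<lambda>x. - ((- x) powr (a + 1))) has_real_derivative (a + 1) * (-x) powr a) (at x)"
      using 2 by (auto intro!: derivative_eq_intros)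
    then have "((\<lambda>x. - ((- x) powr (a + 1))) has_real_derivative (a + 1) * \<bar>x\<bar> powr a) (at x)"
      using 2 by simp
    then show ?thesis
      by (rule has_field_derivative_transform_within_open[of _ _ _ "{..<0}"])
        (use 2 in \<open>auto simp: sgn_pow_def powr_add\<close>)
  next
    case 3
    have "((\<lambda>x. \<bar>x\<bar>) \<longlongrightarrow> (0::real)) (at 0)"
      by (rule tendsto_eq_intros | simp)+
    then have "((\<lambda>x. \<bar>x\<bar> powr a) \<longlongrightarrow> 0 powr a) (at (0::real))"
      using 3 by (intro tendsto_powr2) (auto intro: always_eventually)
    then have "((\<lambda>h. (sgn_pow a (0 + h) - sgn_pow a 0) / h) \<longlongrightarrow> 0) (at 0)"
      using 3 by (simp add: sgn_pow_def cong: Lim_cong_within)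
    then show ?thesis
      using 3 by (simp add: DERIV_def)
  qed
qed

lemma isCont_sgn_pow:
  assumes "a > -1"
  shows "isCont (sgn_pow a) x"
proof (cases "x = 0")
  case True
  have "((\<lambda>x. \<bar>x\<bar>) \<longlongrightarrow> (0::real)) (at 0)"
    by (rule tendsto_eq_intros | simp)+
  then have "((\<lambda>x. \<bar>x\<bar> powr (a + 1)) \<longlongrightarrow> 0 powr (a + 1)) (at (0::real))"
    using assms by (intro tendsto_powr2) (auto intro: always_eventually)
  then have "((\<lambda>x. \<bar>sgn_pow a x\<bar>) \<longlongrightarrow> 0) (at (0::real))"
    by (simp add: abs_sgn_pow)
  then show ?thesis
    using True by (simp add: isCont_def tendsto_rabs_zero_iff)
next
  case False
  then show ?thesis
    using DERIV_isCont DERIV_sgn_pow by blast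
qed

lemma continuous_on_sgn_pow [continuous_intros]:
  assumes "a > -1" "continuous_on S f"
  shows "continuous_on S (\<lambda>x. sgn_pow a (f x))"
  using assms isCont_sgn_pow[OF assms(1)]
  by (metis continuous_at_imp_continuous_on continuous_on_compose2 subset_UNIV)

lemma borel_measurable_sgn_pow [measurable]:
  assumes [measurable]: "f \<in> borel_measurable M"
  shows "(\<lambda>x. sgn_pow a (f x)) \<in> borel_measurable M"
  unfolding sgn_pow_def by measurable

lemma DERIV_abs_powr:
  assumes "b > 1"
  shows "((\<lambda>x. \<bar>x\<bar> powr b) has_real_derivative b * sgn_pow (b - 2) x) (at x)"
proof -
  consider "x > 0" | "x < 0" | "x = 0"
    by linarith
  then show ?thesis
  proof cases
    case 1
    have "((\<lambda>x. x powr b) has_real_derivative b * x powr (b - 1)) (at x)"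
      using 1 by (auto intro!: derivative_eq_intros)
    also have "b * x powr (b - 1) = b * sgn_pow (b - 2) x"
      using 1 by (simp add: sgn_pow_pos)
    finally show ?thesis
      by (rule has_field_derivative_transform_within_open[of _ _ _ "{0<..}"]) (use 1 in auto)
  next
    case 2
    have "((\<lambda>x. (- x) powr b) has_real_derivative - (b * (- x) powr (b - 1))) (at x)"
      using 2 by (auto intro!: derivative_eq_intros)
    also have "- (b * (- x) powr (b - 1)) = b * sgn_pow (b - 2) x"
    proof -
      have "sgn_pow (b - 2) (- x) = (- x) powr (b - 1)"
        using 2 sgn_pow_pos[of "-x" "b - 2"] by (simp del: sgn_pow_minus)
      then show ?thesis
        by (metis minus_minus mult_minus_right sgn_pow_minus)
    qed
    finally show ?thesis
      by (rule has_field_derivative_transform_within_open[of _ _ _ "{..<0}"]) (use 2 in auto)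
  next
    case 3
    have "((\<lambda>x. \<bar>x\<bar> powr b / x) \<longlongrightarrow> 0) (at 0)"
    proof (rule tendsto_rabs_zero_cancel)
      have "((\<lambda>x. \<bar>x\<bar>) \<longlongrightarrow> (0::real)) (at 0)"
        by (rule tendsto_eq_intros | simp)+
      then have "((\<lambda>x. \<bar>x\<bar> powr (b - 1)) \<longlongrightarrow> 0 powr (b - 1)) (at (0::real))"
        using assms by (intro tendsto_powr2) (auto intro: always_eventually)
      then show "((\<lambda>x. \<bar>\<bar>x\<bar> powr b / x\<bar>) \<longlongrightarrow> 0) (at 0)"
        by (simp add: powr_diff)
    qed
    then show ?thesis
      using 3 by (simp add: DERIV_def)
  qed
qed

section \<open>The equation solved for the second derivative of W, and its potential\<close>

definition ode_rhs :: "real \<Rightarrow> real \<Rightarrow> real \<Rightarrow> real" where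
  "ode_rhs p lam x =
     - ((p - 1) * sgn_pow (2 / (p - 1)) x - lam * sgn_pow ((2 - p) / (p - 1)) x) / p"

lemma continuous_on_ode_rhs [continuous_intros]:
  assumes "p > 1" "continuous_on S f"
  shows "continuous_on S (\<lambda>x. ode_rhs p lam (f x))"
proof -
  have "2 / (p - 1) > -1" "(2 - p) / (p - 1) > -1"
    using assms by (auto simp: field_simps intro: less_trans[of _ 0])
  then show ?thesis
    unfolding ode_rhs_def using assms by (intro continuous_intros) auto
qed

text \<open>Expressed through k, the two odd powers of W collapse to |k|^p k and k. The explicit
  solutions are checked in this form.\<close>

lemma ode_rhs_sgn_pow:
  assumes "p > 1"
  shows "ode_rhs p lam (sgn_pow (p - 2) k) = - ((p - 1) * \<bar>k\<bar> powr p - lam) * k / p"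
proof -
  have "2 / (p - 1) * (p - 2 + 1) + (p - 2) = p"
    using assms by (simp add: field_simps)
  then have "sgn_pow (2 / (p - 1)) (sgn_pow (p - 2) k) = \<bar>k\<bar> powr p * k"
    using sgn_pow_def[of p k] by (simp only: sgn_pow_sgn_pow)
  then show ?thesis
    using assms by (simp only: ode_rhs_def sgn_pow_inverse) (simp add: algebra_simps)
qed

lemma F_pot_sgn_pow:
  assumes "p > 1"
  shows "F_pot p lam (sgn_pow (p - 2) k) =
    (p - 1)\<^sup>2 * (\<bar>k\<bar> powr p)\<^sup>2 - 2 * lam * (p - 1) * \<bar>k\<bar> powr p"
proof -
  have "(p - 2 + 1) * (2 * p / (p - 1)) = p + p" "(p - 2 + 1) * (p / (p - 1)) = p"
    using assms by (simp_all add: field_simps)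
  then show ?thesis
    by (simp only: F_pot_def abs_sgn_pow powr_powr powr_add[of _ p p] power2_eq_square)
qed

text \<open>The factor - 2 p^2 is what makes p^2 W'^2 + F(W) constant along solutions. Both
  exponents in \<open>F_pot\<close> exceed 1, so it is C^1 even at 0, where \<open>ode_rhs\<close>
  need not be Lipschitz.\<close>

lemma DERIV_F_pot:
  assumes "p > 1"
  shows "(F_pot p lam has_real_derivative - (2 * p\<^sup>2 * ode_rhs p lam x)) (at x)"
proof -
  have "2 * p / (p - 1) > 1" "p / (p - 1) > 1"
    using assms by (auto simp: field_simps)
  then have "((\<lambda>x. (p - 1)\<^sup>2 * \<bar>x\<bar> powr (2 * p / (p - 1)) - 2 * lam * (p - 1) * \<bar>x\<bar> powr (p / (p - 1)))
    has_real_derivative (p - 1)\<^sup>2 * (2 * p / (p - 1) * sgn_pow (2 * p / (p - 1) - 2) x)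
      - 2 * lam * (p - 1) * (p / (p - 1) * sgn_pow (p / (p - 1) - 2) x)) (at x)"
    by (intro DERIV_diff DERIV_cmult DERIV_abs_powr)
  also have "2 * p / (p - 1) - 2 = 2 / (p - 1)"
    using assms by (simp add: field_simps)
  also have "p / (p - 1) - 2 = (2 - p) / (p - 1)"
    using assms by (simp add: field_simps)
  also have "(p - 1)\<^sup>2 * (2 * p / (p - 1) * sgn_pow (2 / (p - 1)) x)
      - 2 * lam * (p - 1) * (p / (p - 1) * sgn_pow ((2 - p) / (p - 1)) x)
    = - (2 * p\<^sup>2 * ode_rhs p lam x)"
  proof -
    have "(p - 1)\<^sup>2 * (2 * p / (p - 1) * a) - 2 * lam * (p - 1) * (p / (p - 1) * b)
      = 2 * p * ((p - 1) * a - lam * b)" for a b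
    proof -
      have "p - 1 \<noteq> 0"
        using assms by simp
      then have "(p - 1)\<^sup>2 * (2 * p / (p - 1) * a) = 2 * p * (p - 1) * a"
        "2 * lam * (p - 1) * (p / (p - 1) * b) = 2 * p * lam * b"
        by (simp_all add: power2_eq_square)
      then show ?thesis
        by (simp add: algebra_simps)
    qed
    note * = this
    have "2 * p * y = - (2 * p\<^sup>2 * (- y / p))" for y
      using assms by (simp add: power2_eq_square)
    then show ?thesis
      unfolding * ode_rhs_def by blast
  qed
  finally show ?thesis
    unfolding F_pot_def[abs_def] .
qed

subsection \<open>Local uniqueness and conservation of energy\<close>

definition locally_lipschitz_at :: "(real \<Rightarrow> real) \<Rightarrow> real \<Rightarrow> bool" where
  "locally_lipschitz_at f x \<longleftrightarrow>
     (\<exists>\<delta>>0. \<exists>K\<ge>0. \<forall>a b. \<bar>a - x\<bar> < \<delta> \<longrightarrow> \<bar>b - x\<bar> < \<delta> \<longrightarrow> \<bar>f a - f b\<bar> \<le> K * \<bar>a - b\<bar>)"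

lemma locally_lipschitz_at_C1:
  assumes "eventually (\<lambda>x. (f has_real_derivative f' x) (at x)) (nhds x0)" "isCont f' x0"
  shows "locally_lipschitz_at f x0"
proof -
  have "eventually (\<lambda>x. \<bar>f' x - f' x0\<bar> < 1) (nhds x0)"
    using assms(2) unfolding isCont_def tendsto_at_iff_tendsto_nhds
    by (auto simp: tendsto_iff dist_real_def)
  then have "eventually (\<lambda>x. (f has_real_derivative f' x) (at x) \<and> \<bar>f' x - f' x0\<bar> < 1) (nhds x0)"
    using assms(1) by (rule eventually_conj[rotated])
  then obtain \<delta> where \<delta>: "\<delta> > 0"
    "\<And>x. dist x x0 < \<delta> \<Longrightarrow> (f has_real_derivative f' x) (at x) \<and> \<bar>f' x - f' x0\<bar> < 1"
    unfolding eventually_nhds_metric by blast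
  have "\<bar>f a - f b\<bar> \<le> (\<bar>f' x0\<bar> + 1) * \<bar>a - b\<bar>" if "\<bar>a - x0\<bar> < \<delta>" "\<bar>b - x0\<bar> < \<delta>" for a b
  proof -
    have "norm (f a - f b) \<le> (\<bar>f' x0\<bar> + 1) * norm (a - b)"
    proof (rule field_differentiable_bound[of "ball x0 \<delta>" f f'])
      show "(f has_real_derivative f' z) (at z within ball x0 \<delta>)" if "z \<in> ball x0 \<delta>" for z
        using \<delta>(2)[of z] that by (simp add: dist_commute has_field_derivative_at_within)
      show "norm (f' z) \<le> \<bar>f' x0\<bar> + 1" if "z \<in> ball x0 \<delta>" for z
        using \<delta>(2)[of z] that by (auto simp: dist_commute)
    qed (use that in \<open>auto simp: dist_real_def abs_minus_commute\<close>)
    then show ?thesis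
      by simp
  qed
  then show ?thesis
    unfolding locally_lipschitz_at_def using \<delta>(1)
    by (intro exI[of _ \<delta>] conjI exI[of _ "\<bar>f' x0\<bar> + 1"]) auto
qed

lemma DERIV_sgn_pow_eventually:
  assumes "a > 0 \<or> x \<noteq> 0"
  shows "eventually (\<lambda>x. (sgn_pow a has_real_derivative (a + 1) * \<bar>x\<bar> powr a) (at x)) (nhds x)"
proof (cases "a > 0")
  case True
  then show ?thesis
    by (auto intro!: always_eventually DERIV_sgn_pow)
next
  case False
  with assms have "eventually (\<lambda>x::real. x \<noteq> 0) (nhds x)"
    using t1_space_nhds by blast
  then show ?thesis
    by eventually_elim (auto intro!: DERIV_sgn_pow)
qed

lemma isCont_abs_powr:
  fixes x :: real
  assumes "a > 0 \<or> x \<noteq> 0"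
  shows "isCont (\<lambda>x. \<bar>x\<bar> powr a) x"
proof (cases "x = 0")
  case True
  then show ?thesis
    using assms unfolding isCont_def
    by (intro tendsto_powr2 tendsto_rabs) (auto intro: always_eventually tendsto_eq_intros)
qed (auto intro!: continuous_intros)

text \<open>The critical exponent is (2 - p)/(p - 1): it is positive for p < 2, so the derivative is
  continuous everywhere, and negative for p > 2, so 0 has to be avoided.\<close>

lemma locally_lipschitz_at_ode_rhs:
  assumes "p > 1" "p \<le> 2 \<or> x \<noteq> 0"
  shows "locally_lipschitz_at (ode_rhs p lam) x"
\<comment> \<open>Here the critical exponent is 0 and \<open>DERIV_sgn_pow\<close> does not reach x
  = 0, but the term in question is simply lam * x.\<close>
proof (cases "p = 2 \<and> x = 0")
  case True
  have "ode_rhs p lam = (\<lambda>x. - ((p - 1) * sgn_pow 2 x - lam * x) / p)"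
    using True by (auto simp: ode_rhs_def)
  moreover have "eventually (\<lambda>x. ((\<lambda>x. - ((p - 1) * sgn_pow 2 x - lam * x) / p) has_real_derivative
      - ((p - 1) * ((2 + 1) * \<bar>x\<bar> powr 2) - lam) / p) (at x)) (nhds x)"
    by (intro always_eventually allI DERIV_cdivide DERIV_minus DERIV_diff DERIV_cmult DERIV_sgn_pow
        DERIV_cmult_Id) auto
  moreover have "isCont (\<lambda>x. - ((p - 1) * ((2 + 1) * \<bar>x\<bar> powr 2) - lam) / p) x"
    using assms by (intro continuous_intros isCont_abs_powr) auto
  ultimately show ?thesis
    using locally_lipschitz_at_C1 by metis
next
  case False
  then have *: "2 / (p - 1) > 0 \<or> x \<noteq> 0" "(2 - p) / (p - 1) > 0 \<or> x \<noteq> 0"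
    using assms by (auto simp: field_simps)
  show ?thesis
  proof (rule locally_lipschitz_at_C1)
    show "\<forall>\<^sub>F x in nhds x. (ode_rhs p lam has_real_derivative
        - ((p - 1) * ((2 / (p - 1) + 1) * \<bar>x\<bar> powr (2 / (p - 1)))
           - lam * (((2 - p) / (p - 1) + 1) * \<bar>x\<bar> powr ((2 - p) / (p - 1)))) / p) (at x)"
      using DERIV_sgn_pow_eventually[OF *(1)] DERIV_sgn_pow_eventually[OF *(2)]
      by eventually_elim
        (unfold ode_rhs_def[abs_def], intro DERIV_cdivide DERIV_minus DERIV_diff DERIV_cmult)
    show "isCont (\<lambda>x. - ((p - 1) * ((2 / (p - 1) + 1) * \<bar>x\<bar> powr (2 / (p - 1)))
           - lam * (((2 - p) / (p - 1) + 1) * \<bar>x\<bar> powr ((2 - p) / (p - 1)))) / p) x"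
      using assms by (intro isCont_divide isCont_minus isCont_diff isCont_mult continuous_const
          isCont_abs_powr *) auto
  qed
qed

lemma locally_lipschitz_at_F_pot:
  assumes "p > 1"
  shows "locally_lipschitz_at (F_pot p lam) x"
proof (rule locally_lipschitz_at_C1)
  show "eventually (\<lambda>x. (F_pot p lam has_real_derivative - (2 * p\<^sup>2 * ode_rhs p lam x)) (at x)) (nhds x)"
    using assms by (intro always_eventually allI DERIV_F_pot)
  have "continuous_on UNIV (\<lambda>x. - (2 * p\<^sup>2 * ode_rhs p lam x))"
    using assms by (intro continuous_intros)
  then show "isCont (\<lambda>x. - (2 * p\<^sup>2 * ode_rhs p lam x)) x"
    by (simp add: continuous_on_eq_continuous_at)
qed

text \<open>The weight exp (- K s) to the right of \<open>t0\<close>, and exp (K s) to the left of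
  it, turns the differential inequality into monotonicity: the weighted E does not grow away from
  \<open>t0\<close>, where it is 0.\<close>

lemma gronwall_zero:
  fixes E :: "real \<Rightarrow> real"
  assumes S: "is_interval S" "t0 \<in> S" and "E t0 = 0"
    and E: "\<And>s. s \<in> S \<Longrightarrow> E s \<ge> 0"
    and E': "\<And>s. s \<in> S \<Longrightarrow> (E has_real_derivative E' s) (at s within S)"
    and bound: "\<And>s. s \<in> S \<Longrightarrow> \<bar>E' s\<bar> \<le> K * E s"
    and s: "s \<in> S"
  shows "E s = 0"
proof (cases "t0 \<le> s")
  case True
  have sub: "{t0..s} \<subseteq> S"
    using S s by (meson atLeastAtMost_iff mem_is_interval_1_I subsetI)
  have "\<exists>x\<in>{t0..s}. E s * exp (- K * s) - E t0 * exp (- K * t0)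
      = (\<lambda>h. (E' x - K * E x) * exp (- K * x) * h) (s - t0)"
  proof (rule mvt_very_simple[OF True])
    fix x assume "t0 \<le> x" "x \<le> s"
    then have "(E has_real_derivative E' x) (at x within {t0..s})"
      using E' sub by (intro DERIV_subset[OF _ sub]) auto
    then have "((\<lambda>x. E x * exp (- K * x)) has_real_derivative
       (E' x - K * E x) * exp (- K * x)) (at x within {t0..s})"
      by (auto intro!: derivative_eq_intros simp: algebra_simps)
    then show "((\<lambda>x. E x * exp (- K * x)) has_derivative
       (\<lambda>h. (E' x - K * E x) * exp (- K * x) * h)) (at x within {t0..s})"
      by (simp add: has_field_derivative_def)
  qed
  then obtain x where x: "x \<in> {t0..s}"
    "E s * exp (- K * s) = (E' x - K * E x) * exp (- K * x) * (s - t0)"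
    using \<open>E t0 = 0\<close> by auto
  have "E' x - K * E x \<le> 0"
    using bound[of x] sub x(1) by auto
  then have "E s * exp (- K * s) \<le> 0"
    using True unfolding x(2) by (intro mult_nonpos_nonneg) auto
  then show ?thesis
    using E[OF s] by (simp add: mult_le_0_iff)
next
  case False
  have sub: "{s..t0} \<subseteq> S"
    using S s by (meson atLeastAtMost_iff mem_is_interval_1_I subsetI)
  have "\<exists>x\<in>{s..t0}. E t0 * exp (K * t0) - E s * exp (K * s)
      = (\<lambda>h. (E' x + K * E x) * exp (K * x) * h) (t0 - s)"
  proof (rule mvt_very_simple)
    fix x assume "s \<le> x" "x \<le> t0"
    then have "(E has_real_derivative E' x) (at x within {s..t0})"
      using E' sub by (intro DERIV_subset[OF _ sub]) auto
    then have "((\<lambda>x. E x * exp (K * x)) has_real_derivative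
       (E' x + K * E x) * exp (K * x)) (at x within {s..t0})"
      by (auto intro!: derivative_eq_intros simp: algebra_simps)
    then show "((\<lambda>x. E x * exp (K * x)) has_derivative
       (\<lambda>h. (E' x + K * E x) * exp (K * x) * h)) (at x within {s..t0})"
      by (simp add: has_field_derivative_def)
  qed (use False in simp)
  then obtain x where x: "x \<in> {s..t0}"
    "- (E s * exp (K * s)) = (E' x + K * E x) * exp (K * x) * (t0 - s)"
    using \<open>E t0 = 0\<close> by auto
  have "E' x + K * E x \<ge> 0"
    using bound[of x] sub x(1) by auto
  then have "- (E s * exp (K * s)) \<ge> 0"
    using False unfolding x(2) by (intro mult_nonneg_nonneg) auto
  then show ?thesis
    using E[OF s] by (simp add: mult_le_0_iff)
qed

text \<open>Derivatives are taken within S, hence one-sided at the end points of {0..L}, where the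
  initial values are prescribed.\<close>

definition ode_solution :: "real \<Rightarrow> real \<Rightarrow> real set \<Rightarrow> (real \<Rightarrow> real) \<Rightarrow> (real \<Rightarrow> real) \<Rightarrow> bool" where
  "ode_solution p lam S y y1 \<longleftrightarrow>
     (\<forall>s\<in>S. (y has_real_derivative y1 s) (at s within S) \<and>
            (y1 has_real_derivative ode_rhs p lam (y s)) (at s within S))"

lemma ode_solution_subset: "ode_solution p lam S y y1 \<Longrightarrow> T \<subseteq> S \<Longrightarrow> ode_solution p lam T y y1"
  unfolding ode_solution_def using DERIV_subset by (metis subsetD)

lemma ode_solution_continuous:
  assumes "ode_solution p lam S y y1"
  shows "continuous_on S y" "continuous_on S y1"
  using assms unfolding ode_solution_def by (meson DERIV_continuous_on)+

definition energy :: "real \<Rightarrow> real \<Rightarrow> real \<Rightarrow> real \<Rightarrow> real" where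
  "energy p lam y v = p\<^sup>2 * v\<^sup>2 + F_pot p lam y"

lemma energy_const:
  assumes "p > 1" "ode_solution p lam S y y1" "is_interval S" "s \<in> S" "t \<in> S"
  shows "energy p lam (y s) (y1 s) = energy p lam (y t) (y1 t)"
proof -
  have "((\<lambda>s. energy p lam (y s) (y1 s)) has_real_derivative 0) (at s within S)" if "s \<in> S" for s
  proof -
    have "((\<lambda>s. F_pot p lam (y s)) has_real_derivative
        - (2 * p\<^sup>2 * ode_rhs p lam (y s)) * y1 s) (at s within S)"
      using assms that DERIV_F_pot[OF assms(1)] unfolding ode_solution_def
      by (intro DERIV_chain2) auto
    moreover have "((\<lambda>s. p\<^sup>2 * (y1 s)\<^sup>2) has_real_derivative
        p\<^sup>2 * (2 * y1 s * ode_rhs p lam (y s))) (at s within S)"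
      using assms that unfolding ode_solution_def by (auto intro!: derivative_eq_intros)
    ultimately have "((\<lambda>s. energy p lam (y s) (y1 s)) has_real_derivative
        p\<^sup>2 * (2 * y1 s * ode_rhs p lam (y s)) + - (2 * p\<^sup>2 * ode_rhs p lam (y s)) * y1 s) (at s within S)"
      unfolding energy_def by (rule DERIV_add[rotated])
    then show ?thesis
      by (simp add: algebra_simps)
  qed
  then obtain c where "\<And>s. s \<in> S \<Longrightarrow> energy p lam (y s) (y1 s) = c"
    using has_field_derivative_zero_constant[of S "\<lambda>s. energy p lam (y s) (y1 s)"]
      is_interval_convex[OF assms(3)] by blast
  then show ?thesis
    using assms by simp
qed

lemma tendsto_within_bound:
  fixes y :: "real \<Rightarrow> real"
  assumes "continuous_on S y" "t \<in> S" "\<epsilon> > 0"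
  shows "eventually (\<lambda>s. \<bar>y s - y t\<bar> < \<epsilon>) (at t within S)"
proof -
  have "(y \<longlongrightarrow> y t) (at t within S)"
    using assms by (simp add: continuous_on_def)
  from tendstoD[OF this assms(3)] show ?thesis
    by (simp add: dist_real_def)
qed

text \<open>Away from a singular zero, Gronwall applies to the squared distance of the states. At a
  zero with nonzero velocity it applies to the squared distance of the positions alone: subtracting
  the two energy identities bounds the difference of the velocities by that of the positions, as
  \<open>F_pot\<close> is Lipschitz.\<close>

lemma ode_local_uniqueness:
  assumes p: "p > 1" and S: "is_interval S" "t \<in> S"
    and sol: "ode_solution p lam S y y1" "ode_solution p lam S z z1"
    and t: "y t = z t" "y1 t = z1 t" and reg: "p \<le> 2 \<or> y t \<noteq> 0 \<or> y1 t \<noteq> 0"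
  shows "eventually (\<lambda>s. y s = z s \<and> y1 s = z1 s) (at t within S)"
proof (cases "p \<le> 2 \<or> y t \<noteq> 0")
  case True
  then obtain \<delta> K where \<delta>: "\<delta> > 0" "K \<ge> 0" "\<And>a b. \<bar>a - y t\<bar> < \<delta> \<Longrightarrow> \<bar>b - y t\<bar> < \<delta> \<Longrightarrow>
      \<bar>ode_rhs p lam a - ode_rhs p lam b\<bar> \<le> K * \<bar>a - b\<bar>"
    using locally_lipschitz_at_ode_rhs[OF p] unfolding locally_lipschitz_at_def by metis
  have "eventually (\<lambda>s. \<bar>y s - y t\<bar> < \<delta> \<and> \<bar>z s - z t\<bar> < \<delta>) (at t within S)"
    using sol S \<delta>(1) by (intro eventually_conj tendsto_within_bound ode_solution_continuous)
  then obtain d where d: "d > 0"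
    "\<And>s. s \<in> S \<Longrightarrow> s \<noteq> t \<Longrightarrow> dist s t < d \<Longrightarrow> \<bar>y s - y t\<bar> < \<delta> \<and> \<bar>z s - z t\<bar> < \<delta>"
    unfolding eventually_at by blast
  have near: "\<bar>y s - y t\<bar> < \<delta> \<and> \<bar>z s - y t\<bar> < \<delta>" if "s \<in> S \<inter> ball t d" for s
    using d(2)[of s] that \<delta>(1) t by (cases "s = t") (auto simp: dist_commute)
  define E where "E s = (y s - z s)\<^sup>2 + (y1 s - z1 s)\<^sup>2" for s
  define E' where "E' s = 2 * (y s - z s) * (y1 s - z1 s)
    + 2 * (y1 s - z1 s) * (ode_rhs p lam (y s) - ode_rhs p lam (z s))" for s
  have "E s = 0" if s: "s \<in> S \<inter> ball t d" for s
  proof (rule gronwall_zero[of "S \<inter> ball t d" t E E' "1 + K"])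
    show "is_interval (S \<inter> ball t d)"
      using S(1) by (intro is_interval_Int) (auto simp: is_interval_ball_real)
    show "E t = 0"
      using t by (simp add: E_def)
    show "t \<in> S \<inter> ball t d"
      using S d by simp
    show "E s \<ge> 0" for s
      by (simp add: E_def)
    show "(E has_real_derivative E' s) (at s within S \<inter> ball t d)" if "s \<in> S \<inter> ball t d" for s
    proof (rule DERIV_subset)
      show "(E has_real_derivative E' s) (at s within S)"
        using sol that unfolding ode_solution_def E_def[abs_def] E'_def
        by (auto intro!: derivative_eq_intros simp: algebra_simps)
    qed auto
    show "\<bar>E' s\<bar> \<le> (1 + K) * E s" if "s \<in> S \<inter> ball t d" for s
    proof -
      define u v where "u = y s - z s" and "v = y1 s - z1 s"
      have *: "\<bar>ode_rhs p lam (y s) - ode_rhs p lam (z s)\<bar> \<le> K * \<bar>u\<bar>"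
        unfolding u_def using near[OF that] by (intro \<delta>) auto
      have "\<bar>E' s\<bar> \<le> 2 * \<bar>u\<bar> * \<bar>v\<bar> + 2 * \<bar>v\<bar> * \<bar>ode_rhs p lam (y s) - ode_rhs p lam (z s)\<bar>"
        unfolding E'_def u_def[symmetric] v_def[symmetric]
        by (rule order_trans[OF abs_triangle_ineq]) (simp add: abs_mult)
      also have "\<dots> \<le> 2 * \<bar>u\<bar> * \<bar>v\<bar> + 2 * \<bar>v\<bar> * (K * \<bar>u\<bar>)"
        using * by (intro add_left_mono mult_left_mono) auto
      also have "\<dots> = (1 + K) * (2 * \<bar>u\<bar> * \<bar>v\<bar>)"
        by (simp add: algebra_simps)
      also have "\<dots> \<le> (1 + K) * (\<bar>u\<bar>\<^sup>2 + \<bar>v\<bar>\<^sup>2)"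
        using \<delta>(2) by (intro mult_left_mono sum_squares_bound) auto
      finally show ?thesis
        by (simp add: E_def u_def v_def)
    qed
  qed fact
  then have "y s = z s \<and> y1 s = z1 s" if "s \<in> S" "dist s t < d" for s
    using that by (simp add: E_def dist_commute sum_power2_eq_zero_iff)
  then show ?thesis
    using d(1) unfolding eventually_at by blast
next
  case False
  then have v: "y1 t \<noteq> 0"
    using reg by simp
  obtain \<delta> K where \<delta>: "\<delta> > 0" "K \<ge> 0" "\<And>a b. \<bar>a - y t\<bar> < \<delta> \<Longrightarrow> \<bar>b - y t\<bar> < \<delta> \<Longrightarrow>
      \<bar>F_pot p lam a - F_pot p lam b\<bar> \<le> K * \<bar>a - b\<bar>"
    using locally_lipschitz_at_F_pot[OF p] unfolding locally_lipschitz_at_def by metis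
  have "eventually (\<lambda>s. (\<bar>y s - y t\<bar> < \<delta> \<and> \<bar>z s - z t\<bar> < \<delta>)
      \<and> (\<bar>y1 s - y1 t\<bar> < \<bar>y1 t\<bar> / 2 \<and> \<bar>z1 s - z1 t\<bar> < \<bar>y1 t\<bar> / 2)) (at t within S)"
    using sol S \<delta>(1) v by (intro eventually_conj tendsto_within_bound ode_solution_continuous) auto
  then obtain d where d: "d > 0"
    "\<And>s. s \<in> S \<Longrightarrow> s \<noteq> t \<Longrightarrow> dist s t < d \<Longrightarrow> (\<bar>y s - y t\<bar> < \<delta> \<and> \<bar>z s - z t\<bar> < \<delta>)
      \<and> (\<bar>y1 s - y1 t\<bar> < \<bar>y1 t\<bar> / 2 \<and> \<bar>z1 s - z1 t\<bar> < \<bar>y1 t\<bar> / 2)"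
    unfolding eventually_at by blast
  have near: "\<bar>y s - y t\<bar> < \<delta> \<and> \<bar>z s - y t\<bar> < \<delta> \<and> \<bar>y1 s - y1 t\<bar> < \<bar>y1 t\<bar> / 2
      \<and> \<bar>z1 s - y1 t\<bar> < \<bar>y1 t\<bar> / 2" if "s \<in> S \<inter> ball t d" for s
    using d(2)[of s] that \<delta>(1) t v by (cases "s = t") (auto simp: dist_commute)
  define K' where "K' = K / (p\<^sup>2 * \<bar>y1 t\<bar>)"
  have K': "\<bar>y1 s - z1 s\<bar> \<le> K' * \<bar>y s - z s\<bar>" if s: "s \<in> S \<inter> ball t d" for s
  proof -
    have "energy p lam (y s) (y1 s) = energy p lam (y t) (y1 t)"
      "energy p lam (z s) (z1 s) = energy p lam (z t) (z1 t)"
      using s S sol p by (auto intro: energy_const)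
    then have "p\<^sup>2 * ((y1 s)\<^sup>2 - (z1 s)\<^sup>2) = F_pot p lam (z s) - F_pot p lam (y s)"
      using t by (simp add: energy_def algebra_simps)
    then have "p\<^sup>2 * ((y1 s + z1 s) * (y1 s - z1 s)) = F_pot p lam (z s) - F_pot p lam (y s)"
      by (simp add: power2_eq_square algebra_simps)
    then have "p\<^sup>2 * (\<bar>y1 s + z1 s\<bar> * \<bar>y1 s - z1 s\<bar>) = \<bar>F_pot p lam (z s) - F_pot p lam (y s)\<bar>"
      by (metis abs_mult abs_power2 power2_abs)
    also have "\<dots> \<le> K * \<bar>z s - y s\<bar>"
      using near[OF s] by (intro \<delta>) auto
    finally have 1: "p\<^sup>2 * (\<bar>y1 s + z1 s\<bar> * \<bar>y1 s - z1 s\<bar>) \<le> K * \<bar>y s - z s\<bar>"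
      by (simp add: abs_minus_commute)
    \<comment> \<open>Both velocities lie within half of |y1 t| of y1 t, so they share its sign and
      cannot cancel in the sum; this allows the division by y1 s + z1 s.\<close>
    have "\<bar>y1 t\<bar> \<le> \<bar>y1 s + z1 s\<bar>"
      using near[OF s] by (auto simp: abs_if split: if_splits)
    then have "p\<^sup>2 * (\<bar>y1 t\<bar> * \<bar>y1 s - z1 s\<bar>) \<le> p\<^sup>2 * (\<bar>y1 s + z1 s\<bar> * \<bar>y1 s - z1 s\<bar>)"
      by (intro mult_left_mono mult_right_mono) auto
    with 1 have "p\<^sup>2 * \<bar>y1 t\<bar> * \<bar>y1 s - z1 s\<bar> \<le> K * \<bar>y s - z s\<bar>"
      by (simp add: mult.assoc)
    then show ?thesis
      using v p by (simp add: K'_def pos_le_divide_eq mult.commute)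
  qed
  define E where "E s = (y s - z s)\<^sup>2" for s
  define E' where "E' s = 2 * (y s - z s) * (y1 s - z1 s)" for s
  have E0: "E s = 0" if s: "s \<in> S \<inter> ball t d" for s
  proof (rule gronwall_zero[of "S \<inter> ball t d" t E E' "2 * K'"])
    show "is_interval (S \<inter> ball t d)"
      using S(1) by (intro is_interval_Int) (auto simp: is_interval_ball_real)
    show "E t = 0"
      using t by (simp add: E_def)
    show "t \<in> S \<inter> ball t d"
      using S d by simp
    show "E s \<ge> 0" for s
      by (simp add: E_def)
    show "(E has_real_derivative E' s) (at s within S \<inter> ball t d)" if "s \<in> S \<inter> ball t d" for s
    proof (rule DERIV_subset)
      show "(E has_real_derivative E' s) (at s within S)"
        using sol that unfolding ode_solution_def E_def[abs_def] E'_def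
        by (auto intro!: derivative_eq_intros simp: algebra_simps)
    qed auto
    show "\<bar>E' s\<bar> \<le> 2 * K' * E s" if "s \<in> S \<inter> ball t d" for s
    proof -
      have "\<bar>E' s\<bar> = 2 * \<bar>y s - z s\<bar> * \<bar>y1 s - z1 s\<bar>"
        by (simp add: E'_def abs_mult del: right_diff_distrib_numeral)
      also have "\<dots> \<le> 2 * \<bar>y s - z s\<bar> * (K' * \<bar>y s - z s\<bar>)"
        using K'[OF that] by (intro mult_left_mono) auto
      also have "\<dots> = 2 * K' * \<bar>y s - z s\<bar>\<^sup>2"
        by (simp add: power2_eq_square algebra_simps)
      finally show ?thesis
        by (simp add: E_def)
    qed
  qed fact
  have "y s = z s \<and> y1 s = z1 s" if "s \<in> S" "dist s t < d" for s
    using that E0[of s] K'[of s] by (auto simp: E_def dist_commute)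
  then show ?thesis
    using d(1) unfolding eventually_at by blast
qed

text \<open>The set where the states agree is closed by continuity, open by local uniqueness, and S
  is connected. Regularity is asked of z only, because at a point of agreement y has the same
  state.\<close>

lemma ode_uniqueness:
  assumes p: "p > 1" and S: "is_interval S" "t0 \<in> S"
    and sol: "ode_solution p lam S y y1" "ode_solution p lam S z z1"
    and t0: "y t0 = z t0" "y1 t0 = z1 t0"
    and reg: "\<And>s. s \<in> S \<Longrightarrow> p \<le> 2 \<or> z s \<noteq> 0 \<or> z1 s \<noteq> 0" and s: "s \<in> S"
  shows "y s = z s \<and> y1 s = z1 s"
proof -
  define T where "T = {s \<in> S. y s = z s \<and> y1 s = z1 s}"
  have "closedin (top_of_set S) {s \<in> S. y s - z s = 0}"
    using sol by (intro continuous_closedin_preimage_constant continuous_intros ode_solution_continuous)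
  moreover have "closedin (top_of_set S) {s \<in> S. y1 s - z1 s = 0}"
    using sol by (intro continuous_closedin_preimage_constant continuous_intros ode_solution_continuous)
  ultimately have "closedin (top_of_set S) ({s \<in> S. y s - z s = 0} \<inter> {s \<in> S. y1 s - z1 s = 0})"
    by (rule closedin_Int)
  also have "{s \<in> S. y s - z s = 0} \<inter> {s \<in> S. y1 s - z1 s = 0} = T"
    by (auto simp: T_def)
  finally have "closedin (top_of_set S) T" .
  moreover have "openin (top_of_set S) T"
    unfolding openin_euclidean_subtopology_iff
  proof (intro conjI ballI)
    fix t assume t: "t \<in> T"
    then have "eventually (\<lambda>s. y s = z s \<and> y1 s = z1 s) (at t within S)"
      using reg[of t] p S sol by (intro ode_local_uniqueness) (auto simp: T_def)
    then show "\<exists>e>0. \<forall>x'\<in>S. dist x' t < e \<longrightarrow> x' \<in> T"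
      using t unfolding eventually_at T_def by fastforce
  qed (auto simp: T_def)
  moreover have "connected S"
    using S(1) by (simp add: is_interval_connected)
  moreover have "t0 \<in> T"
    using t0 S by (simp add: T_def)
  ultimately have "T = S"
    by (metis connected_clopen empty_iff)
  then show ?thesis
    using s by (auto simp: T_def)
qed

subsection \<open>Regularity of weak solutions\<close>

text \<open>Smoothness with explicit witnesses for the derivatives. It is closed under sums,
  products and affine substitutions by plain induction, with no computation of
  \<open>deriv ^^ n\<close> as in \<open>test_function\<close>.\<close>

primrec times_differentiable :: "nat \<Rightarrow> (real \<Rightarrow> real) \<Rightarrow> bool" where
  "times_differentiable 0 f \<longleftrightarrow> True"
| "times_differentiable (Suc n) f \<longleftrightarrow>
     (\<exists>f'. (\<forall>x. (f has_real_derivative f' x) (at x)) \<and> times_differentiable n f')"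

lemma times_differentiable_Suc_I:
  "(\<And>x. (f has_real_derivative f' x) (at x)) \<Longrightarrow> times_differentiable n f' \<Longrightarrow>
    times_differentiable (Suc n) f"
  by auto

lemma times_differentiable_SucD: "times_differentiable (Suc n) f \<Longrightarrow> times_differentiable n f"
proof (induction n arbitrary: f)
  case (Suc n)
  then show ?case
    by (metis times_differentiable.simps(2))
qed simp

lemma times_differentiable_const: "times_differentiable n (\<lambda>x. c)"
proof (induction n arbitrary: c)
  case (Suc n)
  show ?case
    by (rule times_differentiable_Suc_I[of _ "\<lambda>x. 0"]) (use Suc in auto)
qed simp

lemma times_differentiable_add:
  "times_differentiable n f \<Longrightarrow> times_differentiable n g \<Longrightarrow> times_differentiable n (\<lambda>x. f x + g x)"
proof (induction n arbitrary: f g)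
  case (Suc n)
  then obtain f' g' where "\<And>x. (f has_real_derivative f' x) (at x)" "times_differentiable n f'"
    "\<And>x. (g has_real_derivative g' x) (at x)" "times_differentiable n g'"
    by auto
  then show ?case
    using Suc.IH[of f' g'] by (intro times_differentiable_Suc_I[of _ "\<lambda>x. f' x + g' x"] DERIV_add) auto
qed simp

lemma times_differentiable_mult:
  "times_differentiable n f \<Longrightarrow> times_differentiable n g \<Longrightarrow> times_differentiable n (\<lambda>x. f x * g x)"
proof (induction n arbitrary: f g)
  case (Suc n)
  then obtain f' g' where *: "\<And>x. (f has_real_derivative f' x) (at x)" "times_differentiable n f'"
    "\<And>x. (g has_real_derivative g' x) (at x)" "times_differentiable n g'"
    by auto
  have "times_differentiable n (\<lambda>x. f' x * g x + f x * g' x)"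
    using times_differentiable_add[OF Suc.IH[OF *(2) times_differentiable_SucD[OF Suc.prems(2)]]
        Suc.IH[OF times_differentiable_SucD[OF Suc.prems(1)] *(4)]] .
  moreover have "((\<lambda>x. f x * g x) has_real_derivative f' x * g x + f x * g' x) (at x)" for x
    using DERIV_mult[OF *(1,3)] by (simp add: mult.commute)
  ultimately show ?case
    by (rule times_differentiable_Suc_I[rotated])
qed simp

lemma times_differentiable_affine:
  "times_differentiable n f \<Longrightarrow> times_differentiable n (\<lambda>x. f (a * x + b))"
proof (induction n arbitrary: f)
  case (Suc n)
  then obtain f' where *: "\<And>x. (f has_real_derivative f' x) (at x)" "times_differentiable n f'"
    by auto
  have "times_differentiable n (\<lambda>x. f' (a * x + b) * a)"
    using *(2) by (intro times_differentiable_mult times_differentiable_const Suc.IH)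
  moreover have "((\<lambda>x. f (a * x + b)) has_real_derivative f' (a * x + b) * a) (at x)" for x
    by (rule DERIV_chain2[OF *(1)]) (auto intro!: derivative_eq_intros)
  ultimately show ?case
    by (rule times_differentiable_Suc_I[rotated])
qed simp

lemma times_differentiable_deriv:
  assumes "times_differentiable (Suc n) f"
  shows "times_differentiable n (deriv f)" "f differentiable (at x)"
proof -
  obtain f' where f': "\<And>x. (f has_real_derivative f' x) (at x)" "times_differentiable n f'"
    using assms by auto
  then have "deriv f = f'"
    by (auto intro!: DERIV_imp_deriv)
  then show "times_differentiable n (deriv f)"
    using f' by simp
  show "f differentiable (at x)"
    using f'(1)[of x] by (auto simp: real_differentiable_def)
qed

lemma test_functionI:
  assumes "\<And>n. times_differentiable n \<phi>" "\<And>s. \<phi> s \<noteq> 0 \<Longrightarrow> s \<in> {a..b}" "0 < a" "b < L"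
  shows "test_function L \<phi>"
proof -
  have "(deriv ^^ n) f differentiable (at x)" if "times_differentiable (Suc n) f" for n x f
    using that
  proof (induction n arbitrary: f)
    case 0
    then show ?case
      using times_differentiable_deriv(2)[of 0 f x] by simp
  next
    case (Suc n)
    then show ?case
      using times_differentiable_deriv(1) by (metis comp_apply funpow_Suc_right)
  qed
  moreover have "closure {x. \<phi> x \<noteq> 0} \<subseteq> {a..b}"
    using assms(2) by (intro closure_minimal) auto
  ultimately show ?thesis
    unfolding test_function_def using assms
    by (auto simp del: times_differentiable.simps
        intro: compact_closure[THEN iffD2] bounded_subset[of "{a..b}"])
qed

section \<open>Smooth bumps and their second antiderivatives\<close>

definition exp_bump :: "nat \<Rightarrow> real \<Rightarrow> real" where
  "exp_bump n x = (if x > 0 then exp (- 1 / x) / x ^ n else 0)"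

text \<open>Carrying the powers of 1/x along makes the family closed under differentiation up to
  linear combinations, so smoothness of all members follows by one induction. At 0 the exponential
  beats every power.\<close>

lemma DERIV_exp_bump:
  "(exp_bump n has_real_derivative exp_bump (n + 2) x - real n * exp_bump (n + 1) x) (at x)"
proof -
  consider "x > 0" | "x < 0" | "x = 0"
    by linarith
  then show ?thesis
  proof cases
    case 1
    have "((\<lambda>x. exp (- 1 / x) / x ^ n) has_real_derivative
        exp (- 1 / x) / x ^ (n + 2) - real n * (exp (- 1 / x) / x ^ (n + 1))) (at x)"
    proof (cases n)
      case 0
      then show ?thesis
        using 1 by (auto intro!: derivative_eq_intros simp: power2_eq_square)
    next
      case (Suc m)
      then show ?thesis
        using 1 by (auto intro!: derivative_eq_intros simp: divide_simps power2_eq_square)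
          ((simp add: algebra_simps; cases m; simp)+)
    qed
    then have "((\<lambda>x. exp (- 1 / x) / x ^ n) has_real_derivative
        exp_bump (n + 2) x - real n * exp_bump (n + 1) x) (at x)"
      using 1 by (simp add: exp_bump_def)
    then show ?thesis
      by (rule has_field_derivative_transform_within_open[of _ _ _ "{0<..}"])
        (use 1 in \<open>auto simp: exp_bump_def\<close>)
  next
    case 2
    have "((\<lambda>x. 0) has_real_derivative exp_bump (n + 2) x - real n * exp_bump (n + 1) x) (at x)"
      using 2 by (simp add: exp_bump_def)
    then show ?thesis
      by (rule has_field_derivative_transform_within_open[of _ _ _ "{..<0}"])
        (use 2 in \<open>auto simp: exp_bump_def\<close>)
  next
    case 3
    have "((\<lambda>x. exp (- 1 / x) / x ^ n / x) \<longlongrightarrow> 0) (at_right (0::real))"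
      by real_asymp
    then have "((\<lambda>x. exp_bump n x / x) \<longlongrightarrow> 0) (at_right 0)"
      by (rule Lim_transform_eventually)
        (auto simp: exp_bump_def eventually_at_filter)
    moreover have "((\<lambda>x. exp_bump n x / x) \<longlongrightarrow> 0) (at_left 0)"
      by (rule Lim_transform_eventually[of "\<lambda>x. 0"])
        (auto simp: exp_bump_def eventually_at_filter)
    ultimately have "((\<lambda>x. exp_bump n x / x) \<longlongrightarrow> 0) (at 0)"
      using filterlim_split_at by blast
    then show ?thesis
      using 3 by (simp add: DERIV_def exp_bump_def)
  qed
qed

lemma times_differentiable_exp_bump: "times_differentiable k (exp_bump n)"
proof (induction k arbitrary: n)
  case (Suc k)
  have "times_differentiable k (\<lambda>x. exp_bump (n + 2) x + (- real n) * exp_bump (n + 1) x)"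
    by (intro times_differentiable_add times_differentiable_mult times_differentiable_const Suc)
  moreover have "(exp_bump n has_real_derivative exp_bump (n + 2) x + (- real n) * exp_bump (n + 1) x) (at x)" for x
    using DERIV_exp_bump[of n x] by simp
  ultimately show ?case
    by (rule times_differentiable_Suc_I[rotated])
qed simp

lemma antiderivative_real:
  fixes f :: "real \<Rightarrow> real"
  assumes "continuous_on UNIV f"
  obtains F where "\<And>x. (F has_real_derivative f x) (at x)"
proof -
  have "\<exists>F. \<forall>x::real. -\<infinity> < ereal x \<longrightarrow> ereal x < \<infinity> \<longrightarrow> (F has_vector_derivative f x) (at x)"
    using assms by (intro einterval_antiderivative) (auto simp: continuous_on_eq_continuous_at)
  then show ?thesis
    using that by (auto simp: has_real_derivative_iff_has_vector_derivative)
qed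

text \<open>\<rho> is the bump exp (-1/x) exp (-1/(1-x)) on the unit interval. Its second
  antiderivative B is smooth, 0 on the left and affine on the right, so a combination of shifted
  copies has compact support as soon as the affine tails cancel.\<close>

lemma double_antiderivative_bump:
  obtains \<rho> R B :: "real \<Rightarrow> real" and M c where
    "continuous_on UNIV \<rho>" "\<And>x. \<rho> x \<ge> 0" "\<And>x. x \<notin> {0..1} \<Longrightarrow> \<rho> x = 0"
    "\<And>x. (R has_real_derivative \<rho> x) (at x)" "\<And>x. x \<le> 0 \<Longrightarrow> R x = 0" "\<And>x. x \<ge> 1 \<Longrightarrow> R x = M"
    "\<And>x. (B has_real_derivative R x) (at x)" "\<And>x. x \<le> 0 \<Longrightarrow> B x = 0" "\<And>x. x \<ge> 1 \<Longrightarrow> B x = M * x + c" "M > 0"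
    "\<And>n. times_differentiable n B"
proof -
  define \<rho> where "\<rho> x = exp_bump 0 x * exp_bump 0 ((-1) * x + 1)" for x
  have smooth: "times_differentiable n \<rho>" for n
    unfolding \<rho>_def[abs_def]
    by (intro times_differentiable_mult times_differentiable_exp_bump
        times_differentiable_affine[of _ "exp_bump 0"])
  have "\<rho> differentiable (at x)" for x
    using times_differentiable_deriv(2) smooth by blast
  then have cont: "continuous_on UNIV \<rho>"
    by (simp add: continuous_at_imp_continuous_on differentiable_imp_continuous_within)
  have nonneg: "\<rho> x \<ge> 0" for x
    by (simp add: \<rho>_def exp_bump_def)
  have zero: "\<rho> x = 0" if "x \<notin> {0<..<1}" for x
    using that by (auto simp: \<rho>_def exp_bump_def)
  have zero': "\<rho> x = 0" if "x \<notin> {0..1}" for x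
    using that by (intro zero) auto
  obtain R0 where "\<And>x. (R0 has_real_derivative \<rho> x) (at x)"
    using antiderivative_real[OF cont] by blast
  then have R: "((\<lambda>x. R0 x - R0 0) has_real_derivative \<rho> x) (at x)" for x
    by (auto intro!: derivative_eq_intros)
  define R where "R x = R0 x - R0 0" for x
  have R': "(R has_real_derivative \<rho> x) (at x)" for x
    using R unfolding R_def[abs_def] .
  then have contR: "continuous_on UNIV R"
    by (meson DERIV_isCont continuous_at_imp_continuous_on)
  obtain B0 where "\<And>x. (B0 has_real_derivative R x) (at x)"
    using antiderivative_real[OF contR] by blast
  then have B: "((\<lambda>x. B0 x - B0 0) has_real_derivative R x) (at x)" for x
    by (auto intro!: derivative_eq_intros)
  define B where "B x = B0 x - B0 0" for x
  have B': "(B has_real_derivative R x) (at x)" for x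
    using B unfolding B_def[abs_def] .
  have const: "f x = f a" if "\<And>x. (f has_real_derivative f' x) (at x)" "\<And>x. x \<in> S \<Longrightarrow> f' x = 0"
    "convex S" "x \<in> S" "a \<in> S" for f f' :: "real \<Rightarrow> real" and x a S
    using has_field_derivative_zero_constant[of S f] that
    by (metis has_field_derivative_at_within)
  have R0: "R x = 0" if "x \<le> 0" for x
    using const[OF R', of "{..0}" x 0] that zero by (auto simp: R_def)
  have B0: "B x = 0" if "x \<le> 0" for x
    using const[OF B', of "{..0}" x 0] that R0 by (auto simp: B_def)
  have R1: "R x = R 1" if "x \<ge> 1" for x
    using const[OF R', of "{1..}" x 1] that zero by auto
  have "((\<lambda>x. B x - R 1 * x) has_real_derivative R x - R 1) (at x)" for x
    using B' by (auto intro!: derivative_eq_intros)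
  moreover have "R x - R 1 = 0" if "x \<in> {1..}" for x
    using R1[of x] that by simp
  ultimately have "B x - R 1 * x = B 1 - R 1 * 1" if "x \<ge> 1" for x
    by (rule const[of _ _ "{1..}"]) (use that in auto)
  then have B1: "B x = R 1 * x + (B 1 - R 1)" if "x \<ge> 1" for x
    using that by (simp add: algebra_simps)
  have "R 0 < R 1"
  proof (rule DERIV_pos_imp_increasing_open[of 0 1 R])
    show "\<exists>y. (R has_real_derivative y) (at x) \<and> y > 0" if "0 < x" "x < 1" for x
      using that R'[of x] by (intro exI[of _ "\<rho> x"]) (auto simp: \<rho>_def exp_bump_def)
  qed (use contR in \<open>auto intro: continuous_on_subset\<close>)
  then have M: "R 1 > 0"
    using R0[of 0] by simp
  have "times_differentiable n B" for n
  proof -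
    have "times_differentiable (Suc (Suc n)) B"
      by (rule times_differentiable_Suc_I[OF B' times_differentiable_Suc_I[OF R' smooth]])
    then show ?thesis
      using times_differentiable_SucD by blast
  qed
  then show ?thesis
    by (intro that[of \<rho> R "R 1" B "B 1 - R 1"] cont nonneg R' B' R0 B0 R1 B1 M zero') simp_all
qed

text \<open>A one-sided approximate identity of mass M: the kernel lives on {x..x + h}, hence inside
  {0..L} once h < L - x, and there g is uniformly close to g x.\<close>

lemma mollified_integral_tendsto:
  fixes g :: "real \<Rightarrow> real"
  assumes \<rho>: "continuous_on UNIV \<rho>" "\<And>x. \<rho> x \<ge> 0" "\<And>x. x \<notin> {0..1} \<Longrightarrow> \<rho> x = 0"
    and R: "\<And>x. (R has_real_derivative \<rho> x) (at x)" "\<And>x. x \<le> 0 \<Longrightarrow> R x = 0" "\<And>x. x \<ge> 1 \<Longrightarrow> R x = M"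
    and g: "continuous_on {0..L} g" and x: "0 < x" "x < L"
  shows "((\<lambda>h. integral {0..L} (\<lambda>s. g s * (\<rho> ((s - x) / h) / h))) \<longlongrightarrow> g x * M) (at_right 0)"
proof (rule tendstoI)
  fix e :: real assume e: "e > 0"
  have "M \<ge> 0"
    using DERIV_nonneg_imp_nondecreasing[of 0 1 R] R \<rho>(2) by force
  define \<eta> where "\<eta> = e / (M + 1)"
  have \<eta>: "\<eta> > 0" "\<eta> * M < e"
    using e \<open>M \<ge> 0\<close> by (auto simp: \<eta>_def field_simps)
  have "x \<in> {0..L}"
    using x by simp
  then obtain d where d: "d > 0" "\<And>s. s \<in> {0..L} \<Longrightarrow> dist s x < d \<Longrightarrow> dist (g s) (g x) < \<eta>"
    using g \<eta>(1) unfolding continuous_on_iff by blast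
  have main: "dist (integral {0..L} (\<lambda>s. g s * (\<rho> ((s - x) / h) / h))) (g x * M) < e"
    if h: "0 < h" "h < d" "h < L - x" for h
  proof -
    have cont\<rho>: "continuous_on {0..L} (\<lambda>s. \<rho> ((s - x) / h) / h)"
      using h by (intro continuous_intros continuous_on_compose2[OF \<rho>(1)]) auto
    have int\<rho>: "((\<lambda>s. \<rho> ((s - x) / h) / h) has_integral (R ((L - x) / h) - R ((0 - x) / h))) {0..L}"
    proof (rule fundamental_theorem_of_calculus)
      show "((\<lambda>s. R ((s - x) / h)) has_vector_derivative \<rho> ((s - x) / h) / h) (at s within {0..L})" for s
      proof -
        have "((\<lambda>s. R ((s - x) / h)) has_real_derivative \<rho> ((s - x) / h) * (1 / h)) (at s)"
          by (rule DERIV_chain2[OF R(1)]) (use h in \<open>auto intro!: derivative_eq_intros\<close>)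
        then show ?thesis
          by (simp add: has_real_derivative_iff_has_vector_derivative has_vector_derivative_at_within)
      qed
    qed (use x in simp)
    moreover have "R ((L - x) / h) = M"
      using h by (intro R) (simp add: field_simps)
    moreover have "R ((0 - x) / h) = 0"
      using h x by (intro R) (simp add: field_simps)
    ultimately have int\<rho>: "((\<lambda>s. \<rho> ((s - x) / h) / h) has_integral M) {0..L}"
      by simp
    have int1: "(\<lambda>s. g s * (\<rho> ((s - x) / h) / h)) integrable_on {0..L}"
      by (intro integrable_continuous_real continuous_on_mult g cont\<rho>)
    have int2: "((\<lambda>s. g x * (\<rho> ((s - x) / h) / h)) has_integral (g x * M)) {0..L}"
      using has_integral_mult_right[OF int\<rho>] .
    have int3: "((\<lambda>s. \<eta> * (\<rho> ((s - x) / h) / h)) has_integral (\<eta> * M)) {0..L}"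
      using has_integral_mult_right[OF int\<rho>] .
    have "norm (integral {0..L} (\<lambda>s. g s * (\<rho> ((s - x) / h) / h) - g x * (\<rho> ((s - x) / h) / h)))
        \<le> integral {0..L} (\<lambda>s. \<eta> * (\<rho> ((s - x) / h) / h))"
    proof (rule integral_norm_bound_integral)
      show "(\<lambda>s. g s * (\<rho> ((s - x) / h) / h) - g x * (\<rho> ((s - x) / h) / h)) integrable_on {0..L}"
        using int1 has_integral_integrable[OF int2] by (rule integrable_diff)
      show "(\<lambda>s. \<eta> * (\<rho> ((s - x) / h) / h)) integrable_on {0..L}"
        using int3 by blast
      show "norm (g s * (\<rho> ((s - x) / h) / h) - g x * (\<rho> ((s - x) / h) / h))
          \<le> \<eta> * (\<rho> ((s - x) / h) / h)" if s: "s \<in> {0..L}" for s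
      proof (cases "(s - x) / h \<in> {0..1}")
        case True
        then have "dist s x < d"
          using h by (auto simp: dist_real_def field_simps)
        then have "\<bar>g s - g x\<bar> \<le> \<eta>"
          using d(2)[OF s] by (simp add: dist_real_def)
        then have "\<bar>g s - g x\<bar> * (\<rho> ((s - x) / h) / h) \<le> \<eta> * (\<rho> ((s - x) / h) / h)"
          using \<rho>(2) h by (intro mult_right_mono) auto
        then show ?thesis
          unfolding left_diff_distrib[symmetric] using \<rho>(2) h by (simp add: abs_mult)
      next
        case False
        then show ?thesis
          using \<rho>(3) by simp
      qed
    qed
    also have "\<dots> = \<eta> * M"
      using int3 by (rule integral_unique)
    finally show ?thesis
      using \<eta> integral_diff[OF int1 has_integral_integrable[OF int2]] integral_unique[OF int2]
      by (simp add: dist_real_def)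
  qed
  show "\<forall>\<^sub>F h in at_right 0. dist (integral {0..L} (\<lambda>s. g s * (\<rho> ((s - x) / h) / h))) (g x * M) < e"
    unfolding eventually_at_right_field using main d(1) x
    by (intro exI[of _ "min d (L - x)"]) auto
qed

text \<open>The test functions have as second derivative a combination of three narrow bumps whose
  total mass and first moment vanish; concentrating the bumps gives the three-point identity
  that characterises affine functions.\<close>

lemma weakly_affine_imp_affine:
  fixes g :: "real \<Rightarrow> real"
  assumes L: "L > 0" and g: "continuous_on {0..L} g"
    and weak: "\<And>\<phi> \<phi>1 \<phi>2. test_function L \<phi> \<Longrightarrow> (\<And>s. (\<phi> has_real_derivative \<phi>1 s) (at s)) \<Longrightarrow>
       (\<And>s. (\<phi>1 has_real_derivative \<phi>2 s) (at s)) \<Longrightarrow> continuous_on UNIV \<phi>2 \<Longrightarrow>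
       integral {0..L} (\<lambda>s. g s * \<phi>2 s) = 0"
  obtains a b where "\<And>s. s \<in> {0..L} \<Longrightarrow> g s = a * s + b"
proof -
  obtain \<rho> R B :: "real \<Rightarrow> real" and M c where
    \<rho>: "continuous_on UNIV \<rho>" "\<And>x. \<rho> x \<ge> 0" "\<And>x. x \<notin> {0..1} \<Longrightarrow> \<rho> x = 0"
    and R: "\<And>x. (R has_real_derivative \<rho> x) (at x)" "\<And>x. x \<le> 0 \<Longrightarrow> R x = 0" "\<And>x. x \<ge> 1 \<Longrightarrow> R x = M"
    and B: "\<And>x. (B has_real_derivative R x) (at x)"
      "\<And>x. x \<le> 0 \<Longrightarrow> B x = 0" "\<And>x. x \<ge> 1 \<Longrightarrow> B x = M * x + c" "M > 0"
      "\<And>n. times_differentiable n B"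
    by (rule double_antiderivative_bump) (rule that)
  have three: "(x2 - x3) * g x1 + (x3 - x1) * g x2 + (x1 - x2) * g x3 = 0"
    if x: "x1 \<in> {0<..<L}" "x2 \<in> {0<..<L}" "x3 \<in> {0<..<L}" for x1 x2 x3
  proof -
    define I where "I x h = integral {0..L} (\<lambda>s. g s * (\<rho> ((s - x) / h) / h))" for x h
    define a where "a = min x1 (min x2 x3)"
    define b where "b = max x1 (max x2 x3)"
    have ab: "0 < a" "b < L" "a \<le> x1" "a \<le> x2" "a \<le> x3" "x1 \<le> b" "x2 \<le> b" "x3 \<le> b"
      using x by (auto simp: a_def b_def)
    have zero: "(x2 - x3) * I x1 h + (x3 - x1) * I x2 h + (x1 - x2) * I x3 h = 0"
      if h: "0 < h" "h < L - b" for h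
    proof -
      define \<phi> where "\<phi> s = (x2 - x3) * B ((s - x1) / h) + (x3 - x1) * B ((s - x2) / h)
         + (x1 - x2) * B ((s - x3) / h)" for s
      define \<phi>1 where "\<phi>1 s = ((x2 - x3) * R ((s - x1) / h) + (x3 - x1) * R ((s - x2) / h)
         + (x1 - x2) * R ((s - x3) / h)) / h" for s
      define \<phi>2 where "\<phi>2 s = ((x2 - x3) * (\<rho> ((s - x1) / h) / h) + (x3 - x1) * (\<rho> ((s - x2) / h) / h)
         + (x1 - x2) * (\<rho> ((s - x3) / h) / h)) / h" for s
      have "integral {0..L} (\<lambda>s. g s * \<phi>2 s) = 0"
      proof (rule weak[of \<phi> \<phi>1])
        show "test_function L \<phi>"
        proof (rule test_functionI[of \<phi> a "b + h"])
          have *: "B ((s - y) / h) = B ((1 / h) * s + (- y / h))" for s y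
            by (simp add: diff_divide_distrib)
          show "times_differentiable n \<phi>" for n
            unfolding \<phi>_def[abs_def] *
            by (intro times_differentiable_add times_differentiable_mult times_differentiable_const
                times_differentiable_affine B)
          show "s \<in> {a..b + h}" if "\<phi> s \<noteq> 0" for s
          proof (rule ccontr)
            assume "s \<notin> {a..b + h}"
            then consider "s < a" | "s > b + h"
              by force
            then have "\<phi> s = 0"
            proof cases
              case 1
              then show ?thesis
                using ab h by (simp add: \<phi>_def B(2) divide_nonpos_pos)
            next
              case 2
              then have "B ((s - y) / h) = M / h * (s - y) + c" if "y \<le> b" for y
                using that h B(3)[of "(s - y) / h"] by (simp add: field_simps)
              then have "\<phi> s = (x2 - x3) * (M / h * (s - x1) + c) + (x3 - x1) * (M / h * (s - x2) + c)
                  + (x1 - x2) * (M / h * (s - x3) + c)"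
                using ab by (simp only: \<phi>_def)
              \<comment> \<open>The coefficients x2 - x3, x3 - x1, x1 - x2 have sum 0 and are
                orthogonal to (x1, x2, x3), so both the constant and the shifted parts of the tails
                cancel.\<close>
              also have "\<dots> = 0"
                by algebra
              finally show ?thesis .
            qed
            with that show False
              by simp
          qed
        qed (use ab h in auto)
        have chain: "((\<lambda>s. f ((s - y) / h)) has_real_derivative f' ((s - y) / h) * (1 / h)) (at s)"
          if "\<And>x. (f has_real_derivative f' x) (at x)" for f f' y s
          by (rule DERIV_chain2[OF that]) (use h in \<open>auto intro!: derivative_eq_intros\<close>)
        show "(\<phi> has_real_derivative \<phi>1 s) (at s)" for s
          unfolding \<phi>_def[abs_def] \<phi>1_def
          by (rule derivative_eq_intros chain[OF B(1)] refl | simp add: add_divide_distrib mult.commute)+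
        show "(\<phi>1 has_real_derivative \<phi>2 s) (at s)" for s
          unfolding \<phi>1_def[abs_def] \<phi>2_def
          by (intro DERIV_cdivide)
            (rule derivative_eq_intros chain[OF R(1)] refl | simp add: mult.commute)+
        show "continuous_on UNIV \<phi>2"
          unfolding \<phi>2_def[abs_def] using h
          by (intro continuous_intros continuous_on_compose2[OF \<rho>(1)]) auto
      qed
      also have "integral {0..L} (\<lambda>s. g s * \<phi>2 s) =
        ((x2 - x3) * I x1 h + (x3 - x1) * I x2 h + (x1 - x2) * I x3 h) / h"
      proof -
        have "((\<lambda>s. g s * (\<rho> ((s - y) / h) / h)) has_integral I y h) {0..L}" for y
          unfolding I_def using h
          by (intro integrable_integral integrable_continuous_real continuous_intros g
              continuous_on_compose2[OF \<rho>(1)]) auto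
        then have "((\<lambda>s. ((x2 - x3) * (g s * (\<rho> ((s - x1) / h) / h)) + (x3 - x1) * (g s * (\<rho> ((s - x2) / h) / h))
            + (x1 - x2) * (g s * (\<rho> ((s - x3) / h) / h))) / h) has_integral
           ((x2 - x3) * I x1 h + (x3 - x1) * I x2 h + (x1 - x2) * I x3 h) / h) {0..L}"
          by (intro has_integral_divide has_integral_add has_integral_mult_right)
        moreover have "((x2 - x3) * (g s * (\<rho> ((s - x1) / h) / h)) + (x3 - x1) * (g s * (\<rho> ((s - x2) / h) / h))
            + (x1 - x2) * (g s * (\<rho> ((s - x3) / h) / h))) / h = g s * \<phi>2 s" for s
          by (simp add: \<phi>2_def ring_distribs mult.left_commute)
        ultimately show ?thesis
          by (simp add: integral_unique)
      qed
      finally show ?thesis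
        using h by simp
    qed
    have "((\<lambda>h. (x2 - x3) * I x1 h + (x3 - x1) * I x2 h + (x1 - x2) * I x3 h) \<longlongrightarrow>
       (x2 - x3) * (g x1 * M) + (x3 - x1) * (g x2 * M) + (x1 - x2) * (g x3 * M)) (at_right 0)"
      unfolding I_def using x
      by (intro tendsto_intros mollified_integral_tendsto[OF \<rho> R g]) auto
    moreover have "((\<lambda>h. (x2 - x3) * I x1 h + (x3 - x1) * I x2 h + (x1 - x2) * I x3 h) \<longlongrightarrow> 0) (at_right 0)"
    proof (rule Lim_transform_eventually[of "\<lambda>x. 0"])
      show "\<forall>\<^sub>F h in at_right 0. 0 = (x2 - x3) * I x1 h + (x3 - x1) * I x2 h + (x1 - x2) * I x3 h"
        unfolding eventually_at_right_field using zero ab(2)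
        by (intro exI[of _ "L - b"]) auto
    qed simp
    ultimately have "(x2 - x3) * (g x1 * M) + (x3 - x1) * (g x2 * M) + (x1 - x2) * (g x3 * M) = 0"
      by (rule tendsto_unique[OF trivial_limit_at_right_real])
    then have "M * ((x2 - x3) * g x1 + (x3 - x1) * g x2 + (x1 - x2) * g x3) = 0"
      by (simp add: algebra_simps)
    then show ?thesis
      using B(4) by simp
  qed
  \<comment> \<open>The line through the graph of g at L/3 and 2L/3; the three-point identity with
    these two nodes puts every other interior point on it.\<close>
  define a where "a = (g (2 * L / 3) - g (L / 3)) / (L / 3)"
  define b where "b = 2 * g (L / 3) - g (2 * L / 3)"
  have eq: "g s = a * s + b" if s: "s \<in> {0<..<L}" for s
  proof -
    have "(2 * L / 3 - s) * g (L / 3) + (s - L / 3) * g (2 * L / 3) + (L / 3 - 2 * L / 3) * g s = 0"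
      using L s by (intro three) auto
    then have "L / 3 * g s = (2 * L / 3 - s) * g (L / 3) + (s - L / 3) * g (2 * L / 3)"
      by (simp add: algebra_simps)
    moreover have "L / 3 * (a * s + b) = (2 * L / 3 - s) * g (L / 3) + (s - L / 3) * g (2 * L / 3)"
    proof -
      have "L / 3 * a = g (2 * L / 3) - g (L / 3)"
        using L by (simp add: a_def)
      then have "L / 3 * (a * s + b) = (g (2 * L / 3) - g (L / 3)) * s + L / 3 * b"
        by (simp only: distrib_left mult.assoc[symmetric])
      then show ?thesis
        unfolding b_def by (simp only:) (simp add: field_simps)
    qed
    ultimately have "L / 3 * g s = L / 3 * (a * s + b)"
      by (simp only:)
    then show ?thesis
      using L by simp
  qed
  have "{0..L} = closure {0<..<L}"
    using L by simp
  moreover have "g s - (a * s + b) = 0" if "s \<in> closure {0<..<L}" for s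
  proof (rule continuous_constant_on_closure[of "{0<..<L}" "\<lambda>s. g s - (a * s + b)"])
    show "continuous_on (closure {0<..<L}) (\<lambda>s. g s - (a * s + b))"
      using L g by (auto intro!: continuous_intros)
  qed (use eq that in auto)
  ultimately show ?thesis
    by (intro that[of a b]) auto
qed


text \<open>Replacing w by its continuous representative changes the integrand on a null set only.
  Continuity then turns the Lebesgue integral over the open interval into a gauge integral over
  {0..L}, and the factor p is divided out.\<close>

lemma weak_equation_continuous:
  assumes p: "p > 1" and weak: "weak_equation p L lam w" and w: "w \<in> borel_measurable (lebesgue_on {0<..<L})"
    and W: "continuous_rep L w W" and test: "test_function L \<phi>"
    and \<phi>: "\<And>s. (\<phi> has_real_derivative \<phi>1 s) (at s)" "\<And>s. (\<phi>1 has_real_derivative \<phi>2 s) (at s)"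
      "continuous_on UNIV \<phi>2"
  shows "integral {0..L} (\<lambda>s. W s * \<phi>2 s - ode_rhs p lam (W s) * \<phi> s) = 0"
proof -
  define I where "I w s = p * w s * \<phi>2 s + (p - 1) * sgn_pow (2 / (p - 1)) (w s) * \<phi> s
            - lam * sgn_pow ((2 - p) / (p - 1)) (w s) * \<phi> s" for w :: "real \<Rightarrow> real" and s
  have contW: "continuous_on {0..L} W" and AE: "AE s in lebesgue_on {0<..<L}. W s = w s"
    using W by (auto simp: continuous_rep_def)
  have cont\<phi>: "continuous_on S \<phi>" for S
    using \<phi>(1) by (meson DERIV_isCont continuous_at_imp_continuous_on)
  have cont\<phi>2: "continuous_on S \<phi>2" for S
    using \<phi>(3) continuous_on_subset by blast
  have I_eq: "I W = (\<lambda>s. p * (W s * \<phi>2 s - ode_rhs p lam (W s) * \<phi> s))"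
    using p by (auto simp: I_def ode_rhs_def field_simps)
  have contI: "continuous_on {0..L} (I W)"
    unfolding I_eq using p by (intro continuous_intros contW cont\<phi> cont\<phi>2)
  have "deriv (deriv \<phi>) = \<phi>2"
  proof -
    have "deriv \<phi> = \<phi>1" "deriv \<phi>1 = \<phi>2"
      using \<phi> by (auto intro!: DERIV_imp_deriv)
    then show ?thesis
      by simp
  qed
  then have "integral\<^sup>L (lebesgue_on {0<..<L}) (I w) = 0"
    using weak[unfolded weak_equation_def, rule_format, OF test] by (simp only: I_def[abs_def])
  also have "integral\<^sup>L (lebesgue_on {0<..<L}) (I w) = integral\<^sup>L (lebesgue_on {0<..<L}) (I W)"
  proof (rule integral_cong_AE)
    have [measurable]: "\<phi> \<in> borel_measurable (lebesgue_on {0<..<L})"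
      "\<phi>2 \<in> borel_measurable (lebesgue_on {0<..<L})"
      using cont\<phi> cont\<phi>2 by (auto intro!: continuous_imp_measurable_on_sets_lebesgue)
    show "I w \<in> borel_measurable (lebesgue_on {0<..<L})"
      unfolding I_def[abs_def] using w by measurable
    show "I W \<in> borel_measurable (lebesgue_on {0<..<L})"
      using contI by (auto intro!: continuous_imp_measurable_on_sets_lebesgue intro: continuous_on_subset)
    show "AE s in lebesgue_on {0<..<L}. I w s = I W s"
      using AE by eventually_elim (simp add: I_def)
  qed
  also have "\<dots> = integral {0<..<L} (I W)"
  proof (rule lebesgue_integral_eq_integral)
    have "I W absolutely_integrable_on {0..L}"
      using contI by (rule absolutely_integrable_continuous_real)
    then have "I W absolutely_integrable_on {0<..<L}"
      by (rule set_integrable_subset) auto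
    then show "integrable (lebesgue_on {0<..<L}) (I W)"
      by (simp add: integrable_restrict_space set_integrable_def)
  qed simp
  also have "\<dots> = integral {0..L} (I W)"
    by (simp add: integral_open_interval_real)
  finally show ?thesis
    using p by (simp add: I_eq)
qed

text \<open>Integrating the continuous function \<open>ode_rhs p lam (W s)\<close> twice gives a C^2
  function Z with the same weak second derivative as W. Hence W - Z is weakly affine, therefore
  affine, and W inherits the regularity of Z.\<close>

lemma weak_solution_imp_ode_solution:
  assumes p: "p > 1" and L: "L > 0" and weak: "weak_equation p L lam w"
    and w: "w \<in> borel_measurable (lebesgue_on {0<..<L})"
    and W: "continuous_rep L w W"
  obtains y1 where "ode_solution p lam {0..L} W y1"
proof -
  have contW: "continuous_on {0..L} W"
    using W by (simp add: continuous_rep_def)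
  \<comment> \<open>Clamping the argument to {0..L} extends the right-hand side continuously to the
    whole line, so global antiderivatives exist and no end points need care.\<close>
  define G where "G s = ode_rhs p lam (W (max 0 (min L s)))" for s
  have contG: "continuous_on UNIV G"
    unfolding G_def[abs_def] using p L
    by (intro continuous_intros continuous_on_compose2[OF contW]) auto
  have G: "G s = ode_rhs p lam (W s)" if "s \<in> {0..L}" for s
  proof -
    have "max 0 (min L s) = s"
      using that by auto
    then show ?thesis
      by (simp add: G_def)
  qed
  obtain Z1 where Z1: "\<And>s. (Z1 has_real_derivative G s) (at s)"
    using antiderivative_real[OF contG] by blast
  then have contZ1: "continuous_on UNIV Z1"
    by (meson DERIV_isCont continuous_at_imp_continuous_on)
  obtain Z where Z: "\<And>s. (Z has_real_derivative Z1 s) (at s)"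
    using antiderivative_real[OF contZ1] by blast
  then have contZ: "continuous_on S Z" for S
    by (meson DERIV_isCont continuous_at_imp_continuous_on)
  obtain a b where ab: "\<And>s. s \<in> {0..L} \<Longrightarrow> W s - Z s = a * s + b"
  proof (rule weakly_affine_imp_affine[OF L])
    show "continuous_on {0..L} (\<lambda>s. W s - Z s)"
      by (intro continuous_intros contW contZ)
    fix \<phi> \<phi>1 \<phi>2 :: "real \<Rightarrow> real"
    assume test: "test_function L \<phi>" and \<phi>: "\<And>s. (\<phi> has_real_derivative \<phi>1 s) (at s)"
      "\<And>s. (\<phi>1 has_real_derivative \<phi>2 s) (at s)" "continuous_on UNIV \<phi>2"
    have cont\<phi>: "continuous_on S \<phi>" for S
      using \<phi>(1) by (meson DERIV_isCont continuous_at_imp_continuous_on)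
    have cont\<phi>2: "continuous_on S \<phi>2" for S
      using \<phi>(3) continuous_on_subset by blast
    \<comment> \<open>The support is a closed subset of the open interval, so \<phi> vanishes near 0
      and near L; this kills all boundary terms of the integration by parts below.\<close>
    have zero: "\<phi> s = 0 \<and> \<phi>1 s = 0" if "s \<notin> {0<..<L}" for s
    proof -
      have op: "open (- closure {x. \<phi> x \<noteq> 0})" and s: "s \<in> - closure {x. \<phi> x \<noteq> 0}"
        using test that by (auto simp: test_function_def)
      have \<phi>0: "\<phi> t = 0" if "t \<in> - closure {x. \<phi> x \<noteq> 0}" for t
        using that closure_subset[of "{x. \<phi> x \<noteq> 0}"] by auto
      have "((\<lambda>_. 0) has_real_derivative 0) (at s)"
        by simp
      then have "(\<phi> has_real_derivative 0) (at s)"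
        using op s by (rule has_field_derivative_transform_within_open) (simp only: \<phi>0)
      then show ?thesis
        using DERIV_unique[OF \<phi>(1)] \<phi>0[OF s] by simp
    qed
    have "((\<lambda>s. Z s * \<phi>2 s - G s * \<phi> s) has_integral
       (Z L * \<phi>1 L - Z1 L * \<phi> L) - (Z 0 * \<phi>1 0 - Z1 0 * \<phi> 0)) {0..L}"
    proof (rule fundamental_theorem_of_calculus)
      fix s
      have "((\<lambda>s. Z s * \<phi>1 s - Z1 s * \<phi> s) has_real_derivative
          (Z1 s * \<phi>1 s + \<phi>2 s * Z s) - (G s * \<phi> s + \<phi>1 s * Z1 s)) (at s)"
        by (intro DERIV_diff DERIV_mult Z Z1 \<phi>)
      then have "((\<lambda>s. Z s * \<phi>1 s - Z1 s * \<phi> s) has_real_derivative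
          Z s * \<phi>2 s - G s * \<phi> s) (at s)"
        by (simp add: mult.commute)
      then show "((\<lambda>s. Z s * \<phi>1 s - Z1 s * \<phi> s) has_vector_derivative
          Z s * \<phi>2 s - G s * \<phi> s) (at s within {0..L})"
        by (simp add: has_real_derivative_iff_has_vector_derivative has_vector_derivative_at_within)
    qed (use L in simp)
    moreover have "\<phi> 0 = 0" "\<phi> L = 0" "\<phi>1 0 = 0" "\<phi>1 L = 0"
      using zero[of 0] zero[of L] by auto
    ultimately have 1: "((\<lambda>s. Z s * \<phi>2 s - G s * \<phi> s) has_integral 0) {0..L}"
      by simp
    have "(\<lambda>s. W s * \<phi>2 s - ode_rhs p lam (W s) * \<phi> s) integrable_on {0..L}"
      using p by (intro integrable_continuous_real continuous_intros contW cont\<phi> cont\<phi>2)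
    then have "((\<lambda>s. W s * \<phi>2 s - ode_rhs p lam (W s) * \<phi> s) has_integral 0) {0..L}"
      using weak_equation_continuous[OF p weak w W test \<phi>] by (simp add: has_integral_integral)
    from has_integral_diff[OF this 1]
    have "((\<lambda>s. (W s * \<phi>2 s - ode_rhs p lam (W s) * \<phi> s) - (Z s * \<phi>2 s - G s * \<phi> s)) has_integral 0) {0..L}"
      by simp
    then have "((\<lambda>s. (W s - Z s) * \<phi>2 s) has_integral 0) {0..L}"
      by (rule has_integral_eq[rotated]) (simp add: G left_diff_distrib)
    then show "integral {0..L} (\<lambda>s. (W s - Z s) * \<phi>2 s) = 0"
      by (rule integral_unique)
  qed blast
  have "ode_solution p lam {0..L} W (\<lambda>s. Z1 s + a)"
    unfolding ode_solution_def
  proof (intro ballI conjI)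
    fix s assume s: "s \<in> {0..L}"
    have "((\<lambda>s. Z s + (a * s + b)) has_real_derivative Z1 s + a) (at s)"
      using Z by (auto intro!: derivative_eq_intros)
    then show "(W has_real_derivative Z1 s + a) (at s within {0..L})"
    proof (rule has_field_derivative_transform_within[OF has_field_derivative_at_within zero_less_one s])
      show "Z t + (a * t + b) = W t" if "t \<in> {0..L}" for t
        using ab[OF that] by simp
    qed
    have "((\<lambda>s. Z1 s + a) has_real_derivative ode_rhs p lam (W s)) (at s)"
      using Z1[of s] G[OF s] by (auto intro!: derivative_eq_intros)
    then show "((\<lambda>s. Z1 s + a) has_real_derivative ode_rhs p lam (W s)) (at s within {0..L})"
      by (rule has_field_derivative_at_within)
  qed
  then show ?thesis
    by (rule that)
qed

subsection \<open>The amplitude functions\<close>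

lemma finite_cos_zeros: "finite {t \<in> {a..b}. cos t = (0::real)}"
proof (rule finite_subset)
  show "{t \<in> {a..b}. cos t = 0} \<subseteq> (\<lambda>n::int. n * pi + pi / 2) ` {\<lfloor>a / pi\<rfloor> - 1..\<lceil>b / pi\<rceil>}"
  proof
    fix t assume "t \<in> {t \<in> {a..b}. cos t = 0}"
    then obtain n :: int where n: "t = n * pi + pi / 2" and t: "a \<le> t" "t \<le> b"
      by (auto simp: cos_zero_iff_int2)
    have t': "t / pi = n + 1 / 2"
      using n by (simp add: field_simps)
    have "a / pi \<le> n + 1 / 2" "n + 1 / 2 \<le> b / pi"
      unfolding t'[symmetric] using t by (auto intro: divide_right_mono)
    then have "n \<in> {\<lfloor>a / pi\<rfloor> - 1..\<lceil>b / pi\<rceil>}"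
      by (auto; linarith)
    then show "t \<in> (\<lambda>n::int. n * pi + pi / 2) ` {\<lfloor>a / pi\<rfloor> - 1..\<lceil>b / pi\<rceil>}"
      using n by blast
  qed
qed simp

text \<open>Integration by parts gives
  \<^term>\<open>(1 + e) * \<bar>cos t\<bar> powr e = (2 + e) * \<bar>cos t\<bar> powr (e + 2) - deriv (\<lambda>t. sgn_pow e (cos t) * sin t) t\<close>,
  whose right-hand side stays integrable across the zeros of the cosine.\<close>

lemma abs_cos_powr_antiderivative:
  assumes e: "e > -1"
  obtains J where "continuous_on UNIV J" "\<And>t. cos t \<noteq> 0 \<Longrightarrow> (J has_real_derivative \<bar>cos t\<bar> powr e) (at t)"
proof -
  have "continuous_on UNIV (\<lambda>t. sgn_pow e (cos t) * cos t)"
    using e by (intro continuous_intros)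
  then obtain N where N: "\<And>t. (N has_real_derivative sgn_pow e (cos t) * cos t) (at t)"
    using antiderivative_real by blast
  then have contN: "continuous_on UNIV N"
    by (meson DERIV_isCont continuous_at_imp_continuous_on)
  define J where "J t = ((e + 2) * N t - sgn_pow e (cos t) * sin t) / (e + 1)" for t
  have "(J has_real_derivative \<bar>cos t\<bar> powr e) (at t)" if "cos t \<noteq> 0" for t
  proof -
    have "((\<lambda>t. sgn_pow e (cos t)) has_real_derivative ((e + 1) * \<bar>cos t\<bar> powr e) * (- sin t)) (at t)"
      using that by (intro DERIV_chain2[OF DERIV_sgn_pow] DERIV_cos) auto
    then have "(J has_real_derivative ((e + 2) * (sgn_pow e (cos t) * cos t)
        - (((e + 1) * \<bar>cos t\<bar> powr e) * (- sin t) * sin t + cos t * sgn_pow e (cos t))) / (e + 1)) (at t)"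
      unfolding J_def[abs_def] by (intro DERIV_cdivide DERIV_diff DERIV_cmult N DERIV_mult DERIV_sin)
    also have "((e + 2) * (sgn_pow e (cos t) * cos t)
        - (((e + 1) * \<bar>cos t\<bar> powr e) * (- sin t) * sin t + cos t * sgn_pow e (cos t))) / (e + 1)
      = \<bar>cos t\<bar> powr e * ((cos t)\<^sup>2 + (sin t)\<^sup>2)"
    proof -
      have "((e + 2) * (P * c * c) - (((e + 1) * P) * (- s) * s + c * (P * c))) / (e + 1) = P * (c\<^sup>2 + s\<^sup>2)"
        for P c s :: real
        using e by (simp add: field_simps power2_eq_square)
      then show ?thesis
        unfolding sgn_pow_def .
    qed
    finally show ?thesis
      by simp
  qed
  moreover have "continuous_on UNIV J"
    unfolding J_def[abs_def] using e by (intro continuous_intros contN) auto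
  ultimately show ?thesis
    using that by blast
qed

text \<open>Integration by parts shifts the derivative onto the smooth factor m: with J an
  antiderivative of the singular power, J m minus an antiderivative of the continuous J m' does the
  job.\<close>

lemma abs_cos_powr_times_antiderivative:
  assumes e: "e > -1" and m: "\<And>t. (m has_real_derivative m' t) (at t)" "continuous_on UNIV m'"
  obtains H where "continuous_on UNIV H"
    "\<And>t. cos t \<noteq> 0 \<Longrightarrow> (H has_real_derivative \<bar>cos t\<bar> powr e * m t) (at t)"
proof -
  obtain J where J: "continuous_on UNIV J" "\<And>t. cos t \<noteq> 0 \<Longrightarrow> (J has_real_derivative \<bar>cos t\<bar> powr e) (at t)"
    using abs_cos_powr_antiderivative[OF e] by blast
  have "continuous_on UNIV (\<lambda>t. J t * m' t)"
    by (intro continuous_intros J m)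
  then obtain P where P: "\<And>t. (P has_real_derivative J t * m' t) (at t)"
    using antiderivative_real by blast
  have cont: "continuous_on UNIV P" "continuous_on UNIV m"
    using P m by (meson DERIV_isCont continuous_at_imp_continuous_on)+
  show ?thesis
  proof (rule that[of "\<lambda>t. J t * m t - P t"])
    show "continuous_on UNIV (\<lambda>t. J t * m t - P t)"
      by (intro continuous_intros J cont)
    show "((\<lambda>t. J t * m t - P t) has_real_derivative \<bar>cos t\<bar> powr e * m t) (at t)" if "cos t \<noteq> 0" for t
      using DERIV_diff[OF DERIV_mult[OF J(2)[OF that] m(1)] P] by (simp add: mult.commute)
  qed
qed

text \<open>The lower bound by the squared cosine is all that is needed for the inverse of H to
  exist on the whole line: it is positive off the zeros of the cosine (strict monotonicity) and its
  integral grows linearly (surjectivity). No period has to be computed.\<close>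

locale cos_singular_antiderivative =
  fixes H h :: "real \<Rightarrow> real"
  assumes cont: "continuous_on UNIV H"
    and deriv: "\<And>t. cos t \<noteq> 0 \<Longrightarrow> (H has_real_derivative h t) (at t)"
    and ge: "\<And>t. h t \<ge> (cos t)\<^sup>2"
    and measurable: "h \<in> borel_measurable borel"
begin

lemma has_integral: "a \<le> b \<Longrightarrow> (h has_integral (H b - H a)) {a..b}"
  using deriv cont
  by (intro fundamental_theorem_of_calculus_strong[OF finite_cos_zeros[of a b]])
    (auto simp: has_real_derivative_iff_has_vector_derivative intro: continuous_on_subset)

lemma LBINT_eq:
  shows "(LBINT t=0..ereal x. h t) = H x - H 0"
proof -
  have *: "(LBINT t=ereal a..ereal b. h t) = H b - H a" if "a \<le> b" for a b
  proof -
    have "0 \<le> h t" for t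
      using ge[of t] zero_le_power2 order_trans by blast
    then have "h absolutely_integrable_on {a..b}"
      using has_integral[OF that] by (intro nonnegative_absolutely_integrable_1) blast
    then have "set_integrable lborel {a..b} h"
      using measurable unfolding set_integrable_def by (subst integrable_completion[symmetric]) auto
    then have "(LBINT t=ereal a..ereal b. h t) = integral {a..b} h"
      by (rule interval_integral_eq_integral[OF that])
    then show ?thesis
      using integral_unique[OF has_integral[OF that]] by simp
  qed
  show ?thesis
  proof (cases "0 \<le> x")
    case True
    then show ?thesis
      using *[of 0 x] by (simp add: zero_ereal_def)
  next
    case False
    then show ?thesis
      using *[of x 0] interval_integral_endpoints_reverse[of 0 "ereal x" h]
      by (simp add: zero_ereal_def)
  qed
qed

text \<open>The squared cosine has the primitive t/2 + sin (2t)/4, whose oscillating part costs at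
  most 1/2.\<close>

lemma growth:
  assumes "a \<le> b"
  shows "(b - a) / 2 - 1 / 2 \<le> H b - H a"
proof -
  have "((\<lambda>t. (cos t)\<^sup>2) has_integral ((b / 2 + sin (2 * b) / 4) - (a / 2 + sin (2 * a) / 4))) {a..b}"
  proof (rule fundamental_theorem_of_calculus[OF assms])
    fix t :: real
    have "((\<lambda>t. t / 2 + sin (2 * t) / 4) has_real_derivative 1 / 2 + cos (2 * t) * 2 / 4) (at t)"
      by (auto intro!: derivative_eq_intros)
    also have "1 / 2 + cos (2 * t) * 2 / 4 = (cos t)\<^sup>2"
      using cos_double_cos[of t] by (simp add: field_simps)
    finally show "((\<lambda>t. t / 2 + sin (2 * t) / 4) has_vector_derivative (cos t)\<^sup>2) (at t within {a..b})"
      by (simp add: has_real_derivative_iff_has_vector_derivative has_vector_derivative_at_within)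
  qed
  from has_integral_le[OF this has_integral[OF assms] ge]
  have "(b / 2 + sin (2 * b) / 4) - (a / 2 + sin (2 * a) / 4) \<le> H b - H a" .
  moreover have "sin (2 * b) \<ge> -1" "sin (2 * a) \<le> 1"
    by simp_all
  moreover have "y / 2 + z / 4 - (x / 2 + u / 4) \<ge> (y - x) / 2 - 1 / 2" if "z \<ge> -1" "u \<le> 1" for x y z u :: real
    using that by (simp add: field_simps)
  ultimately show ?thesis
    by (meson order_trans)
qed

text \<open>A failure of strictness makes H constant on an interval. Such an interval contains a
  point with nonzero cosine, where the derivative is positive.\<close>

lemma strict_mono: "strict_mono H"
proof (rule strict_monoI)
  have le: "H a \<le> H b" if "a \<le> b" for a b
  proof -
    have "0 \<le> h t" for t
      using ge[of t] zero_le_power2 order_trans by blast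
    then show ?thesis
      using has_integral_nonneg[OF has_integral[OF that]] by simp
  qed
  fix a b :: real assume "a < b"
  then have "infinite ({a<..<b} - {t \<in> {a..b}. cos t = 0})"
    using finite_cos_zeros by (metis Diff_infinite_finite infinite_Ioo)
  then obtain c where c: "a < c" "c < b" "cos c \<noteq> 0"
  proof -
    obtain c where "c \<in> {a<..<b} - {t \<in> {a..b}. cos t = 0}"
      using infinite_imp_nonempty[OF \<open>infinite ({a<..<b} - {t \<in> {a..b}. cos t = 0})\<close>] by blast
    then show ?thesis
      by (intro that[of c]) auto
  qed
  show "H a < H b"
  proof (rule ccontr)
    assume "\<not> ?thesis"
    then have *: "H t = H a" if "t \<in> {a<..<b}" for t
      using le[of a t] le[of t b] that by auto
    have "((\<lambda>_. H a) has_real_derivative 0) (at c)"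
      by simp
    then have "(H has_real_derivative 0) (at c)"
      by (rule has_field_derivative_transform_within_open[of _ _ _ "{a<..<b}"]) (use c * in auto)
    then have "h c = 0"
      using deriv[OF c(3)] DERIV_unique by blast
    then show False
      using ge[of c] c(3) by simp
  qed
qed

lemma surj: "range (\<lambda>x. H x - H 0) = UNIV"
proof -
  have "\<exists>x. H x - H 0 = y" for y
  proof -
    \<comment> \<open>Chosen so that the bound b/2 - 1/2 from \<open>growth\<close> is at least |y|,
      which brackets y between the values at - b and b.\<close>
    define b where "b = 2 * \<bar>y\<bar> + 2"
    have b: "b \<ge> 0" "\<bar>y\<bar> \<le> b / 2 - 1 / 2"
      by (auto simp: b_def field_simps)
    have "\<exists>x. - b \<le> x \<and> x \<le> b \<and> H x - H 0 = y"
    proof (rule IVT')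
      show "H (- b) - H 0 \<le> y" "y \<le> H b - H 0"
        using growth[of "- b" 0] growth[of 0 b] b by auto
    qed (use cont b in \<open>auto intro!: continuous_intros intro: continuous_on_subset\<close>)
    then show ?thesis
      by blast
  qed
  then show ?thesis
    by (metis surj_def)
qed

end

text \<open>The open set D stands for either domain of the elliptic integrals, the whole line or the
  interval between - pi/2 and pi/2.\<close>

lemma inverse_amplitude:
  fixes F :: "real \<Rightarrow> real"
  assumes D: "open D" and mono: "strict_mono_on D F" and img: "F ` D = UNIV"
  shows "inv_into D F x \<in> D" "F (inv_into D F x) = x" "t \<in> D \<Longrightarrow> inv_into D F (F t) = t"
    and "strict_mono (inv_into D F)" and "continuous_on UNIV (inv_into D F)"
    and "(F has_real_derivative d) (at (inv_into D F x)) \<Longrightarrow> d \<noteq> 0 \<Longrightarrow>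
      (inv_into D F has_real_derivative inverse d) (at x)"
proof -
  have inj: "inj_on F D"
    using mono by (rule strict_mono_on_imp_inj_on)
  show *: "inv_into D F x \<in> D" "F (inv_into D F x) = x" for x
    using img by (auto intro: inv_into_into f_inv_into_f)
  show **: "t \<in> D \<Longrightarrow> inv_into D F (F t) = t" for t
    using inj by (rule inv_into_f_f)
  show sm: "strict_mono (inv_into D F)"
  proof (rule strict_monoI)
    fix x y :: real assume "x < y"
    then show "inv_into D F x < inv_into D F y"
      using mono *[of x] *[of y] by (metis less_imp_not_less linorder_neqE_linordered_idom strict_mono_onD)
  qed
  \<comment> \<open>A monotone function with open range has no jumps; this gives continuity of the
    inverse without assuming continuity of F.\<close>
  have "range (inv_into D F) = D"
    using * ** by (metis (no_types, lifting) rangeI image_subset_iff subsetI subset_antisym)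
  then show cont: "continuous_on UNIV (inv_into D F)"
    using D sm by (intro continuous_onI_mono) (auto simp: strict_mono_less_eq)
  show "(inv_into D F has_real_derivative inverse d) (at x)"
    if "(F has_real_derivative d) (at (inv_into D F x))" "d \<noteq> 0"
    using cont * that
    by (intro DERIV_inverse_function[where f = F and g = "inv_into D F" and a = "x - 1" and b = "x + 1"])
      (auto simp: continuous_on_eq_continuous_at)
qed

section \<open>The integrands of \<open>F1\<close> and \<open>F2\<close> and the inverses of these
  integrals\<close>

lemma q_sin_less_1:
  assumes "0 < q" "q \<le> 1" "q < 1 \<or> cos t \<noteq> 0"
  shows "q\<^sup>2 * (sin t)\<^sup>2 < (1::real)"
proof (cases "q < 1")
  case True
  have "q\<^sup>2 * (sin t)\<^sup>2 \<le> q\<^sup>2"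
    by (rule mult_left_le) (auto simp: abs_square_le_1)
  also have "\<dots> < 1"
    using True assms by (simp add: power_less_one_iff)
  finally show ?thesis .
next
  case False
  with assms have "q = 1" "cos t \<noteq> 0"
    by auto
  then show ?thesis
    using sin_cos_squared_add[of t] by (simp add: sin_squared_eq)
qed

lemma abs_cos_powr_ge:
  fixes e :: real
  assumes "e \<le> 2"
  shows "(cos t)\<^sup>2 \<le> \<bar>cos t\<bar> powr e"
proof -
  have "\<bar>cos t\<bar> powr 2 \<le> \<bar>cos t\<bar> powr e"
    using assms by (intro powr_mono') auto
  then show ?thesis
    by (simp add: powr_numeral)
qed

text \<open>For q = 1 the root is |cos t|, so this expression becomes |cos t| powr (- 2 / p) and
  serves both branches of \<open>F1\<close>; at zeros of the cosine both read as 0.\<close>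

definition am1_integrand :: "real \<Rightarrow> real \<Rightarrow> real \<Rightarrow> real" where
  "am1_integrand p q t = \<bar>cos t\<bar> powr (1 - 2 / p) / sqrt (1 - q\<^sup>2 * (sin t)\<^sup>2)"

lemma am1_integrand_1: "am1_integrand p 1 t = \<bar>cos t\<bar> powr (- 2 / p)"
proof -
  have "1 - (sin t)\<^sup>2 = (cos t)\<^sup>2"
    by (simp add: cos_squared_eq)
  then show ?thesis
    by (cases "cos t = 0") (simp_all add: am1_integrand_def powr_diff powr_minus_divide)
qed

lemma F1_eq: "F1 p x q = (LBINT t=0..ereal x. am1_integrand p q t)"
proof (cases "q = 1")
  case True
  then show ?thesis
    by (simp only: F1_def am1_integrand_1 simp_thms if_True)
next
  case False
  then show ?thesis
    by (simp only: F1_def am1_integrand_def if_False)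
qed

text \<open>The exponent of the cosine stays above -1 in both situations: 1 - 2/p for p > 1, with
  the root as a smooth factor when q < 1, and - 2/p when p > 2.\<close>

lemma am1_antiderivative:
  assumes p: "p > 1" and q: "0 < q" "q \<le> 1" and dom: "q < 1 \<or> p > 2"
  obtains H where "cos_singular_antiderivative H (am1_integrand p q)"
proof -
  have meas: "am1_integrand p q \<in> borel_measurable borel"
    unfolding am1_integrand_def[abs_def] by measurable
  show ?thesis
  proof (cases "q < 1")
    case True
    define m where "m t = 1 / sqrt (1 - q\<^sup>2 * (sin t)\<^sup>2)" for t
    define m' where "m' t = q\<^sup>2 * sin t * cos t / ((1 - q\<^sup>2 * (sin t)\<^sup>2) * sqrt (1 - q\<^sup>2 * (sin t)\<^sup>2))" for t
    have pos: "1 - q\<^sup>2 * (sin t)\<^sup>2 > 0" for t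
      using q_sin_less_1[OF q, of t] True by simp
    have ne: "1 - q\<^sup>2 * (sin t)\<^sup>2 \<noteq> 0" "sqrt (1 - q\<^sup>2 * (sin t)\<^sup>2) \<noteq> 0" for t
      using pos[of t] by auto
    have "1 - 2 / p > -1"
      using p by (simp add: field_simps)
    moreover have "(m has_real_derivative m' t) (at t)" for t
    proof -
      have "((\<lambda>t. sqrt (1 - q\<^sup>2 * (sin t)\<^sup>2)) has_real_derivative
          - (q\<^sup>2 * sin t * cos t) / sqrt (1 - q\<^sup>2 * (sin t)\<^sup>2)) (at t)"
        using pos[of t] by (auto intro!: derivative_eq_intros simp: field_simps)
      from DERIV_inverse'[OF this ne(2)]
      have "(m has_real_derivative - (inverse (sqrt (1 - q\<^sup>2 * (sin t)\<^sup>2)) *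
        (- (q\<^sup>2 * sin t * cos t) / sqrt (1 - q\<^sup>2 * (sin t)\<^sup>2)) * inverse (sqrt (1 - q\<^sup>2 * (sin t)\<^sup>2)))) (at t)"
        by (simp add: m_def[abs_def] inverse_eq_divide)
      also have "- (inverse (sqrt (1 - q\<^sup>2 * (sin t)\<^sup>2)) *
        (- (q\<^sup>2 * sin t * cos t) / sqrt (1 - q\<^sup>2 * (sin t)\<^sup>2)) * inverse (sqrt (1 - q\<^sup>2 * (sin t)\<^sup>2))) = m' t"
        using pos[of t] by (simp add: m'_def divide_simps)
      finally show ?thesis .
    qed
    moreover have "continuous_on UNIV m'"
      unfolding m'_def[abs_def] using ne by (intro continuous_intros) auto
    ultimately obtain H where H: "continuous_on UNIV H"
      "\<And>t. cos t \<noteq> 0 \<Longrightarrow> (H has_real_derivative \<bar>cos t\<bar> powr (1 - 2 / p) * m t) (at t)"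
      using abs_cos_powr_times_antiderivative[of "1 - 2 / p" m m'] by blast
    show ?thesis
    proof (rule that, unfold_locales)
      show "continuous_on UNIV H" "am1_integrand p q \<in> borel_measurable borel"
        by fact+
      show "(H has_real_derivative am1_integrand p q t) (at t)" if "cos t \<noteq> 0" for t
        using H(2)[OF that] by (simp add: am1_integrand_def m_def)
      show "(cos t)\<^sup>2 \<le> am1_integrand p q t" for t
      proof -
        have "(cos t)\<^sup>2 \<le> \<bar>cos t\<bar> powr (1 - 2 / p)"
          using p by (intro abs_cos_powr_ge) (simp add: field_simps)
        also have "\<dots> = \<bar>cos t\<bar> powr (1 - 2 / p) / 1"
          by simp
        also have "\<dots> \<le> am1_integrand p q t"
          unfolding am1_integrand_def using pos[of t] by (intro divide_left_mono) auto
        finally show ?thesis .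
      qed
    qed
  next
    case False
    with q dom have "q = 1" "p > 2"
      by auto
    then have "- 2 / p > -1"
      by (simp add: field_simps)
    then obtain H where H: "continuous_on UNIV H"
      "\<And>t. cos t \<noteq> 0 \<Longrightarrow> (H has_real_derivative \<bar>cos t\<bar> powr (- 2 / p)) (at t)"
      using abs_cos_powr_antiderivative by blast
    show ?thesis
    proof (rule that, unfold_locales)
      show "continuous_on UNIV H" "am1_integrand p q \<in> borel_measurable borel"
        by fact+
      show "(H has_real_derivative am1_integrand p q t) (at t)" if "cos t \<noteq> 0" for t
        using H(2)[OF that] by (simp add: am1_integrand_1 \<open>q = 1\<close>)
      show "(cos t)\<^sup>2 \<le> am1_integrand p q t" for t
        using abs_cos_powr_ge[of "- 2 / p" t] p by (simp add: am1_integrand_1 \<open>q = 1\<close> field_simps)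
    qed
  qed
qed

lemma open_F_dom: "open (F_dom p q)"
  by (simp add: F_dom_def)

text \<open>Except for q = 1 and p \<le> 2 this is the locale
  \<open>cos_singular_antiderivative\<close>. In the exceptional case the integral diverges at both
  ends of the bounded domain, and surjectivity comes from comparison with - ln (cos t).\<close>

lemma F1_properties:
  assumes p: "p > 1" and q: "0 < q" "q \<le> 1"
  shows "strict_mono_on (F_dom p q) (\<lambda>t. F1 p t q)" (is ?mono)
    and "(\<lambda>t. F1 p t q) ` F_dom p q = UNIV" (is ?img)
    and "t \<in> F_dom p q \<Longrightarrow> cos t \<noteq> 0 \<Longrightarrow> ((\<lambda>t. F1 p t q) has_real_derivative am1_integrand p q t) (at t)"
      (is "_ \<Longrightarrow> _ \<Longrightarrow> ?deriv")
proof -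
  have "?mono \<and> ?img \<and> (t \<in> F_dom p q \<longrightarrow> cos t \<noteq> 0 \<longrightarrow> ?deriv)"
  proof (cases "q < 1 \<or> p > 2")
    case True
    then obtain H where "cos_singular_antiderivative H (am1_integrand p q)"
      using am1_antiderivative[OF p q] by blast
    then interpret cos_singular_antiderivative H "am1_integrand p q" .
    have F1: "(\<lambda>t. F1 p t q) = (\<lambda>t. H t - H 0)"
      by (simp add: F1_eq LBINT_eq)
    have dom: "F_dom p q = UNIV"
      using True by (auto simp: F_dom_def)
    have "strict_mono_on UNIV (\<lambda>t. H t - H 0)"
      using strict_mono by (auto simp: strict_mono_def)
    moreover have "((\<lambda>t. H t - H 0) has_real_derivative am1_integrand p q t) (at t)" if "cos t \<noteq> 0"
      using deriv[OF that] by (auto intro!: derivative_eq_intros)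
    ultimately show ?thesis
      unfolding F1 dom using surj by blast
  next
    case False
    with q have q1: "q = 1" and p2: "p \<le> 2"
      by auto
    then have dom: "F_dom p q = {- pi / 2<..<pi / 2}"
      by (simp add: F_dom_def)
    define h where "h t = cos t powr (- 2 / p)" for t
    have cos: "cos t > 0" if "t \<in> {- pi / 2<..<pi / 2}" for t
      using that by (auto intro: cos_gt_zero_pi)
    have conth: "isCont h t" if "t \<in> {- pi / 2<..<pi / 2}" for t
      unfolding h_def[abs_def] using cos[OF that] by (intro continuous_intros) auto
    have h: "am1_integrand p q t = h t" if "t \<in> {- pi / 2<..<pi / 2}" for t
      using cos[OF that] by (simp add: am1_integrand_1 q1 h_def)
    \<comment> \<open>Since 2/p \<ge> 1 and the cosine is at most 1, the integrand dominates 1 / cos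
      t and hence |tan t|, the absolute value of the derivative of - ln (cos t).\<close>
    have tan: "\<bar>sin t\<bar> / cos t \<le> h t" if "t \<in> {- pi / 2<..<pi / 2}" for t
    proof -
      have "cos t powr (2 / p) \<le> cos t powr 1"
        using cos[OF that] p p2 by (intro powr_mono') (auto simp: field_simps)
      then have "1 / cos t \<le> h t"
        using cos[OF that] by (simp add: h_def powr_minus_divide frac_le)
      moreover have "\<bar>sin t\<bar> / cos t \<le> 1 / cos t"
        using cos[OF that] by (intro divide_right_mono) auto
      ultimately show ?thesis
        by simp
    qed
    have "\<exists>F. \<forall>t::real. ereal (- pi / 2) < ereal t \<longrightarrow> ereal t < ereal (pi / 2) \<longrightarrow> (F has_vector_derivative h t) (at t)"
      using conth by (intro einterval_antiderivative) auto
    then obtain H where H: "\<And>t. t \<in> {- pi / 2<..<pi / 2} \<Longrightarrow> (H has_real_derivative h t) (at t)"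
      by (auto simp: has_real_derivative_iff_has_vector_derivative)
    have F1: "F1 p x q = H x - H 0" if x: "x \<in> {- pi / 2<..<pi / 2}" for x
    proof -
      have sub: "{min 0 x..max 0 x} \<subseteq> {- pi / 2<..<pi / 2}"
        using x by auto
      have "(LBINT t=ereal 0..ereal x. h t) = H x - H 0"
      proof (rule interval_integral_FTC_finite)
        show "continuous_on {min 0 x..max 0 x} h"
          using conth sub by (auto intro!: continuous_at_imp_continuous_on)
        show "(H has_vector_derivative h t) (at t within {min 0 x..max 0 x})"
          if "min 0 x \<le> t" "t \<le> max 0 x" for t
        proof (rule has_vector_derivative_at_within)
          have "t \<in> {- pi / 2<..<pi / 2}"
            using sub that by auto
          then show "(H has_vector_derivative h t) (at t)"
            using H by (simp add: has_real_derivative_iff_has_vector_derivative)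
        qed
      qed
      moreover have "(LBINT t=ereal 0..ereal x. am1_integrand p q t) = (LBINT t=ereal 0..ereal x. h t)"
      proof (rule interval_integral_cong)
        fix t assume "t \<in> einterval (min (ereal 0) (ereal x)) (max (ereal 0) (ereal x))"
        then have "t \<in> {min 0 x..max 0 x}"
          by (auto simp: einterval_def min_def max_def split: if_splits)
        then show "am1_integrand p q t = h t"
          using sub h by blast
      qed
      ultimately show ?thesis
        by (simp add: F1_eq zero_ereal_def)
    qed
    have mono: ?mono
      unfolding dom
    proof (rule strict_mono_onI)
      fix r s assume rs: "r \<in> {- pi / 2<..<pi / 2}" "s \<in> {- pi / 2<..<pi / 2}" "r < s"
      have "H r < H s"
      proof (rule DERIV_pos_imp_increasing[OF rs(3)])
        fix x assume "r \<le> x" "x \<le> s"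
        then have x: "x \<in> {- pi / 2<..<pi / 2}"
          using rs by auto
        then show "\<exists>y. (H has_real_derivative y) (at x) \<and> 0 < y"
          using H[OF x] cos[OF x] by (intro exI[of _ "h x"]) (auto simp: h_def)
      qed
      then show "F1 p r q < F1 p s q"
        using rs by (simp add: F1)
    qed
    have up: "- ln (cos t) \<le> H t - H 0" if "0 \<le> t" "t < pi / 2" for t
    proof -
      have "H 0 + ln (cos 0) \<le> H t + ln (cos t)"
      proof (rule DERIV_nonneg_imp_nondecreasing[OF that(1)])
        fix x assume "0 \<le> x" "x \<le> t"
        then have x: "x \<in> {- pi / 2<..<pi / 2}"
          using that by auto
        have "((\<lambda>x. H x + ln (cos x)) has_real_derivative h x + - sin x / cos x) (at x)"
          using cos[OF x] by (auto intro!: derivative_eq_intros H[OF x])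
        moreover have "sin x / cos x \<le> \<bar>sin x\<bar> / cos x"
          using cos[OF x] by (intro divide_right_mono) auto
        then have "h x + - sin x / cos x \<ge> 0"
          using tan[OF x] by simp
        ultimately show "\<exists>y. ((\<lambda>x. H x + ln (cos x)) has_real_derivative y) (at x) \<and> 0 \<le> y"
          by blast
      qed
      then show ?thesis
        by simp
    qed
    have down: "H t - H 0 \<le> ln (cos t)" if "- pi / 2 < t" "t \<le> 0" for t
    proof -
      have "H t - ln (cos t) \<le> H 0 - ln (cos 0)"
      proof (rule DERIV_nonneg_imp_nondecreasing[OF that(2)])
        fix x assume "t \<le> x" "x \<le> 0"
        then have x: "x \<in> {- pi / 2<..<pi / 2}"
          using that by auto
        have "((\<lambda>x. H x - ln (cos x)) has_real_derivative h x - - sin x / cos x) (at x)"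
          using cos[OF x] by (auto intro!: derivative_eq_intros H[OF x])
        moreover have "- sin x / cos x \<le> \<bar>sin x\<bar> / cos x"
          using cos[OF x] by (intro divide_right_mono) auto
        then have "h x - - sin x / cos x \<ge> 0"
          using tan[OF x] by simp
        ultimately show "\<exists>y. ((\<lambda>x. H x - ln (cos x)) has_real_derivative y) (at x) \<and> 0 \<le> y"
          by blast
      qed
      then show ?thesis
        by simp
    qed
    have "\<exists>t\<in>{- pi / 2<..<pi / 2}. H t - H 0 = y" for y
    proof -
      \<comment> \<open>With this choice - ln (cos b) = |y|, so the logarithmic bounds bracket y
        between the values at - b and b.\<close>
      define b where "b = arccos (exp (- \<bar>y\<bar>))"
      have b: "0 \<le> b" "b < pi / 2" "cos b = exp (- \<bar>y\<bar>)"
      proof -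
        have y: "0 < exp (- \<bar>y\<bar>)" "exp (- \<bar>y\<bar>) \<le> 1"
          by auto
        then have y': "-1 \<le> exp (- \<bar>y\<bar>)"
          by linarith
        show "0 \<le> b" "cos b = exp (- \<bar>y\<bar>)"
          unfolding b_def by (rule arccos_lbound[OF y' y(2)] cos_arccos[OF y' y(2)])+
        show "b < pi / 2"
          using y arccos_less_arccos[of 0 "exp (- \<bar>y\<bar>)"] unfolding b_def by auto
      qed
      have "\<exists>t. - b \<le> t \<and> t \<le> b \<and> H t - H 0 = y"
      proof (rule IVT')
        show "H (- b) - H 0 \<le> y" "y \<le> H b - H 0"
          using up[of b] down[of "- b"] b by auto
        show "continuous_on {- b..b} (\<lambda>t. H t - H 0)"
        proof (intro continuous_intros continuous_at_imp_continuous_on ballI)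
          show "isCont H t" if "t \<in> {- b..b}" for t
            using that b by (intro DERIV_isCont[OF H]) auto
        qed
      qed (use b in auto)
      then show ?thesis
        using b by (auto intro!: bexI)
    qed
    then have ?img
      unfolding dom using F1 by (metis (no_types, lifting) UNIV_eq_I image_eqI)
    moreover have ?deriv if t: "t \<in> {- pi / 2<..<pi / 2}"
    proof -
      have "((\<lambda>x. H x - H 0) has_real_derivative am1_integrand p q t) (at t)"
        using H[OF t] h[OF t] by (auto intro!: derivative_eq_intros)
      then show ?thesis
        by (rule has_field_derivative_transform_within_open[of _ _ _ "{- pi / 2<..<pi / 2}"])
          (use t F1 in auto)
    qed
    ultimately show ?thesis
      using mono dom by simp
  qed
  then show ?mono ?img "t \<in> F_dom p q \<Longrightarrow> cos t \<noteq> 0 \<Longrightarrow> ?deriv"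
    by auto
qed

lemma
  assumes p: "p > 1" and q: "0 < q" "q \<le> 1"
  shows am1_in_F_dom: "am1 p x q \<in> F_dom p q"
    and F1_am1: "F1 p (am1 p x q) q = x"
    and am1_F1: "t \<in> F_dom p q \<Longrightarrow> am1 p (F1 p t q) q = t"
    and strict_mono_am1: "strict_mono (\<lambda>x. am1 p x q)"
    and continuous_on_am1: "continuous_on UNIV (\<lambda>x. am1 p x q)"
    and DERIV_am1: "cos (am1 p x q) \<noteq> 0 \<Longrightarrow>
      ((\<lambda>x. am1 p x q) has_real_derivative inverse (am1_integrand p q (am1 p x q))) (at x)"
proof -
  have am: "(\<lambda>x. am1 p x q) = inv_into (F_dom p q) (\<lambda>t. F1 p t q)"
    by (simp add: am1_def fun_eq_iff)
  have amx: "am1 p x q = inv_into (F_dom p q) (\<lambda>t. F1 p t q) x" for x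
    by (simp add: am1_def)
  note * = inverse_amplitude[OF open_F_dom F1_properties(1,2)[OF p q]]
  show 1: "am1 p x q \<in> F_dom p q" "F1 p (am1 p x q) q = x" for x
    unfolding amx using *(1,2) by auto
  show "t \<in> F_dom p q \<Longrightarrow> am1 p (F1 p t q) q = t"
    unfolding amx using *(3) by auto
  show "strict_mono (\<lambda>x. am1 p x q)" "continuous_on UNIV (\<lambda>x. am1 p x q)"
    unfolding am using *(4,5) by auto
  assume cos: "cos (am1 p x q) \<noteq> 0"
  have "sqrt (1 - q\<^sup>2 * (sin (am1 p x q))\<^sup>2) > 0"
    using q_sin_less_1[OF q, of "am1 p x q"] cos by simp
  then have "am1_integrand p q (am1 p x q) \<noteq> 0"
    using cos by (simp add: am1_integrand_def)
  then show "((\<lambda>x. am1 p x q) has_real_derivative inverse (am1_integrand p q (am1 p x q))) (at x)"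
    using *(6) F1_properties(3)[OF p q 1(1) cos] unfolding am amx by blast
qed

lemma
  assumes p: "p > 1" and q: "0 < q" "q < 1"
  shows am2_F2: "am2 p (F2 p t q) q = t"
    and DERIV_am2: "((\<lambda>x. am2 p x q) has_real_derivative
      (1 - q\<^sup>2 * (sin (am2 p x q))\<^sup>2) powr (1 / p)) (at x)"
proof -
  define h where "h t = 1 / (1 - q\<^sup>2 * (sin t)\<^sup>2) powr (1 / p)" for t
  have pos: "1 - q\<^sup>2 * (sin t)\<^sup>2 > 0" for t
    using q_sin_less_1[of q t] q by simp
  have conth: "continuous_on UNIV h"
    unfolding h_def[abs_def] using pos by (intro continuous_intros) (auto simp: less_imp_neq[symmetric])
  obtain H where H: "\<And>t. (H has_real_derivative h t) (at t)"
    using antiderivative_real[OF conth] by blast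
  have ge: "(cos t)\<^sup>2 \<le> h t" for t
  proof -
    have "(1 - q\<^sup>2 * (sin t)\<^sup>2) powr (1 / p) \<le> 1"
      using p pos[of t] by (intro powr_le1) auto
    then have "1 \<le> h t"
      using pos[of t] by (simp add: h_def)
    then show ?thesis
      using abs_square_le_1[of "cos t"] by (meson abs_cos_le_one order_trans)
  qed
  \<comment> \<open>The integrand of \<open>F2\<close> has no singularity; since it is at least 1 it
    satisfies the cosine bound, and the locale supplies monotonicity and surjectivity.\<close>
  interpret cos_singular_antiderivative H h
    using H conth ge
    by unfold_locales (auto intro: borel_measurable_continuous_onI continuous_at_imp_continuous_on DERIV_isCont)
  have F2: "(\<lambda>t. F2 p t q) = (\<lambda>t. H t - H 0)"
    using q LBINT_eq by (simp add: F2_def h_def)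
  have dom: "F_dom p q = UNIV"
    using q by (simp add: F_dom_def)
  have am: "(\<lambda>x. am2 p x q) = inv_into UNIV (\<lambda>t. F2 p t q)"
    by (simp add: am2_def dom fun_eq_iff)
  have amx: "am2 p x q = inv_into UNIV (\<lambda>t. F2 p t q) x" for x
    by (simp add: am2_def dom)
  have sm: "strict_mono_on UNIV (\<lambda>t. F2 p t q)"
    unfolding F2 using strict_mono by (auto simp: strict_mono_def)
  have img: "range (\<lambda>t. F2 p t q) = UNIV"
    unfolding F2 using surj .
  note * = inverse_amplitude[OF open_UNIV sm img]
  show "am2 p (F2 p t q) q = t"
    unfolding amx using *(3) by auto
  have "((\<lambda>t. F2 p t q) has_real_derivative h (am2 p x q)) (at (am2 p x q))"
    unfolding F2 using H by (auto intro!: derivative_eq_intros)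
  moreover have "h (am2 p x q) \<noteq> 0"
    using pos[of "am2 p x q"] by (simp add: h_def)
  ultimately have "((\<lambda>x. am2 p x q) has_real_derivative inverse (h (am2 p x q))) (at x)"
    using *(6) unfolding am amx by blast
  then show "((\<lambda>x. am2 p x q) has_real_derivative (1 - q\<^sup>2 * (sin (am2 p x q))\<^sup>2) powr (1 / p)) (at x)"
    by (simp add: h_def)
qed

subsection \<open>Solutions of cn type\<close>

text \<open>By the fundamental theorem with a finite exceptional set, f differs from an
  antiderivative of g by a constant. This recovers derivatives at points where the amplitude
  obstructs the chain rule.\<close>

lemma DERIV_except_finite:
  fixes f g :: "real \<Rightarrow> real"
  assumes f: "continuous_on UNIV f" and g: "continuous_on UNIV g"
    and S: "\<And>a b. finite ({a..b} \<inter> S)" and deriv: "\<And>x. x \<notin> S \<Longrightarrow> (f has_real_derivative g x) (at x)"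
  shows "(f has_real_derivative g x) (at x)"
proof -
  obtain G where G: "\<And>x. (G has_real_derivative g x) (at x)"
    using antiderivative_real[OF g] by blast
  have eq: "f b - f a = G b - G a" if "a \<le> b" for a b
  proof -
    have "(g has_integral (f b - f a)) {a..b}"
      using deriv f by (intro fundamental_theorem_of_calculus_strong[OF S[of a b] that])
        (auto simp: has_real_derivative_iff_has_vector_derivative intro: continuous_on_subset)
    moreover have "(g has_integral (G b - G a)) {a..b}"
      using G by (intro fundamental_theorem_of_calculus that)
        (auto simp: has_real_derivative_iff_has_vector_derivative intro: has_vector_derivative_at_within)
    ultimately show ?thesis
      by (rule has_integral_unique)
  qed
  have "f = (\<lambda>x. G x + (f 0 - G 0))"
  proof
    show "f x = G x + (f 0 - G 0)" for x
      using eq[of 0 x] eq[of x 0] by (cases "0 \<le> x") auto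
  qed
  moreover have "((\<lambda>x. G x + (f 0 - G 0)) has_real_derivative g x) (at x)"
    using G by (auto intro!: derivative_eq_intros)
  ultimately show ?thesis
    by metis
qed

lemma finite_cos_am1_zeros:
  assumes "p > 1" "0 < q" "q \<le> 1"
  shows "finite ({a..b} \<inter> {x. cos (am1 p x q) = 0})"
proof (rule finite_imageD)
  show "inj_on (\<lambda>x. am1 p x q) ({a..b} \<inter> {x. cos (am1 p x q) = 0})"
    using strict_mono_am1[OF assms] by (meson inj_on_subset strict_mono_imp_inj_on subset_UNIV)
  have "am1 p a q \<le> am1 p x q" "am1 p x q \<le> am1 p b q" if "a \<le> x" "x \<le> b" for x
    using monoD[OF strict_mono_mono[OF strict_mono_am1[OF assms]]] that by auto
  then have "(\<lambda>x. am1 p x q) ` ({a..b} \<inter> {x. cos (am1 p x q) = 0})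
      \<subseteq> {t \<in> {am1 p a q..am1 p b q}. cos t = 0}"
    by auto
  then show "finite ((\<lambda>x. am1 p x q) ` ({a..b} \<inter> {x. cos (am1 p x q) = 0}))"
    using finite_cos_zeros finite_subset by blast
qed

text \<open>The first function is |cn|^(p-2) cn. Differentiating the power of the cosine produces
  |cos|^(1-2/p), which cancels the denominator in the derivative of the amplitude; what remains is
  continuous across the zeros of the cosine.\<close>

lemma DERIV_cn_power:
  assumes p: "p > 1" and q: "0 < q" "q \<le> 1"
  shows "((\<lambda>x. sgn_pow (1 - 2 / p) (cos (am1 p x q))) has_real_derivative
      - (2 - 2 / p) * sin (am1 p x q) * sqrt (1 - q\<^sup>2 * (sin (am1 p x q))\<^sup>2)) (at x)" (is ?thesis1)
    and "((\<lambda>x. - (2 - 2 / p) * sin (am1 p x q) * sqrt (1 - q\<^sup>2 * (sin (am1 p x q))\<^sup>2)) has_real_derivative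
      - (2 - 2 / p) * cn_p p x q * (1 - 2 * q\<^sup>2 * (sin (am1 p x q))\<^sup>2)) (at x)" (is ?thesis2)
proof -
  define \<theta> where "\<theta> x = am1 p x q" for x
  have cont\<theta>: "continuous_on UNIV \<theta>"
    unfolding \<theta>_def[abs_def] using continuous_on_am1[OF p q] .
  have fin: "finite ({a..b} \<inter> {x. cos (\<theta> x) = 0})" for a b
    unfolding \<theta>_def using finite_cos_am1_zeros[OF p q] .
  have e: "1 - 2 / p > -1" "2 / p - 1 > -1"
    using p by (simp_all add: field_simps)
  have pos: "1 - q\<^sup>2 * (sin (\<theta> x))\<^sup>2 > 0" if "cos (\<theta> x) \<noteq> 0" for x
    using q_sin_less_1[OF q] that by simp
  define r where "r x = sqrt (1 - q\<^sup>2 * (sin (\<theta> x))\<^sup>2)" for x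
  have rpos: "r x > 0" if "cos (\<theta> x) \<noteq> 0" for x
    unfolding r_def using pos[OF that] by simp
  have r2: "(r x)\<^sup>2 = 1 - q\<^sup>2 * (sin (\<theta> x))\<^sup>2" if "cos (\<theta> x) \<noteq> 0" for x
    unfolding r_def using pos[OF that] by simp
  have deriv\<theta>: "(\<theta> has_real_derivative r x / \<bar>cos (\<theta> x)\<bar> powr (1 - 2 / p)) (at x)" if "cos (\<theta> x) \<noteq> 0" for x
    using DERIV_am1[OF p q, of x] that by (simp add: \<theta>_def[abs_def] r_def am1_integrand_def)
  have contr: "continuous_on UNIV r"
    unfolding r_def[abs_def] by (intro continuous_intros cont\<theta>)
  have V: "((\<lambda>x. sgn_pow (1 - 2 / p) (cos (\<theta> x))) has_real_derivative - (2 - 2 / p) * sin (\<theta> x) * r x) (at x)"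
  proof (rule DERIV_except_finite[OF _ _ fin])
    show "continuous_on UNIV (\<lambda>x. sgn_pow (1 - 2 / p) (cos (\<theta> x)))"
      "continuous_on UNIV (\<lambda>x. - (2 - 2 / p) * sin (\<theta> x) * r x)"
      using e by (intro continuous_intros cont\<theta> contr; simp)+
    fix x assume "x \<notin> {x. cos (\<theta> x) = 0}"
    then have c: "cos (\<theta> x) \<noteq> 0"
      by simp
    have "((\<lambda>x. sgn_pow (1 - 2 / p) (cos (\<theta> x))) has_real_derivative
      ((1 - 2 / p + 1) * \<bar>cos (\<theta> x)\<bar> powr (1 - 2 / p)) *
        (- sin (\<theta> x) * (r x / \<bar>cos (\<theta> x)\<bar> powr (1 - 2 / p)))) (at x)"
      using c by (intro DERIV_chain2[OF DERIV_sgn_pow] DERIV_chain2[OF DERIV_cos] deriv\<theta>) auto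
    also have "((1 - 2 / p + 1) * \<bar>cos (\<theta> x)\<bar> powr (1 - 2 / p)) *
        (- sin (\<theta> x) * (r x / \<bar>cos (\<theta> x)\<bar> powr (1 - 2 / p))) = - (2 - 2 / p) * sin (\<theta> x) * r x"
      using c by (simp add: algebra_simps)
    finally show "((\<lambda>x. sgn_pow (1 - 2 / p) (cos (\<theta> x))) has_real_derivative - (2 - 2 / p) * sin (\<theta> x) * r x) (at x)" .
  qed
  then show ?thesis1
    by (simp add: \<theta>_def r_def)
  have cn: "cn_p p x q = sgn_pow (2 / p - 1) (cos (\<theta> x))" for x
    by (simp add: cn_p_def \<theta>_def)
  \<comment> \<open>For q = 1 the root r is the absolute value of a cosine, so it too has to be
    differentiated off the zeros first.\<close>
  have "((\<lambda>x. - (2 - 2 / p) * sin (\<theta> x) * r x) has_real_derivative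
    - (2 - 2 / p) * cn_p p x q * (1 - 2 * q\<^sup>2 * (sin (\<theta> x))\<^sup>2)) (at x)"
  proof (rule DERIV_except_finite[OF _ _ fin])
    show "continuous_on UNIV (\<lambda>x. - (2 - 2 / p) * cn_p p x q * (1 - 2 * q\<^sup>2 * (sin (\<theta> x))\<^sup>2))"
      "continuous_on UNIV (\<lambda>x. - (2 - 2 / p) * sin (\<theta> x) * r x)"
      unfolding cn using e by (intro continuous_intros cont\<theta> contr; simp)+
    fix x assume "x \<notin> {x. cos (\<theta> x) = 0}"
    then have c: "cos (\<theta> x) \<noteq> 0"
      by simp
    define \<theta>' where "\<theta>' = r x / \<bar>cos (\<theta> x)\<bar> powr (1 - 2 / p)"
    have d\<theta>: "(\<theta> has_real_derivative \<theta>') (at x)"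
      unfolding \<theta>'_def by (rule deriv\<theta>[OF c])
    have "(r has_real_derivative - (q\<^sup>2 * sin (\<theta> x) * cos (\<theta> x) * \<theta>') / r x) (at x)"
      unfolding r_def[abs_def]
      using pos[OF c] by (auto intro!: derivative_eq_intros d\<theta> simp: field_simps)
    moreover have "((\<lambda>x. sin (\<theta> x)) has_real_derivative cos (\<theta> x) * \<theta>') (at x)"
      by (intro DERIV_chain2[OF DERIV_sin] d\<theta>)
    ultimately have "((\<lambda>x. - (2 - 2 / p) * (sin (\<theta> x) * r x)) has_real_derivative
      - (2 - 2 / p) * (cos (\<theta> x) * \<theta>' * r x + - (q\<^sup>2 * sin (\<theta> x) * cos (\<theta> x) * \<theta>') / r x * sin (\<theta> x))) (at x)"
      by (intro DERIV_cmult DERIV_mult)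
    also have "cos (\<theta> x) * \<theta>' * r x + - (q\<^sup>2 * sin (\<theta> x) * cos (\<theta> x) * \<theta>') / r x * sin (\<theta> x)
       = cos (\<theta> x) * (\<theta>' / r x) * ((r x)\<^sup>2 - q\<^sup>2 * (sin (\<theta> x))\<^sup>2)"
      using rpos[OF c] by (simp add: field_simps power2_eq_square)
    also have "(r x)\<^sup>2 - q\<^sup>2 * (sin (\<theta> x))\<^sup>2 = 1 - 2 * q\<^sup>2 * (sin (\<theta> x))\<^sup>2"
      using r2[OF c] by simp
    also have "cos (\<theta> x) * (\<theta>' / r x) = cn_p p x q"
    proof -
      have "2 / p - 1 = - (1 - 2 / p)"
        by simp
      then have "\<bar>cos (\<theta> x)\<bar> powr (2 / p - 1) = 1 / \<bar>cos (\<theta> x)\<bar> powr (1 - 2 / p)"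
        by (simp only: powr_minus_divide)
      then show ?thesis
        using rpos[OF c] by (simp add: cn sgn_pow_def \<theta>'_def)
    qed
    finally show "((\<lambda>x. - (2 - 2 / p) * sin (\<theta> x) * r x) has_real_derivative
        - (2 - 2 / p) * cn_p p x q * (1 - 2 * q\<^sup>2 * (sin (\<theta> x))\<^sup>2)) (at x)"
      by (simp add: mult.assoc)
  qed
  then show ?thesis2
    by (simp add: \<theta>_def r_def)
qed

text \<open>With u = dn^p the first function is dn^(p-1). The powers of u from the outer derivative
  and from the amplitude cancel, and as u > 0 there are no exceptional points.\<close>

lemma DERIV_dn_power:
  assumes p: "p > 1" and q: "0 < q" "q < 1"
  shows "((\<lambda>x. (1 - q\<^sup>2 * (sin (am2 p x q))\<^sup>2) powr (1 - 1 / p)) has_real_derivative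
      - (2 - 2 / p) * q\<^sup>2 * sin (am2 p x q) * cos (am2 p x q)) (at x)"
    and "((\<lambda>x. - (2 - 2 / p) * q\<^sup>2 * sin (am2 p x q) * cos (am2 p x q)) has_real_derivative
      - (2 - 2 / p) * q\<^sup>2 * (1 - 2 * (sin (am2 p x q))\<^sup>2) * dn_p p x q) (at x)"
proof -
  define \<theta> where "\<theta> x = am2 p x q" for x
  define u where "u x = 1 - q\<^sup>2 * (sin (\<theta> x))\<^sup>2" for x
  have pos: "u x > 0" for x
    using q_sin_less_1[of q "\<theta> x"] q by (simp add: u_def)
  have \<theta>: "(\<theta> has_real_derivative u x powr (1 / p)) (at x)" for x
    unfolding \<theta>_def[abs_def] u_def using DERIV_am2[OF p q] .
  have "(u has_real_derivative - (2 * q\<^sup>2 * sin (\<theta> x) * cos (\<theta> x) * u x powr (1 / p))) (at x)"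
    unfolding u_def[abs_def] using \<theta>[of x] by (auto intro!: derivative_eq_intros simp: u_def)
  then have "((\<lambda>x. u x powr (1 - 1 / p)) has_real_derivative
     ((1 - 1 / p) * u x powr (1 - 1 / p - 1)) * (- (2 * q\<^sup>2 * sin (\<theta> x) * cos (\<theta> x) * u x powr (1 / p)))) (at x)"
    using pos by (intro DERIV_chain2[OF has_real_derivative_powr])
  also have "((1 - 1 / p) * u x powr (1 - 1 / p - 1)) * (- (2 * q\<^sup>2 * sin (\<theta> x) * cos (\<theta> x) * u x powr (1 / p)))
    = - (2 - 2 / p) * q\<^sup>2 * sin (\<theta> x) * cos (\<theta> x) * (u x powr (1 - 1 / p - 1) * u x powr (1 / p))"
    by (simp add: field_simps)
  also have "u x powr (1 - 1 / p - 1) * u x powr (1 / p) = 1"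
    using pos[of x] by (simp add: powr_add[symmetric])
  finally show "((\<lambda>x. (1 - q\<^sup>2 * (sin (am2 p x q))\<^sup>2) powr (1 - 1 / p)) has_real_derivative
      - (2 - 2 / p) * q\<^sup>2 * sin (am2 p x q) * cos (am2 p x q)) (at x)"
    by (simp add: u_def \<theta>_def)
  have "((\<lambda>x. sin (\<theta> x) * cos (\<theta> x)) has_real_derivative
      (cos (\<theta> x) * u x powr (1 / p)) * cos (\<theta> x) + (- sin (\<theta> x) * u x powr (1 / p)) * sin (\<theta> x)) (at x)"
    by (intro DERIV_mult DERIV_chain2[OF DERIV_sin] DERIV_chain2[OF DERIV_cos] \<theta>)
  also have "(cos (\<theta> x) * u x powr (1 / p)) * cos (\<theta> x) + (- sin (\<theta> x) * u x powr (1 / p)) * sin (\<theta> x)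
    = ((cos (\<theta> x))\<^sup>2 - (sin (\<theta> x))\<^sup>2) * dn_p p x q"
    by (simp add: dn_p_def u_def \<theta>_def power2_eq_square algebra_simps)
  also have "(cos (\<theta> x))\<^sup>2 - (sin (\<theta> x))\<^sup>2 = 1 - 2 * (sin (\<theta> x))\<^sup>2"
    by (simp add: cos_squared_eq)
  finally have "((\<lambda>x. (- (2 - 2 / p) * q\<^sup>2) * (sin (\<theta> x) * cos (\<theta> x))) has_real_derivative
      (- (2 - 2 / p) * q\<^sup>2) * ((1 - 2 * (sin (\<theta> x))\<^sup>2) * dn_p p x q)) (at x)"
    by (rule DERIV_cmult)
  then show "((\<lambda>x. - (2 - 2 / p) * q\<^sup>2 * sin (am2 p x q) * cos (am2 p x q)) has_real_derivative
      - (2 - 2 / p) * q\<^sup>2 * (1 - 2 * (sin (am2 p x q))\<^sup>2) * dn_p p x q) (at x)"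
    by (simp add: \<theta>_def mult.assoc)
qed

lemma sgn_pow_cn:
  assumes "p > 0"
  shows "sgn_pow (p - 2) (cn_p p x q) = sgn_pow (1 - 2 / p) (cos (am1 p x q))"
proof -
  have "(p - 2) * (2 / p - 1 + 1) + (2 / p - 1) = 1 - 2 / p"
    using assms by (simp add: field_simps)
  then show ?thesis
    by (simp only: cn_p_def sgn_pow_sgn_pow)
qed

lemma abs_powr_p: "\<bar>A\<bar> powr p = \<bar>A\<bar> powr (p - 2) * A\<^sup>2" for A p :: real
proof -
  have "\<bar>A\<bar> powr p = \<bar>A\<bar> powr (p - 2 + 2)"
    by simp
  also have "\<dots> = \<bar>A\<bar> powr (p - 2) * \<bar>A\<bar> powr 2"
    by (rule powr_add)
  also have "\<bar>A\<bar> powr 2 = A\<^sup>2"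
    by (simp add: powr_numeral)
  finally show ?thesis .
qed

lemma abs_sgn_pow_powr_p:
  assumes "p > 0"
  shows "\<bar>sgn_pow (2 / p - 1) c\<bar> powr p = c\<^sup>2"
proof -
  have "\<bar>sgn_pow (2 / p - 1) c\<bar> powr p = \<bar>c\<bar> powr 2"
    using assms by (simp add: abs_sgn_pow powr_powr)
  then show ?thesis
    by (simp add: powr_numeral)
qed

definition cn_params :: "real \<Rightarrow> real \<Rightarrow> real \<Rightarrow> real \<Rightarrow> real \<Rightarrow> bool" where
  "cn_params p lam A \<alpha> q \<longleftrightarrow> \<alpha> > 0 \<and> 0 < q \<and> q \<le> 1 \<and> A\<^sup>2 = 4 * \<alpha>\<^sup>2 * q\<^sup>2 \<and>
     lam = 2 * (p - 1) * \<bar>A\<bar> powr (p - 2) * \<alpha>\<^sup>2 * (2 * q\<^sup>2 - 1)"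

text \<open>\<open>cn_curve\<close> and \<open>cn_curve'\<close> are position W and velocity W' as
  functions of the angle, a parametrised curve in phase space. Along a solution the angle is
  \<open>am1 p (\<alpha> * s + \<beta>) q\<close>.\<close>

definition cn_curve :: "real \<Rightarrow> real \<Rightarrow> real \<Rightarrow> real" where
  "cn_curve p A \<theta> = sgn_pow (p - 2) (A * sgn_pow (2 / p - 1) (cos \<theta>))"

definition cn_curve' :: "real \<Rightarrow> real \<Rightarrow> real \<Rightarrow> real \<Rightarrow> real \<Rightarrow> real" where
  "cn_curve' p A \<alpha> q \<theta> =
     - (\<bar>A\<bar> powr (p - 2) * A * \<alpha> * (2 - 2 / p) * sin \<theta> * sqrt (1 - q\<^sup>2 * (sin \<theta>)\<^sup>2))"

text \<open>The value of the energy on a cn curve; with the dn parameter relations, the same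
  expression with a minus sign is the energy on a dn curve.\<close>

definition cn_energy :: "real \<Rightarrow> real \<Rightarrow> real \<Rightarrow> real \<Rightarrow> real" where
  "cn_energy p A \<alpha> q = 4 * (p - 1)\<^sup>2 * (\<bar>A\<bar> powr (p - 2))\<^sup>2 * A\<^sup>2 * \<alpha>\<^sup>2 * (1 - q\<^sup>2)"

text \<open>In terms of |k|^p = |A|^p cos^2 the potential is a polynomial in sin^2, and so is the
  squared velocity. The parameter relations make all but the constant term cancel.\<close>

lemma energy_cn_curve:
  assumes p: "p > 1" and par: "cn_params p lam A \<alpha> q"
  shows "energy p lam (cn_curve p A \<theta>) (cn_curve' p A \<alpha> q \<theta>) = cn_energy p A \<alpha> q"
proof -
  define P c s where "P = \<bar>A\<bar> powr (p - 2)" and "c = cos \<theta>" and "s = sin \<theta>"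
  have c2: "c\<^sup>2 = 1 - s\<^sup>2"
    by (simp add: c_def s_def cos_squared_eq)
  have A: "A\<^sup>2 = 4 * \<alpha>\<^sup>2 * q\<^sup>2" and lam: "lam = 2 * (p - 1) * P * \<alpha>\<^sup>2 * (2 * q\<^sup>2 - 1)" and q: "0 < q" "q \<le> 1"
    using par by (auto simp: cn_params_def P_def)
  have "q\<^sup>2 * s\<^sup>2 \<le> 1"
    unfolding s_def using q by (intro mult_le_one) (auto simp: abs_square_le_1)
  then have r: "(sqrt (1 - q\<^sup>2 * s\<^sup>2))\<^sup>2 = 1 - q\<^sup>2 * s\<^sup>2"
    by simp
  have "\<bar>A * sgn_pow (2 / p - 1) c\<bar> powr p = P * A\<^sup>2 * c\<^sup>2"
    using p abs_sgn_pow_powr_p[of p c] abs_powr_p[of A p] by (simp add: abs_mult powr_mult P_def)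
  then have F: "F_pot p lam (cn_curve p A \<theta>) = (p - 1)\<^sup>2 * (P * A\<^sup>2 * c\<^sup>2)\<^sup>2 - 2 * lam * (p - 1) * (P * A\<^sup>2 * c\<^sup>2)"
    unfolding cn_curve_def using F_pot_sgn_pow[OF p] by (simp add: c_def)
  have "p * cn_curve' p A \<alpha> q \<theta> = - (2 * (p - 1) * P * A * \<alpha> * s * sqrt (1 - q\<^sup>2 * s\<^sup>2))"
    using p by (simp add: cn_curve'_def P_def s_def field_simps)
  then have "p\<^sup>2 * (cn_curve' p A \<alpha> q \<theta>)\<^sup>2 = (2 * (p - 1) * P * A * \<alpha> * s * sqrt (1 - q\<^sup>2 * s\<^sup>2))\<^sup>2"
    by (metis power2_minus power_mult_distrib)
  also have "\<dots> = 4 * (p - 1)\<^sup>2 * P\<^sup>2 * A\<^sup>2 * \<alpha>\<^sup>2 * s\<^sup>2 * (1 - q\<^sup>2 * s\<^sup>2)"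
    by (simp only: power_mult_distrib r) simp
  finally have "energy p lam (cn_curve p A \<theta>) (cn_curve' p A \<alpha> q \<theta>) =
      4 * (p - 1)\<^sup>2 * P\<^sup>2 * A\<^sup>2 * \<alpha>\<^sup>2 * s\<^sup>2 * (1 - q\<^sup>2 * s\<^sup>2)
      + ((p - 1)\<^sup>2 * (P * A\<^sup>2 * c\<^sup>2)\<^sup>2 - 2 * lam * (p - 1) * (P * A\<^sup>2 * c\<^sup>2))"
    by (simp add: energy_def F)
  also have "\<dots> = 4 * (p - 1)\<^sup>2 * P\<^sup>2 * A\<^sup>2 * \<alpha>\<^sup>2 * (1 - q\<^sup>2)"
    unfolding lam c2 power_mult_distrib A by algebra
  finally show ?thesis
    by (simp add: cn_energy_def P_def)
qed

lemma cn_curve_am1: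
  assumes "p > 1"
  shows "cn_curve p A (am1 p x q) = sgn_pow (p - 2) (A * cn_p p x q)"
  by (simp add: cn_curve_def cn_p_def)

lemma cn_solution:
  assumes p: "p > 1" and par: "cn_params p lam A \<alpha> q"
  shows "((\<lambda>s. sgn_pow (p - 2) (A * cn_p p (\<alpha> * s + \<beta>) q)) has_real_derivative
      cn_curve' p A \<alpha> q (am1 p (\<alpha> * s + \<beta>) q)) (at s)" (is ?thesis1)
    and "((\<lambda>s. cn_curve' p A \<alpha> q (am1 p (\<alpha> * s + \<beta>) q)) has_real_derivative
      ode_rhs p lam (sgn_pow (p - 2) (A * cn_p p (\<alpha> * s + \<beta>) q))) (at s)" (is ?thesis2)
proof -
  have q: "0 < q" "q \<le> 1" and A: "A\<^sup>2 = 4 * \<alpha>\<^sup>2 * q\<^sup>2"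
    and lam: "lam = 2 * (p - 1) * \<bar>A\<bar> powr (p - 2) * \<alpha>\<^sup>2 * (2 * q\<^sup>2 - 1)"
    using par by (auto simp: cn_params_def)
  have aff: "((\<lambda>s. \<alpha> * s + \<beta>) has_real_derivative \<alpha>) (at s)" for s
    by (auto intro!: derivative_eq_intros)
  define S where "S = \<bar>A\<bar> powr (p - 2) * A"
  have "sgn_pow (p - 2) (A * cn_p p x q) = S * sgn_pow (1 - 2 / p) (cos (am1 p x q))" for x
    using p by (simp add: sgn_pow_mult sgn_pow_cn) (simp add: S_def sgn_pow_def)
  moreover have "((\<lambda>s. S * sgn_pow (1 - 2 / p) (cos (am1 p (\<alpha> * s + \<beta>) q))) has_real_derivative
      S * (- (2 - 2 / p) * sin (am1 p (\<alpha> * s + \<beta>) q) *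
        sqrt (1 - q\<^sup>2 * (sin (am1 p (\<alpha> * s + \<beta>) q))\<^sup>2) * \<alpha>)) (at s)"
    by (rule DERIV_cmult[OF DERIV_chain2[OF DERIV_cn_power(1)[OF p q] aff]])
  moreover have curve: "S * (- (2 - 2 / p) * sin \<theta> * sqrt (1 - q\<^sup>2 * (sin \<theta>)\<^sup>2) * \<alpha>)
      = cn_curve' p A \<alpha> q \<theta>" for \<theta>
  proof -
    have "S * (- m * x * y * \<alpha>) = - (S * \<alpha> * m * x * y)" for m x y
      by simp
    then show ?thesis
      unfolding cn_curve'_def S_def by blast
  qed
  ultimately show ?thesis1
    by simp
  define \<theta> where "\<theta> = am1 p (\<alpha> * s + \<beta>) q"
  define k where "k = A * cn_p p (\<alpha> * s + \<beta>) q"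
  have "((\<lambda>s. (S * \<alpha>) * (- (2 - 2 / p) * sin (am1 p (\<alpha> * s + \<beta>) q) *
        sqrt (1 - q\<^sup>2 * (sin (am1 p (\<alpha> * s + \<beta>) q))\<^sup>2))) has_real_derivative
     (S * \<alpha>) * (- (2 - 2 / p) * cn_p p (\<alpha> * s + \<beta>) q * (1 - 2 * q\<^sup>2 * (sin \<theta>)\<^sup>2) * \<alpha>)) (at s)"
    unfolding \<theta>_def by (rule DERIV_cmult[OF DERIV_chain2[OF DERIV_cn_power(2)[OF p q] aff]])
  also have "(\<lambda>s. (S * \<alpha>) * (- (2 - 2 / p) * sin (am1 p (\<alpha> * s + \<beta>) q) *
        sqrt (1 - q\<^sup>2 * (sin (am1 p (\<alpha> * s + \<beta>) q))\<^sup>2))) = (\<lambda>s. cn_curve' p A \<alpha> q (am1 p (\<alpha> * s + \<beta>) q))"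
    unfolding curve[symmetric] by (simp only: mult_ac)
  also have "(S * \<alpha>) * (- (2 - 2 / p) * cn_p p (\<alpha> * s + \<beta>) q * (1 - 2 * q\<^sup>2 * (sin \<theta>)\<^sup>2) * \<alpha>)
    = - (2 * (p - 1) * \<bar>A\<bar> powr (p - 2) * \<alpha>\<^sup>2 * (1 - 2 * q\<^sup>2 * (sin \<theta>)\<^sup>2)) * k / p"
    using p by (simp add: S_def k_def field_simps power2_eq_square)
  \<comment> \<open>The relation A^2 = 4 \<alpha>^2 q^2 turns the q-dependent part into |k|^p, and
    the rest is exactly lam.\<close>
  also have "2 * (p - 1) * \<bar>A\<bar> powr (p - 2) * \<alpha>\<^sup>2 * (1 - 2 * q\<^sup>2 * (sin \<theta>)\<^sup>2)
    = (p - 1) * (\<bar>A\<bar> powr (p - 2) * (4 * \<alpha>\<^sup>2 * q\<^sup>2) * (1 - (sin \<theta>)\<^sup>2)) - lam"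
    unfolding lam by algebra
  also have "\<bar>A\<bar> powr (p - 2) * (4 * \<alpha>\<^sup>2 * q\<^sup>2) * (1 - (sin \<theta>)\<^sup>2) = \<bar>k\<bar> powr p"
  proof -
    have "\<bar>k\<bar> powr p = \<bar>A\<bar> powr p * \<bar>cn_p p (\<alpha> * s + \<beta>) q\<bar> powr p"
      by (simp add: k_def abs_mult powr_mult)
    also have "\<bar>cn_p p (\<alpha> * s + \<beta>) q\<bar> powr p = (cos \<theta>)\<^sup>2"
      using p by (simp add: cn_p_def abs_sgn_pow_powr_p \<theta>_def)
    finally show ?thesis
      using abs_powr_p[of A p] by (simp add: A cos_squared_eq)
  qed
  also have "- ((p - 1) * \<bar>k\<bar> powr p - lam) * k / p = ode_rhs p lam (sgn_pow (p - 2) k)"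
    using ode_rhs_sgn_pow[OF p] by simp
  finally show ?thesis2
    by (simp add: k_def)
qed

text \<open>Solving the energy identity for the velocity gives p^2 w1^2 as a positive constant times
  (1 - x^2)(1 - q^2 + q^2 x^2), where x is the would-be cosine. Nonnegativity forces |x| \<le> 1,
  and the two angles with cosine x have opposite velocities. For q = 1 the second factor is positive
  only when x is nonzero, whence the sign condition. The bound by pi lets
  \<open>core_through\<close> place the angle within a single core.\<close>

lemma cn_match:
  assumes p: "p > 1" and par: "cn_params p lam A \<alpha> q" and sgn: "q < 1 \<or> w0 * A > 0"
    and E: "energy p lam w0 w1 = cn_energy p A \<alpha> q"
  obtains \<beta> where "A * cn_p p \<beta> q = sgn_pow ((2 - p) / (p - 1)) w0"
    "cn_curve' p A \<alpha> q (am1 p \<beta> q) = w1" "\<bar>am1 p \<beta> q\<bar> \<le> pi"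
proof -
  define P where "P = \<bar>A\<bar> powr (p - 2)"
  have q: "0 < q" "q \<le> 1" and \<alpha>: "\<alpha> > 0" and A: "A\<^sup>2 = 4 * \<alpha>\<^sup>2 * q\<^sup>2"
    and lam: "lam = 2 * (p - 1) * P * \<alpha>\<^sup>2 * (2 * q\<^sup>2 - 1)"
    using par by (auto simp: cn_params_def P_def)
  have A0: "A \<noteq> 0"
    using A \<alpha> q by auto
  then have P0: "P > 0"
    by (simp add: P_def)
  define k0 where "k0 = sgn_pow ((2 - p) / (p - 1)) w0"
  have w0: "w0 = sgn_pow (p - 2) k0"
    using p by (simp add: k0_def sgn_pow_inverse)
  \<comment> \<open>The power is inverse to the one in \<open>cn_p\<close>, so an angle has the
    right position exactly if its cosine is x.\<close>
  define x where "x = sgn_pow (p / 2 - 1) (k0 / A)"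
  have x: "sgn_pow (2 / p - 1) x = k0 / A"
  proof -
    have "(2 / p - 1) * (p / 2 - 1 + 1) + (p / 2 - 1) = 0"
      using p by (simp add: field_simps)
    then show ?thesis
      unfolding x_def sgn_pow_sgn_pow by simp
  qed
  have k0: "\<bar>k0\<bar> powr p = P * A\<^sup>2 * x\<^sup>2"
  proof -
    have "\<bar>k0\<bar> powr p = (\<bar>A\<bar> * \<bar>sgn_pow (2 / p - 1) x\<bar>) powr p"
    proof -
      have "k0 = A * sgn_pow (2 / p - 1) x"
        unfolding x using A0 by simp
      then show ?thesis
        by (metis abs_mult)
    qed
    then show ?thesis
      using p by (simp add: powr_mult abs_sgn_pow_powr_p abs_powr_p[of A p] P_def)
  qed
  have w1: "p\<^sup>2 * w1\<^sup>2 = 4 * (p - 1)\<^sup>2 * P\<^sup>2 * A\<^sup>2 * \<alpha>\<^sup>2 * ((1 - x\<^sup>2) * (1 - q\<^sup>2 + q\<^sup>2 * x\<^sup>2))"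
  proof -
    have "p\<^sup>2 * w1\<^sup>2 = cn_energy p A \<alpha> q - ((p - 1)\<^sup>2 * (P * A\<^sup>2 * x\<^sup>2)\<^sup>2 - 2 * lam * (p - 1) * (P * A\<^sup>2 * x\<^sup>2))"
      using E F_pot_sgn_pow[OF p, of lam k0] unfolding energy_def w0 k0 by simp
    also have "\<dots> = 4 * (p - 1)\<^sup>2 * P\<^sup>2 * A\<^sup>2 * \<alpha>\<^sup>2 * ((1 - x\<^sup>2) * (1 - q\<^sup>2 + q\<^sup>2 * x\<^sup>2))"
      unfolding cn_energy_def P_def[symmetric] lam power_mult_distrib A by algebra
    finally show ?thesis .
  qed
  have x0: "x > 0" if "\<not> q < 1"
  proof -
    have "w0 * A > 0"
      using sgn that by simp
    moreover have "k0 > 0 \<longleftrightarrow> w0 > 0" "k0 < 0 \<longleftrightarrow> w0 < 0"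
      unfolding k0_def by (metis sgn_sgn_pow sgn_1_pos) (metis sgn_sgn_pow sgn_1_neg)
    ultimately have "k0 / A > 0"
      by (auto simp: zero_less_mult_iff zero_less_divide_iff)
    then show ?thesis
      unfolding x_def by (subst sgn_pow_pos) auto
  qed
  have pos: "1 - q\<^sup>2 + q\<^sup>2 * x\<^sup>2 > 0"
  proof (cases "q < 1")
    case True
    then have "q\<^sup>2 < 1"
      using q by (simp add: power_less_one_iff)
    moreover have "q\<^sup>2 * x\<^sup>2 \<ge> 0"
      by simp
    ultimately show ?thesis
      by linarith
  next
    case False
    then show ?thesis
      using x0 q by simp
  qed
  have "0 \<le> 4 * (p - 1)\<^sup>2 * P\<^sup>2 * A\<^sup>2 * \<alpha>\<^sup>2 * ((1 - x\<^sup>2) * (1 - q\<^sup>2 + q\<^sup>2 * x\<^sup>2))"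
    unfolding w1[symmetric] by simp
  moreover have "4 * (p - 1)\<^sup>2 * P\<^sup>2 * A\<^sup>2 * \<alpha>\<^sup>2 > 0"
    using p P0 A0 \<alpha> by simp
  ultimately have "1 - x\<^sup>2 \<ge> 0"
    using pos by (simp add: zero_le_mult_iff)
  then have x1: "- 1 \<le> x" "x \<le> 1"
    using abs_square_le_1[of x] by auto
  define \<theta>0 where "\<theta>0 = arccos x"
  have cos\<theta>0: "cos \<theta>0 = x"
    unfolding \<theta>0_def using x1 by (rule cos_arccos)
  have "\<bar>\<theta>0\<bar> \<le> pi"
    unfolding \<theta>0_def using arccos_lbound[OF x1] arccos_ubound[OF x1] by simp
  have sin\<theta>0: "(sin \<theta>0)\<^sup>2 = 1 - x\<^sup>2"
    using cos\<theta>0 by (simp add: sin_squared_eq)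
  \<comment> \<open>For q = 1 the domain of \<open>F1\<close> may be bounded; x > 0 keeps arccos x
    below pi/2.\<close>
  have dom: "\<theta>0 \<in> F_dom p q" "- \<theta>0 \<in> F_dom p q"
  proof -
    have "\<theta>0 < pi / 2" "\<theta>0 \<ge> 0" if "q = 1"
      using arccos_less_arccos[of 0 x] x0 x1 that arccos_lbound[of x] by (auto simp: \<theta>0_def)
    then show "\<theta>0 \<in> F_dom p q" "- \<theta>0 \<in> F_dom p q"
      by (auto simp: F_dom_def)
  qed
  have "p * cn_curve' p A \<alpha> q \<theta>0 = - (2 * (p - 1) * P * A * \<alpha> * sin \<theta>0 * sqrt (1 - q\<^sup>2 * (sin \<theta>0)\<^sup>2))"
    using p by (simp add: cn_curve'_def P_def field_simps)
  then have "(p * cn_curve' p A \<alpha> q \<theta>0)\<^sup>2 = (2 * (p - 1) * P * A * \<alpha> * sin \<theta>0 * sqrt (1 - q\<^sup>2 * (sin \<theta>0)\<^sup>2))\<^sup>2"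
    by simp
  also have "\<dots> = 4 * (p - 1)\<^sup>2 * P\<^sup>2 * A\<^sup>2 * \<alpha>\<^sup>2 * (sin \<theta>0)\<^sup>2 * (sqrt (1 - q\<^sup>2 * (sin \<theta>0)\<^sup>2))\<^sup>2"
    by (simp only: power_mult_distrib) simp
  also have "(sqrt (1 - q\<^sup>2 * (sin \<theta>0)\<^sup>2))\<^sup>2 = 1 - q\<^sup>2 + q\<^sup>2 * x\<^sup>2"
    using pos by (simp add: sin\<theta>0 algebra_simps)
  finally have "(p * cn_curve' p A \<alpha> q \<theta>0)\<^sup>2 = (p * w1)\<^sup>2"
    unfolding power_mult_distrib[of p w1] w1 sin\<theta>0 by simp
  then have "cn_curve' p A \<alpha> q \<theta>0 = w1 \<or> cn_curve' p A \<alpha> q \<theta>0 = - w1"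
    using p by (simp add: power_mult_distrib power2_eq_iff)
  moreover have "cn_curve' p A \<alpha> q (- \<theta>0) = - cn_curve' p A \<alpha> q \<theta>0"
    by (simp add: cn_curve'_def)
  ultimately obtain \<theta> where \<theta>: "\<theta> \<in> F_dom p q" "cos \<theta> = x" "cn_curve' p A \<alpha> q \<theta> = w1" "\<bar>\<theta>\<bar> \<le> pi"
    using dom cos\<theta>0 \<open>\<bar>\<theta>0\<bar> \<le> pi\<close> by (metis abs_minus_cancel cos_minus minus_minus)
  show ?thesis
  proof (rule that[of "F1 p \<theta> q"])
    have am: "am1 p (F1 p \<theta> q) q = \<theta>"
      using am1_F1[OF p q] \<theta>(1) by simp
    show "cn_curve' p A \<alpha> q (am1 p (F1 p \<theta> q) q) = w1"
      unfolding am by (rule \<theta>)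
    show "\<bar>am1 p (F1 p \<theta> q) q\<bar> \<le> pi"
      unfolding am by (rule \<theta>)
    show "A * cn_p p (F1 p \<theta> q) q = sgn_pow ((2 - p) / (p - 1)) w0"
      using A0 by (simp add: cn_p_def am \<theta>(2) x k0_def)
  qed
qed

text \<open>At the largest |k| the velocity is 0, so (p - 1) A^p = lam + R. The relations for lam
  and A^2 then give 2 (p - 1) A^(p-2) \<alpha>^2 = R and q^2 = (lam + R)/(2R), with q < 1 because
  positive energy means R > |lam|.\<close>

lemma cn_params_exist:
  assumes p: "p > 1" and D: "D > 0"
  obtains A \<alpha> q where "cn_params p lam A \<alpha> q" "q < 1" "cn_energy p A \<alpha> q = D"
proof -
  define R where "R = sqrt (lam\<^sup>2 + D)"
  have R2: "R\<^sup>2 = lam\<^sup>2 + D"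
    unfolding R_def using D by (simp add: add_nonneg_pos less_imp_le)
  have "\<bar>lam\<bar> < R"
    unfolding R_def using D by (intro real_less_rsqrt) simp
  then have R: "R > 0" "lam + R > 0" "R - lam > 0"
    by auto
  define a where "a = (lam + R) / (p - 1)"
  have a: "a > 0"
    unfolding a_def using R p by simp
  define A where "A = a powr (1 / p)"
  define P where "P = A powr (p - 2)"
  have A: "A > 0" and P: "P > 0"
    using a by (auto simp: A_def P_def)
  have "A powr p = a"
    unfolding A_def using p a by (simp add: powr_powr)
  then have PA: "P * A\<^sup>2 = a"
    using abs_powr_p[of A p] A by (simp add: P_def)
  define \<alpha> where "\<alpha> = sqrt (R / (2 * (p - 1) * P))"
  have \<alpha>2: "\<alpha>\<^sup>2 = R / (2 * (p - 1) * P)"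
    unfolding \<alpha>_def using R p P by simp
  define q where "q = sqrt ((lam + R) / (2 * R))"
  have q2: "q\<^sup>2 = (lam + R) / (2 * R)"
    unfolding q_def using R by simp
  show ?thesis
  proof (rule that[of A \<alpha> q])
    show "q < 1"
      unfolding q_def using R by (simp add: real_sqrt_lt_1_iff field_simps)
    have "4 * \<alpha>\<^sup>2 * q\<^sup>2 = a / P"
      unfolding \<alpha>2 q2 a_def using R p P by (simp add: field_simps)
    also have "\<dots> = A\<^sup>2"
      using PA P by (simp add: field_simps)
    finally have 1: "A\<^sup>2 = 4 * \<alpha>\<^sup>2 * q\<^sup>2" ..
    have 2: "lam = 2 * (p - 1) * P * \<alpha>\<^sup>2 * (2 * q\<^sup>2 - 1)"
      unfolding \<alpha>2 q2 using R p P by (simp add: field_simps)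
    show "cn_params p lam A \<alpha> q"
      unfolding cn_params_def
    proof (intro conjI)
      show "\<alpha> > 0" "q > 0"
        using R p P by (simp_all add: \<alpha>_def q_def)
      show "lam = 2 * (p - 1) * \<bar>A\<bar> powr (p - 2) * \<alpha>\<^sup>2 * (2 * q\<^sup>2 - 1)"
        using 2 A unfolding P_def by (simp only: abs_of_pos)
    qed (use 1 \<open>q < 1\<close> in auto)
    have "cn_energy p A \<alpha> q = 4 * (p - 1)\<^sup>2 * (P * (P * A\<^sup>2)) * \<alpha>\<^sup>2 * (1 - q\<^sup>2)"
      using A by (simp add: cn_energy_def P_def[symmetric] power2_eq_square)
    also have "\<dots> = (R + lam) * (R - lam)"
    proof -
      have q': "1 - q\<^sup>2 = (R - lam) / (2 * R)"
        unfolding q2 using R by (simp add: field_simps)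
      then show ?thesis
        unfolding PA \<alpha>2 a_def q' using R p P by (simp add: divide_simps power2_eq_square) (simp add: algebra_simps)
    qed
    also have "\<dots> = D"
      using R2 by (simp add: algebra_simps power2_eq_square)
    finally show "cn_energy p A \<alpha> q = D" .
  qed
qed

text \<open>For q = 1 the relations reduce to A^2 = 4 \<alpha>^2 and lam = (p - 1) |A|^p / 2.
  Solving for |A| explains the constant \<open>A_p\<close>, which is half of it.\<close>

lemma sech_params:
  assumes p: "p > 1" and lam: "lam > 0" and A: "\<bar>A\<bar> = 2 * A_p p lam"
  shows "cn_params p lam A (A_p p lam) 1" "cn_energy p A (A_p p lam) 1 = 0" "A_p p lam > 0"
proof -
  show pos: "A_p p lam > 0"
    using p lam by (simp add: A_p_def)
  have "2 * A_p p lam = (2 * lam / (p - 1)) powr (1 / p)"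
    by (simp add: A_p_def)
  then have "\<bar>A\<bar> powr p = 2 * lam / (p - 1)"
    unfolding A using p lam by (simp add: powr_powr)
  then have 1: "lam = (p - 1) * \<bar>A\<bar> powr (p - 2) * A\<^sup>2 / 2"
    using abs_powr_p[of A p] p by (simp add: field_simps)
  have 2: "A\<^sup>2 = 4 * (A_p p lam)\<^sup>2"
    using A by (metis power2_abs power_mult_distrib[of 2 "A_p p lam" 2] four_x_squared power_mult_distrib)
  show "cn_params p lam A (A_p p lam) 1"
    unfolding cn_params_def
  proof (intro conjI)
    have "(p - 1) * \<bar>A\<bar> powr (p - 2) * A\<^sup>2 / 2
        = 2 * (p - 1) * \<bar>A\<bar> powr (p - 2) * (A_p p lam)\<^sup>2 * (2 * 1\<^sup>2 - 1)"
      unfolding 2 by simp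
    with 1 show "lam = 2 * (p - 1) * \<bar>A\<bar> powr (p - 2) * (A_p p lam)\<^sup>2 * (2 * 1\<^sup>2 - 1)"
      by (rule trans)
  qed (use pos 2 in auto)
  show "cn_energy p A (A_p p lam) 1 = 0"
    by (simp add: cn_energy_def)
qed

subsection \<open>Solutions of dn type\<close>

definition dn_params :: "real \<Rightarrow> real \<Rightarrow> real \<Rightarrow> real \<Rightarrow> real \<Rightarrow> bool" where
  "dn_params p lam A \<alpha> q \<longleftrightarrow> \<alpha> > 0 \<and> 0 < q \<and> q < 1 \<and> A\<^sup>2 = 4 * \<alpha>\<^sup>2 \<and>
     lam = 2 * (p - 1) * \<bar>A\<bar> powr (p - 2) * \<alpha>\<^sup>2 * (2 - q\<^sup>2)"

definition dn_curve :: "real \<Rightarrow> real \<Rightarrow> real \<Rightarrow> real \<Rightarrow> real" where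
  "dn_curve p A q \<theta> = sgn_pow (p - 2) (A * (1 - q\<^sup>2 * (sin \<theta>)\<^sup>2) powr (1 / p))"

definition dn_curve' :: "real \<Rightarrow> real \<Rightarrow> real \<Rightarrow> real \<Rightarrow> real \<Rightarrow> real" where
  "dn_curve' p A \<alpha> q \<theta> = - (\<bar>A\<bar> powr (p - 2) * A * \<alpha> * (2 - 2 / p) * q\<^sup>2 * sin \<theta> * cos \<theta>)"

lemma abs_dn_powr_p:
  fixes A u p :: real
  assumes "p > 0" "u > 0"
  shows "\<bar>A * u powr (1 / p)\<bar> powr p = \<bar>A\<bar> powr (p - 2) * A\<^sup>2 * u"
proof -
  have "\<bar>A * u powr (1 / p)\<bar> powr p = \<bar>A\<bar> powr p * u"
    using assms by (simp add: abs_mult powr_mult powr_powr)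
  then show ?thesis
    by (simp only: abs_powr_p[of A p])
qed

text \<open>The same cancellation as for cn, with |k|^p = |A|^p (1 - q^2 sin^2); only the sign of
  the surviving constant differs.\<close>

lemma energy_dn_curve:
  assumes p: "p > 1" and par: "dn_params p lam A \<alpha> q"
  shows "energy p lam (dn_curve p A q \<theta>) (dn_curve' p A \<alpha> q \<theta>) = - cn_energy p A \<alpha> q"
proof -
  define P c s where "P = \<bar>A\<bar> powr (p - 2)" and "c = cos \<theta>" and "s = sin \<theta>"
  have c2: "c\<^sup>2 = 1 - s\<^sup>2"
    by (simp add: c_def s_def cos_squared_eq)
  have A: "A\<^sup>2 = 4 * \<alpha>\<^sup>2" and lam: "lam = 2 * (p - 1) * P * \<alpha>\<^sup>2 * (2 - q\<^sup>2)" and q: "0 < q" "q < 1"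
    using par by (auto simp: dn_params_def P_def)
  have "1 - q\<^sup>2 * s\<^sup>2 > 0"
    using q_sin_less_1[of q \<theta>] q by (simp add: s_def)
  then have F: "F_pot p lam (dn_curve p A q \<theta>) =
      (p - 1)\<^sup>2 * (P * A\<^sup>2 * (1 - q\<^sup>2 * s\<^sup>2))\<^sup>2 - 2 * lam * (p - 1) * (P * A\<^sup>2 * (1 - q\<^sup>2 * s\<^sup>2))"
    unfolding dn_curve_def using F_pot_sgn_pow[OF p] abs_dn_powr_p[of p "1 - q\<^sup>2 * s\<^sup>2" A] p
    by (simp add: s_def P_def)
  have "p * dn_curve' p A \<alpha> q \<theta> = - (2 * (p - 1) * P * A * \<alpha> * q\<^sup>2 * s * c)"
    using p by (simp add: dn_curve'_def P_def s_def c_def field_simps)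
  then have "p\<^sup>2 * (dn_curve' p A \<alpha> q \<theta>)\<^sup>2 = (2 * (p - 1) * P * A * \<alpha> * q\<^sup>2 * s * c)\<^sup>2"
    by (metis power2_minus power_mult_distrib)
  also have "\<dots> = 4 * (p - 1)\<^sup>2 * P\<^sup>2 * A\<^sup>2 * \<alpha>\<^sup>2 * (q\<^sup>2)\<^sup>2 * s\<^sup>2 * (1 - s\<^sup>2)"
    by (simp only: power_mult_distrib c2) simp
  finally have "energy p lam (dn_curve p A q \<theta>) (dn_curve' p A \<alpha> q \<theta>) =
      4 * (p - 1)\<^sup>2 * P\<^sup>2 * A\<^sup>2 * \<alpha>\<^sup>2 * (q\<^sup>2)\<^sup>2 * s\<^sup>2 * (1 - s\<^sup>2)
      + ((p - 1)\<^sup>2 * (P * A\<^sup>2 * (1 - q\<^sup>2 * s\<^sup>2))\<^sup>2 - 2 * lam * (p - 1) * (P * A\<^sup>2 * (1 - q\<^sup>2 * s\<^sup>2)))"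
    by (simp add: energy_def F)
  also have "\<dots> = - (4 * (p - 1)\<^sup>2 * P\<^sup>2 * A\<^sup>2 * \<alpha>\<^sup>2 * (1 - q\<^sup>2))"
    unfolding lam power_mult_distrib A by algebra
  finally show ?thesis
    by (simp add: cn_energy_def P_def)
qed

lemma dn_curve_am2: "dn_curve p A q (am2 p x q) = sgn_pow (p - 2) (A * dn_p p x q)"
  by (simp add: dn_curve_def dn_p_def)

lemma dn_solution:
  assumes p: "p > 1" and par: "dn_params p lam A \<alpha> q"
  shows "((\<lambda>s. sgn_pow (p - 2) (A * dn_p p (\<alpha> * s + \<beta>) q)) has_real_derivative
      dn_curve' p A \<alpha> q (am2 p (\<alpha> * s + \<beta>) q)) (at s)" (is ?thesis1)
    and "((\<lambda>s. dn_curve' p A \<alpha> q (am2 p (\<alpha> * s + \<beta>) q)) has_real_derivative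
      ode_rhs p lam (sgn_pow (p - 2) (A * dn_p p (\<alpha> * s + \<beta>) q))) (at s)" (is ?thesis2)
proof -
  have q: "0 < q" "q < 1" and A: "A\<^sup>2 = 4 * \<alpha>\<^sup>2"
    and lam: "lam = 2 * (p - 1) * \<bar>A\<bar> powr (p - 2) * \<alpha>\<^sup>2 * (2 - q\<^sup>2)"
    using par by (auto simp: dn_params_def)
  have pos: "1 - q\<^sup>2 * (sin t)\<^sup>2 > 0" for t
    using q_sin_less_1[of q t] q by simp
  have aff: "((\<lambda>s. \<alpha> * s + \<beta>) has_real_derivative \<alpha>) (at s)" for s
    by (auto intro!: derivative_eq_intros)
  define S where "S = \<bar>A\<bar> powr (p - 2) * A"
  have "sgn_pow (p - 2) (A * dn_p p x q) = S * (1 - q\<^sup>2 * (sin (am2 p x q))\<^sup>2) powr (1 - 1 / p)" for x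
  proof -
    have "sgn_pow (p - 2) (dn_p p x q) = (1 - q\<^sup>2 * (sin (am2 p x q))\<^sup>2) powr (1 / p * (p - 1))"
      using pos[of "am2 p x q"] by (simp add: dn_p_def sgn_pow_pos powr_powr)
    also have "1 / p * (p - 1) = 1 - 1 / p"
      using p by (simp add: field_simps)
    finally show ?thesis
      by (simp add: sgn_pow_mult) (simp add: S_def sgn_pow_def)
  qed
  moreover have "((\<lambda>s. S * (1 - q\<^sup>2 * (sin (am2 p (\<alpha> * s + \<beta>) q))\<^sup>2) powr (1 - 1 / p)) has_real_derivative
      S * (- (2 - 2 / p) * q\<^sup>2 * sin (am2 p (\<alpha> * s + \<beta>) q) * cos (am2 p (\<alpha> * s + \<beta>) q) * \<alpha>)) (at s)"
    by (rule DERIV_cmult[OF DERIV_chain2[OF DERIV_dn_power(1)[OF p q] aff]])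
  moreover have curve: "S * (- (2 - 2 / p) * q\<^sup>2 * sin \<theta> * cos \<theta> * \<alpha>) = dn_curve' p A \<alpha> q \<theta>" for \<theta>
  proof -
    have "S * (- m * Q * x * y * \<alpha>) = - (S * \<alpha> * m * Q * x * y)" for m x y Q
      by simp
    then show ?thesis
      unfolding dn_curve'_def S_def by blast
  qed
  ultimately show ?thesis1
    by simp
  define \<theta> where "\<theta> = am2 p (\<alpha> * s + \<beta>) q"
  define k where "k = A * dn_p p (\<alpha> * s + \<beta>) q"
  have "((\<lambda>s. (S * \<alpha>) * (- (2 - 2 / p) * q\<^sup>2 * sin (am2 p (\<alpha> * s + \<beta>) q) * cos (am2 p (\<alpha> * s + \<beta>) q)))
     has_real_derivative
     (S * \<alpha>) * (- (2 - 2 / p) * q\<^sup>2 * (1 - 2 * (sin \<theta>)\<^sup>2) * dn_p p (\<alpha> * s + \<beta>) q * \<alpha>)) (at s)"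
    unfolding \<theta>_def by (rule DERIV_cmult[OF DERIV_chain2[OF DERIV_dn_power(2)[OF p q] aff]])
  also have "(\<lambda>s. (S * \<alpha>) * (- (2 - 2 / p) * q\<^sup>2 * sin (am2 p (\<alpha> * s + \<beta>) q) * cos (am2 p (\<alpha> * s + \<beta>) q)))
      = (\<lambda>s. dn_curve' p A \<alpha> q (am2 p (\<alpha> * s + \<beta>) q))"
    unfolding curve[symmetric] by (simp only: mult_ac)
  also have "(S * \<alpha>) * (- (2 - 2 / p) * q\<^sup>2 * (1 - 2 * (sin \<theta>)\<^sup>2) * dn_p p (\<alpha> * s + \<beta>) q * \<alpha>)
    = - (2 * (p - 1) * \<bar>A\<bar> powr (p - 2) * \<alpha>\<^sup>2 * q\<^sup>2 * (1 - 2 * (sin \<theta>)\<^sup>2)) * k / p"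
    using p by (simp add: S_def k_def field_simps power2_eq_square)
  also have "2 * (p - 1) * \<bar>A\<bar> powr (p - 2) * \<alpha>\<^sup>2 * q\<^sup>2 * (1 - 2 * (sin \<theta>)\<^sup>2)
    = (p - 1) * (\<bar>A\<bar> powr (p - 2) * A\<^sup>2 * (1 - q\<^sup>2 * (sin \<theta>)\<^sup>2)) - lam"
    unfolding lam A by algebra
  also have "\<bar>A\<bar> powr (p - 2) * A\<^sup>2 * (1 - q\<^sup>2 * (sin \<theta>)\<^sup>2) = \<bar>k\<bar> powr p"
    using abs_dn_powr_p[OF _ pos, of p A \<theta>] p by (simp add: k_def dn_p_def \<theta>_def)
  also have "- ((p - 1) * \<bar>k\<bar> powr p - lam) * k / p = ode_rhs p lam (sgn_pow (p - 2) k)"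
    using ode_rhs_sgn_pow[OF p] by simp
  finally show ?thesis2
    by (simp add: k_def)
qed

text \<open>With u = (k0/A)^p the energy identity gives p^2 w1^2 as a positive constant times (1 -
  u)(u - (1 - q^2)), which confines u to the range of dn^p. As dn never vanishes, A must have the
  sign of w0.\<close>

lemma dn_match:
  assumes p: "p > 1" and par: "dn_params p lam A \<alpha> q" and sgn: "w0 * A > 0"
    and E: "energy p lam w0 w1 = - cn_energy p A \<alpha> q"
  obtains \<beta> where "A * dn_p p \<beta> q = sgn_pow ((2 - p) / (p - 1)) w0"
    "dn_curve' p A \<alpha> q (am2 p \<beta> q) = w1"
proof -
  define P where "P = \<bar>A\<bar> powr (p - 2)"
  have q: "0 < q" "q < 1" and \<alpha>: "\<alpha> > 0" and A: "A\<^sup>2 = 4 * \<alpha>\<^sup>2"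
    and lam: "lam = 2 * (p - 1) * P * \<alpha>\<^sup>2 * (2 - q\<^sup>2)"
    using par by (auto simp: dn_params_def P_def)
  have A0: "A \<noteq> 0"
    using A \<alpha> by auto
  then have P0: "P > 0"
    by (simp add: P_def)
  define k0 where "k0 = sgn_pow ((2 - p) / (p - 1)) w0"
  have w0: "w0 = sgn_pow (p - 2) k0"
    using p by (simp add: k0_def sgn_pow_inverse)
  have "k0 > 0 \<longleftrightarrow> w0 > 0" "k0 < 0 \<longleftrightarrow> w0 < 0"
    unfolding k0_def by (metis sgn_sgn_pow sgn_1_pos) (metis sgn_sgn_pow sgn_1_neg)
  then have kA: "k0 / A > 0"
    using sgn by (auto simp: zero_less_mult_iff zero_less_divide_iff)
  define u where "u = (k0 / A) powr p"
  have u0: "u > 0"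
    using kA by (auto simp: u_def)
  have "u powr (1 / p) = k0 / A"
  proof -
    have "(v powr p) powr (1 / p) = v" if "v > 0" for v
      using p that by (simp add: powr_powr)
    then show ?thesis
      unfolding u_def using kA by blast
  qed
  then have uA: "A * u powr (1 / p) = k0"
    using A0 by simp
  have k0: "\<bar>k0\<bar> powr p = P * A\<^sup>2 * u"
    using abs_dn_powr_p[of p u A] p u0 unfolding uA P_def by simp
  have w1: "p\<^sup>2 * w1\<^sup>2 = 4 * (p - 1)\<^sup>2 * P\<^sup>2 * A\<^sup>2 * \<alpha>\<^sup>2 * ((1 - u) * (u - (1 - q\<^sup>2)))"
  proof -
    have "p\<^sup>2 * w1\<^sup>2 = - cn_energy p A \<alpha> q - ((p - 1)\<^sup>2 * (P * A\<^sup>2 * u)\<^sup>2 - 2 * lam * (p - 1) * (P * A\<^sup>2 * u))"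
      using E F_pot_sgn_pow[OF p, of lam k0] unfolding energy_def w0 k0 by simp
    also have "\<dots> = 4 * (p - 1)\<^sup>2 * P\<^sup>2 * A\<^sup>2 * \<alpha>\<^sup>2 * ((1 - u) * (u - (1 - q\<^sup>2)))"
      unfolding cn_energy_def P_def[symmetric] lam power_mult_distrib A by algebra
    finally show ?thesis .
  qed
  have "0 \<le> 4 * (p - 1)\<^sup>2 * P\<^sup>2 * A\<^sup>2 * \<alpha>\<^sup>2 * ((1 - u) * (u - (1 - q\<^sup>2)))"
    unfolding w1[symmetric] by simp
  moreover have "4 * (p - 1)\<^sup>2 * P\<^sup>2 * A\<^sup>2 * \<alpha>\<^sup>2 > 0"
    using p P0 A0 \<alpha> by simp
  ultimately have "0 \<le> (1 - u) * (u - (1 - q\<^sup>2))"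
    by (meson zero_le_mult_iff not_le order.asym mult_pos_neg)
  moreover have "q\<^sup>2 > 0"
    using q by simp
  ultimately have u: "u \<le> 1" "1 - q\<^sup>2 \<le> u"
    unfolding zero_le_mult_iff by linarith+
  \<comment> \<open>The sine of the angle sought: dn^p = 1 - q^2 sin^2 has to equal u. Reflecting
    the angle keeps the position and flips the velocity.\<close>
  define x where "x = sqrt ((1 - u) / q\<^sup>2)"
  have x2: "x\<^sup>2 = (1 - u) / q\<^sup>2"
    unfolding x_def using u by simp
  have x1: "- 1 \<le> x" "x \<le> 1"
    using u q by (auto simp: x_def field_simps intro: order_trans[of _ 0])
  define \<theta>0 where "\<theta>0 = arcsin x"
  have sin\<theta>0: "sin \<theta>0 = x"
    unfolding \<theta>0_def using x1 by (rule sin_arcsin)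
  have qs: "q\<^sup>2 * (sin \<theta>0)\<^sup>2 = 1 - u"
    unfolding sin\<theta>0 x2 using q by simp
  have qc: "q\<^sup>2 * (cos \<theta>0)\<^sup>2 = u - (1 - q\<^sup>2)"
    using qs by (simp add: cos_squared_eq algebra_simps)
  have "p * dn_curve' p A \<alpha> q \<theta>0 = - (2 * (p - 1) * P * A * \<alpha> * q\<^sup>2 * sin \<theta>0 * cos \<theta>0)"
    using p by (simp add: dn_curve'_def P_def field_simps)
  then have "(p * dn_curve' p A \<alpha> q \<theta>0)\<^sup>2 = (2 * (p - 1) * P * A * \<alpha> * q\<^sup>2 * sin \<theta>0 * cos \<theta>0)\<^sup>2"
    by simp
  also have "\<dots> = 4 * (p - 1)\<^sup>2 * P\<^sup>2 * A\<^sup>2 * \<alpha>\<^sup>2 * ((q\<^sup>2 * (sin \<theta>0)\<^sup>2) * (q\<^sup>2 * (cos \<theta>0)\<^sup>2))"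
    by algebra
  finally have "(p * dn_curve' p A \<alpha> q \<theta>0)\<^sup>2 = (p * w1)\<^sup>2"
    unfolding power_mult_distrib[of p w1] w1 qs qc by simp
  then have "dn_curve' p A \<alpha> q \<theta>0 = w1 \<or> dn_curve' p A \<alpha> q \<theta>0 = - w1"
    using p by (simp add: power_mult_distrib power2_eq_iff)
  moreover have "dn_curve' p A \<alpha> q (- \<theta>0) = - dn_curve' p A \<alpha> q \<theta>0"
    by (simp add: dn_curve'_def)
  moreover have "(sin (- \<theta>0))\<^sup>2 = (sin \<theta>0)\<^sup>2"
    by simp
  ultimately obtain \<theta> where \<theta>: "(sin \<theta>)\<^sup>2 = (sin \<theta>0)\<^sup>2" "dn_curve' p A \<alpha> q \<theta> = w1"
    by (metis minus_minus)
  show ?thesis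
  proof (rule that[of "F2 p \<theta> q"])
    have am: "am2 p (F2 p \<theta> q) q = \<theta>"
      using am2_F2[OF p q] by simp
    show "dn_curve' p A \<alpha> q (am2 p (F2 p \<theta> q) q) = w1"
      unfolding am by (rule \<theta>)
    show "A * dn_p p (F2 p \<theta> q) q = sgn_pow ((2 - p) / (p - 1)) w0"
      unfolding dn_p_def am \<theta>(1) qs k0_def[symmetric] using uA by simp
  qed
qed

text \<open>Now (p - 1) |k|^p oscillates between lam - R and lam + R. The upper value gives A and
  the ratio of the two is 1 - q^2, so q^2 = 2R/(lam + R). Both signs of A are supplied because the
  sign of w0 selects one.\<close>

lemma dn_params_exist:
  assumes p: "p > 1" and lam: "lam > 0" and D: "- lam\<^sup>2 < D" "D < 0"
  obtains A \<alpha> q where "A > 0" "dn_params p lam A \<alpha> q" "dn_params p lam (- A) \<alpha> q"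
    "- cn_energy p A \<alpha> q = D" "- cn_energy p (- A) \<alpha> q = D"
proof -
  define R where "R = sqrt (lam\<^sup>2 + D)"
  have R2: "R\<^sup>2 = lam\<^sup>2 + D"
    unfolding R_def using D by simp
  have R: "R > 0" "R < lam"
    unfolding R_def using D lam by (auto intro: real_less_lsqrt)
  define a where "a = (lam + R) / (p - 1)"
  have a: "a > 0"
    unfolding a_def using R lam p by simp
  define A where "A = a powr (1 / p)"
  define P where "P = A powr (p - 2)"
  have A: "A > 0" and P: "P > 0"
    using a by (auto simp: A_def P_def)
  have "A powr p = a"
    unfolding A_def using p a by (simp add: powr_powr)
  then have PA: "P * A\<^sup>2 = a"
    using abs_powr_p[of A p] A by (simp add: P_def)
  define \<alpha> where "\<alpha> = A / 2"
  have \<alpha>2: "\<alpha>\<^sup>2 = A\<^sup>2 / 4"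
    unfolding \<alpha>_def by (simp add: power_divide)
  define q where "q = sqrt (2 * R / (lam + R))"
  have q2: "q\<^sup>2 = 2 * R / (lam + R)"
    unfolding q_def using R lam by simp
  have q: "0 < q" "q < 1"
    unfolding q_def using R lam by (simp_all add: real_sqrt_lt_1_iff field_simps)
  have lam_eq: "lam = 2 * (p - 1) * P * \<alpha>\<^sup>2 * (2 - q\<^sup>2)"
  proof -
    have q': "2 - q\<^sup>2 = 2 * lam / (lam + R)"
      unfolding q2 using R lam by (simp add: field_simps)
    have "2 * (p - 1) * P * \<alpha>\<^sup>2 * (2 - q\<^sup>2) = (p - 1) / 2 * (P * A\<^sup>2) * (2 - q\<^sup>2)"
      unfolding \<alpha>2 by (simp add: field_simps)
    also have "\<dots> = lam"
      unfolding PA a_def q' using R lam p by (simp add: divide_simps)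
    finally show ?thesis ..
  qed
  have par: "dn_params p lam B \<alpha> q" if "\<bar>B\<bar> = A" for B
    unfolding dn_params_def
  proof (intro conjI)
    show "lam = 2 * (p - 1) * \<bar>B\<bar> powr (p - 2) * \<alpha>\<^sup>2 * (2 - q\<^sup>2)"
      using lam_eq that unfolding P_def by (simp only:)
    have "B\<^sup>2 = A\<^sup>2"
      using that by (metis power2_abs)
    then show "B\<^sup>2 = 4 * \<alpha>\<^sup>2"
      unfolding \<alpha>2 by simp
  qed (use A q in \<open>auto simp: \<alpha>_def\<close>)
  have en: "- cn_energy p B \<alpha> q = D" if "\<bar>B\<bar> = A" for B
  proof -
    have B2: "B\<^sup>2 = A\<^sup>2"
      using that by (metis power2_abs)
    have "- cn_energy p B \<alpha> q = - ((p - 1)\<^sup>2 * (P * A\<^sup>2)\<^sup>2 * (1 - q\<^sup>2))"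
      unfolding cn_energy_def that P_def[symmetric] B2 \<alpha>2 by (simp add: power2_eq_square)
    also have "1 - q\<^sup>2 = (lam - R) / (lam + R)"
      unfolding q2 using R lam by (simp add: field_simps)
    also have "(p - 1)\<^sup>2 * (P * A\<^sup>2)\<^sup>2 = (lam + R)\<^sup>2"
      unfolding PA a_def using p by (simp add: power_divide)
    also have "- ((lam + R)\<^sup>2 * ((lam - R) / (lam + R))) = - ((lam + R) * (lam - R))"
      using R lam by (simp add: power2_eq_square)
    also have "\<dots> = D"
      using R2 by (simp add: algebra_simps power2_eq_square)
    finally show ?thesis .
  qed
  show ?thesis
    using that[of A \<alpha> q] par[of A] par[of "- A"] en[of A] en[of "- A"] A by simp
qed

subsection \<open>Flat cores\<close>

lemma F1_minus: "F1 p (- x) q = - F1 p x q"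
proof -
  have "F1 p (- x) q = (LBINT t=ereal x..- 0. am1_integrand p q (- t))"
    unfolding F1_eq by (subst interval_integral_reflect) simp
  also have "\<dots> = - (LBINT t=0..ereal x. am1_integrand p q t)"
    by (subst interval_integral_endpoints_reverse) (simp add: am1_integrand_def[abs_def])
  finally show ?thesis
    by (simp add: F1_eq)
qed

lemma am1_minus:
  assumes "p > 1" "0 < q" "q \<le> 1"
  shows "am1 p (- x) q = - am1 p x q"
proof -
  have "- am1 p x q \<in> F_dom p q"
    using am1_in_F_dom[OF assms, of x] by (auto simp: F_dom_def)
  then have "am1 p (F1 p (- am1 p x q) q) q = - am1 p x q"
    by (rule am1_F1[OF assms])
  then show ?thesis
    by (simp add: F1_minus F1_am1[OF assms])
qed

lemma K_p1_eq:
  assumes "p > 2"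
  shows "K_p1 p = ereal (F1 p (pi / 2) 1)"
proof -
  have "(LBINT t=0..ereal (pi / 2). cos t powr (- 2 / p)) = (LBINT t=0..ereal (pi / 2). am1_integrand p 1 t)"
  proof (rule interval_integral_cong)
    fix t assume "t \<in> einterval (min 0 (ereal (pi / 2))) (max 0 (ereal (pi / 2)))"
    then have "0 < t" "t < pi / 2"
      using pi_gt_zero by (auto simp: einterval_def min_def max_def split: if_splits)
    then have "cos t > 0"
      by (intro cos_gt_zero) auto
    then show "cos t powr (- 2 / p) = am1_integrand p 1 t"
      by (simp add: am1_integrand_1)
  qed
  then show ?thesis
    using assms by (simp add: K_p1_def F1_eq)
qed

text \<open>For p > 2 the amplitude with q = 1 runs through the whole line; the truncation in
  \<open>sech_p\<close> keeps exactly the part before its first passages through - pi/2 and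
  pi/2.\<close>

lemma abs_am1_less_pi_half_iff:
  assumes "p > 2"
  shows "\<bar>am1 p x 1\<bar> < pi / 2 \<longleftrightarrow> \<bar>x\<bar> < F1 p (pi / 2) 1"
proof -
  have p: "p > 1" "(0::real) < 1" "(1::real) \<le> 1"
    using assms by auto
  have "pi / 2 \<in> F_dom p 1"
    using assms by (simp add: F_dom_def)
  from am1_F1[OF p this] have am: "am1 p (F1 p (pi / 2) 1) 1 = pi / 2"
    "am1 p (- F1 p (pi / 2) 1) 1 = - (pi / 2)"
    by (simp_all add: am1_minus[OF p])
  have "am1 p x 1 < am1 p (F1 p (pi / 2) 1) 1 \<longleftrightarrow> x < F1 p (pi / 2) 1"
    "am1 p (- F1 p (pi / 2) 1) 1 < am1 p x 1 \<longleftrightarrow> - F1 p (pi / 2) 1 < x"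
    by (rule strict_mono_less[OF strict_mono_am1[OF p]])+
  then show ?thesis
    unfolding am by auto
qed

lemma abs_am1_less_K:
  assumes "p > 1" "ereal \<bar>x\<bar> < K_p1 p"
  shows "\<bar>am1 p x 1\<bar> < pi / 2"
proof (cases "p > 2")
  case True
  then show ?thesis
    using assms abs_am1_less_pi_half_iff[of p x] by (simp add: K_p1_eq)
next
  case False
  then show ?thesis
    using am1_in_F_dom[of p 1 x] assms by (auto simp: F_dom_def)
qed

lemma cn_p_1_pos:
  assumes "p > 1" "ereal \<bar>x\<bar> < K_p1 p"
  shows "cn_p p x 1 > 0"
proof -
  have "cos (am1 p x 1) > 0"
    using abs_am1_less_K[OF assms] by (intro cos_gt_zero_pi) auto
  then show ?thesis
    by (simp add: cn_p_def sgn_pow_def)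
qed

context
  fixes p lam K a T :: real
  assumes p2: "p > 2" and lam0: "lam > 0"
  defines "K \<equiv> F1 p (pi / 2) 1" and "a \<equiv> A_p p lam" and "T \<equiv> T_p p lam"
begin

private lemma p1: "p > 1"
  using p2 by simp

private lemma a_pos: "a > 0"
  using sech_params(3)[OF p1 lam0, of "2 * A_p p lam"] p1 lam0 by (simp add: a_def A_p_def)

private lemma K_pos: "K > 0"
proof -
  have "\<bar>am1 p 0 1\<bar> < pi / 2"
    using am1_minus[OF p1, of 1 0] by simp
  then show ?thesis
    using abs_am1_less_pi_half_iff[OF p2, of 0] by (simp add: K_def)
qed

private lemma T_eq: "T = K / a"
  using p2 by (simp add: T_def T_p_def K_p1_eq K_def a_def)

private lemma T_pos: "T > 0"
  using K_pos a_pos by (simp add: T_eq)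

private lemma scaled_less_K: "ereal \<bar>a * x\<bar> < K_p1 p \<longleftrightarrow> \<bar>x\<bar> < T"
  using a_pos p2 by (simp add: K_p1_eq K_def[symmetric] T_eq abs_mult field_simps)

private lemma sech_outside: "\<bar>x\<bar> \<ge> T \<Longrightarrow> sech_p p (a * x) = 0"
  unfolding sech_p_def using scaled_less_K[of x] by auto

private lemma sech_inside: "\<bar>x\<bar> < T \<Longrightarrow> sech_p p (a * x) = cn_p p (a * x) 1"
  unfolding sech_p_def using scaled_less_K[of x] by auto

private lemma cn_pos: "\<bar>x\<bar> < T \<Longrightarrow> cn_p p (a * x) 1 > 0"
  using cn_p_1_pos[OF p1] scaled_less_K by blast

private lemma cn_boundary: "\<bar>x\<bar> = T \<Longrightarrow> cn_p p (a * x) 1 = 0"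
proof -
  assume "\<bar>x\<bar> = T"
  then have "a * x = F1 p (pi / 2) 1 \<or> a * x = F1 p (- pi / 2) 1"
    using a_pos by (auto simp: T_eq K_def abs_if F1_minus field_simps split: if_splits)
  moreover have "am1 p (F1 p t 1) 1 = t" for t
    using p2 by (intro am1_F1[OF p1]) (auto simp: F_dom_def)
  ultimately show ?thesis
    by (auto simp: cn_p_def)
qed

text \<open>The profile is even, and on half a core it is injective: the cosine is injective on
  {0..pi} and the amplitude is odd and strictly increasing.\<close>

private lemma cn_eq_imp:
  assumes "\<bar>x\<bar> < T" "\<bar>y\<bar> < T" "cn_p p (a * x) 1 = cn_p p (a * y) 1"
  shows "x = y \<or> x = - y"
proof -
  have *: "\<bar>am1 p (a * z) 1\<bar> < pi / 2" if "\<bar>z\<bar> < T" for z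
    using abs_am1_less_K[OF p1] scaled_less_K that by blast
  have "cos (am1 p (a * x) 1) = cos (am1 p (a * y) 1)"
  proof -
    have "(p / 2 - 1) * (2 / p - 1 + 1) + (2 / p - 1) = 0"
      using p1 by (simp add: field_simps)
    then have "sgn_pow (p / 2 - 1) (sgn_pow (2 / p - 1) z) = z" for z
      by (simp only: sgn_pow_sgn_pow sgn_pow_zero_exp)
    then show ?thesis
      using assms(3) unfolding cn_p_def by metis
  qed
  then have "cos \<bar>am1 p (a * x) 1\<bar> = cos \<bar>am1 p (a * y) 1\<bar>"
    by simp
  then have "\<bar>am1 p (a * x) 1\<bar> = \<bar>am1 p (a * y) 1\<bar>"
    using *[OF assms(1)] *[OF assms(2)] pi_gt_zero
    by (intro cos_inj_pi[OF abs_ge_zero _ abs_ge_zero]) linarith+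
  then have "am1 p (a * x) 1 = am1 p (a * y) 1 \<or> am1 p (a * x) 1 = am1 p (a * (- y)) 1"
    using am1_minus[OF p1, of 1 "a * y"] by (auto simp: abs_if split: if_splits)
  then have "a * x = a * y \<or> a * x = a * (- y)"
    unfolding strict_mono_eq[OF strict_mono_am1[OF p1 zero_less_one order_refl]] .
  then show ?thesis
    unfolding mult_cancel_left using a_pos by auto
qed

text \<open>This is W for a core centred at c, but not truncated: it solves the equation on the
  whole line and represents the core only where |s - c| \<le> T. The argument has the shape \<alpha>
  * s + \<beta> required by \<open>cn_solution\<close>.\<close>

definition core_profile :: "real \<Rightarrow> real \<Rightarrow> real \<Rightarrow> real" where
  "core_profile \<sigma> c s = sgn_pow (p - 2) (\<sigma> * (2 * a) * cn_p p (a * s + (- a * c)) 1)"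

definition core_velocity :: "real \<Rightarrow> real \<Rightarrow> real \<Rightarrow> real" where
  "core_velocity \<sigma> c s = cn_curve' p (\<sigma> * (2 * a)) a 1 (am1 p (a * s + (- a * c)) 1)"

private lemma core_arg: "a * s + (- a * c) = a * (s - c)"
  by (simp add: algebra_simps)

private lemma core_params:
  assumes "\<sigma> \<in> {- 1, 1 :: real}"
  shows "cn_params p lam (\<sigma> * (2 * a)) a 1" "cn_energy p (\<sigma> * (2 * a)) a 1 = 0"
  using sech_params(1,2)[OF p1 lam0, of "\<sigma> * (2 * a)"] assms a_pos by (auto simp: a_def abs_mult)

lemma core_solution:
  assumes "\<sigma> \<in> {- 1, 1 :: real}"
  shows "(core_profile \<sigma> c has_real_derivative core_velocity \<sigma> c s) (at s)"
    and "(core_velocity \<sigma> c has_real_derivative ode_rhs p lam (core_profile \<sigma> c s)) (at s)"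
  using cn_solution[OF p1 core_params(1)[OF assms], of "- a * c" s]
  unfolding core_profile_def[abs_def] core_velocity_def[abs_def] by auto

lemma core_energy:
  assumes "\<sigma> \<in> {- 1, 1 :: real}"
  shows "energy p lam (core_profile \<sigma> c s) (core_velocity \<sigma> c s) = 0"
  using energy_cn_curve[OF p1 core_params(1)[OF assms]] core_params(2)[OF assms]
  unfolding core_profile_def core_velocity_def cn_curve_am1[OF p1, symmetric] by simp

lemma core_profile_nonzero: "\<sigma> \<in> {- 1, 1 :: real} \<Longrightarrow> \<bar>s - c\<bar> < T \<Longrightarrow> core_profile \<sigma> c s \<noteq> 0"
  using cn_pos[of "s - c"] a_pos unfolding core_profile_def core_arg by auto

lemma core_profile_boundary: "\<bar>s - c\<bar> = T \<Longrightarrow> core_profile \<sigma> c s = 0"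
  using cn_boundary[of "s - c"] unfolding core_profile_def core_arg by auto

lemma core_profile_inverse:
  "\<bar>s - c\<bar> < T \<Longrightarrow> sgn_pow ((2 - p) / (p - 1)) (core_profile \<sigma> c s) = \<sigma> * (2 * a) * sech_p p (a * (s - c))"
  unfolding core_profile_def core_arg by (simp add: sgn_pow_inverse[OF p1] sech_inside)

text \<open>A nonzero state of zero energy lies on the sech curve with the sign of W s0. Matching
  gives a phase \<beta>, hence a centre, and uniqueness spreads the agreement over the core.\<close>

lemma core_through:
  assumes sol: "ode_solution p lam {0..L} W W1" and s0: "s0 \<in> {0..L}" "W s0 \<noteq> 0"
    and E: "energy p lam (W s0) (W1 s0) = 0"
  obtains c \<sigma> where "\<sigma> \<in> {- 1, 1}" "\<bar>s0 - c\<bar> < T"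
    "\<And>s. s \<in> {0..L} \<Longrightarrow> \<bar>s - c\<bar> \<le> T \<Longrightarrow> W s = core_profile \<sigma> c s"
proof -
  define \<sigma> where "\<sigma> = sgn (W s0)"
  have \<sigma>: "\<sigma> \<in> {- 1, 1}"
    using s0 by (auto simp: \<sigma>_def sgn_if)
  have "W s0 * (\<sigma> * (2 * a)) > 0"
    using s0 a_pos by (auto simp: \<sigma>_def sgn_if)
  then obtain \<beta> where \<beta>: "\<sigma> * (2 * a) * cn_p p \<beta> 1 = sgn_pow ((2 - p) / (p - 1)) (W s0)"
    "cn_curve' p (\<sigma> * (2 * a)) a 1 (am1 p \<beta> 1) = W1 s0" "\<bar>am1 p \<beta> 1\<bar> \<le> pi"
    using cn_match[OF p1 core_params(1)[OF \<sigma>], of "W s0" "W1 s0"] E core_params(2)[OF \<sigma>] by auto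
  define c where "c = s0 - \<beta> / a"
  have c: "a * s0 + (- a * c) = \<beta>"
    using a_pos by (simp add: c_def field_simps)
  have "sgn (cos (am1 p \<beta> 1)) = 1"
  proof -
    have "sgn (\<sigma> * (2 * a) * cn_p p \<beta> 1) = sgn (W s0)"
      using \<beta>(1) by simp
    then show ?thesis
      using s0 a_pos by (auto simp: sgn_mult cn_p_def \<sigma>_def sgn_eq_0_iff)
  qed
  then have "cos (am1 p \<beta> 1) > 0"
    by (simp add: sgn_1_pos)
  \<comment> \<open>A positive cosine alone would allow angles shifted by full turns; the bound by
    pi excludes them, so s0 lies in the core centred at c.\<close>
  then have "\<bar>am1 p \<beta> 1\<bar> < pi / 2"
    using \<beta>(3) cos_monotone_0_pi_le[of "pi / 2" "\<bar>am1 p \<beta> 1\<bar>"] by force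
  then have "\<bar>\<beta>\<bar> < K"
    using abs_am1_less_pi_half_iff[OF p2] by (simp add: K_def)
  then have near: "\<bar>s0 - c\<bar> < T"
    using a_pos by (simp add: c_def T_eq divide_strict_right_mono)
  \<comment> \<open>The open core: at distance T from the centre the state is (0, 0) and uniqueness
    breaks down. The ends are added afterwards by continuity.\<close>
  define S where "S = {0..L} \<inter> {c - T<..<c + T}"
  have S: "is_interval S" "s0 \<in> S"
    using s0 near by (auto simp: S_def is_interval_Int abs_less_iff)
  have eqS: "W s = core_profile \<sigma> c s" if "s \<in> S" for s
  proof -
    have "W s = core_profile \<sigma> c s \<and> W1 s = core_velocity \<sigma> c s"
    proof (rule ode_uniqueness[OF p1 S, where y = W and ?y1.0 = W1
          and z = "core_profile \<sigma> c" and ?z1.0 = "core_velocity \<sigma> c"])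
      show "ode_solution p lam S W W1"
        by (rule ode_solution_subset[OF sol]) (auto simp: S_def)
      show "ode_solution p lam S (core_profile \<sigma> c) (core_velocity \<sigma> c)"
        using core_solution[OF \<sigma>] by (simp add: ode_solution_def has_field_derivative_at_within)
      show "W s0 = core_profile \<sigma> c s0"
        unfolding core_profile_def c \<beta>(1) by (simp add: sgn_pow_inverse[OF p1])
      show "W1 s0 = core_velocity \<sigma> c s0"
        unfolding core_velocity_def c \<beta>(2) ..
      show "p \<le> 2 \<or> core_profile \<sigma> c s \<noteq> 0 \<or> core_velocity \<sigma> c s \<noteq> 0" if "s \<in> S" for s
        using core_profile_nonzero[OF \<sigma>, of s c] that by (auto simp: S_def abs_less_iff)
    qed fact
    then show ?thesis
      by simp
  qed
  show ?thesis
  proof (rule that[OF \<sigma> near])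
    fix s assume s: "s \<in> {0..L}" "\<bar>s - c\<bar> \<le> T"
    have "s \<in> closure S"
    proof (cases "s0 \<le> s")
      case True
      have "s \<in> closure {s0..<s} \<or> s = s0"
        using True closure_atLeastLessThan[of s0 s] by (cases "s0 = s") auto
      moreover have "{s0..<s} \<subseteq> S"
        using s s0 near by (auto simp: S_def abs_less_iff)
      ultimately show ?thesis
        using closure_mono[of "{s0..<s}" S] S(2) closure_subset[of S] by auto
    next
      case False
      have "s \<in> closure {s<..s0}"
        using False by simp
      moreover have "{s<..s0} \<subseteq> S"
        using s s0 near by (auto simp: S_def abs_less_iff)
      ultimately show ?thesis
        using closure_mono[of "{s<..s0}" S] by auto
    qed
    moreover have "closure S \<subseteq> {0..L}"
      by (rule closure_minimal) (auto simp: S_def)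
    then have "continuous_on (closure S) (\<lambda>s. W s - core_profile \<sigma> c s)"
      using ode_solution_continuous(1)[OF sol] DERIV_isCont[OF core_solution(1)[OF \<sigma>]]
      by (intro continuous_intros) (auto intro: continuous_on_subset continuous_at_imp_continuous_on)
    ultimately have "W s - core_profile \<sigma> c s = 0"
      using continuous_constant_on_closure[of S "\<lambda>s. W s - core_profile \<sigma> c s" 0 s] eqS by auto
    then show "W s = core_profile \<sigma> c s"
      by simp
  qed
qed

text \<open>Two distinct cores cannot overlap: an end point of one core inside the other would be a zero of
  the solution, unless both cores cover the whole interval, where they would have to coincide.\<close>

lemma cores_separated:
  assumes L: "L > 0" and \<sigma>: "\<sigma> \<in> {- 1, 1 :: real}" "\<sigma>' \<in> {- 1, 1 :: real}"
    and c: "- T < c" "c' < L + T" "c < c'"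
    and W: "\<And>s. s \<in> {0..L} \<Longrightarrow> \<bar>s - c\<bar> \<le> T \<Longrightarrow> W s = core_profile \<sigma> c s"
      "\<And>s. s \<in> {0..L} \<Longrightarrow> \<bar>s - c'\<bar> \<le> T \<Longrightarrow> W s = core_profile \<sigma>' c' s"
  shows "c + 2 * T \<le> c'"
proof (rule ccontr)
  assume less: "\<not> ?thesis"
  consider "0 \<le> c' - T" | "c + T \<le> L" | "c' - T < 0" "L < c + T"
    by linarith
  then show False
  proof cases
    case 1
    then have s: "c' - T \<in> {0..L}" "\<bar>c' - T - c\<bar> < T" "\<bar>c' - T - c'\<bar> = T"
      using c less T_pos by (auto simp: abs_less_iff)
    then show False
      using W(1)[of "c' - T"] W(2)[of "c' - T"] core_profile_nonzero[OF \<sigma>(1) s(2)]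
        core_profile_boundary[OF s(3), of \<sigma>'] by simp
  next
    case 2
    then have s: "c + T \<in> {0..L}" "\<bar>c + T - c'\<bar> < T" "\<bar>c + T - c\<bar> = T"
      using c less T_pos by (auto simp: abs_less_iff)
    then show False
      using W(1)[of "c + T"] W(2)[of "c + T"] core_profile_nonzero[OF \<sigma>(2) s(2)]
        core_profile_boundary[OF s(3), of \<sigma>] by simp
  next
    case 3
    \<comment> \<open>Both open cores contain all of {0..L}. Two equal even profiles with different
      centres force s to be the midpoint of the centres, which cannot hold for every s in the
      interval.\<close>
    have "2 * s = c + c'" if s: "s \<in> {0..L}" for s
    proof -
      have near: "\<bar>s - c\<bar> < T" "\<bar>s - c'\<bar> < T"
        using s c 3 by (auto simp: abs_less_iff)
      have "core_profile \<sigma> c s = core_profile \<sigma>' c' s"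
        using W[OF s] near by simp
      then have eq: "\<sigma> * (2 * a) * cn_p p (a * (s - c)) 1 = \<sigma>' * (2 * a) * cn_p p (a * (s - c')) 1"
        unfolding core_profile_def core_arg by (metis sgn_pow_inverse(1)[OF p1])
      have pos: "cn_p p (a * (s - c)) 1 > 0" "cn_p p (a * (s - c')) 1 > 0"
        using near by (auto intro: cn_pos)
      have "cn_p p (a * (s - c)) 1 = cn_p p (a * (s - c')) 1"
        using eq \<sigma> a_pos pos by auto
      then have "s - c = s - c' \<or> s - c = - (s - c')"
        by (rule cn_eq_imp[OF near])
      then show ?thesis
        using c by auto
    qed
    from this[of 0] this[of L] show False
      using L by simp
  qed
qed

text \<open>Every point with W nonzero lies in a core by \<open>core_through\<close>, distinct cores
  are separated, and between them W is 0 as the truncated sum is. Finiteness and ordering of the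
  centres yield the indexed sum.\<close>

lemma core_decomposition:
  assumes L: "L > 0" and sol: "ode_solution p lam {0..L} W W1"
    and E: "\<And>s. s \<in> {0..L} \<Longrightarrow> energy p lam (W s) (W1 s) = 0"
    and nz: "\<exists>s\<in>{0..L}. W s \<noteq> 0"
    and u: "\<And>s. s \<in> {0..L} \<Longrightarrow> u s = sgn_pow ((2 - p) / (p - 1)) (W s)"
  shows "flat_core_type p L u"
proof -
  \<comment> \<open>All admissible centres at once, including those outside {0..L} whose cores are
    cut off by the ends of the interval.\<close>
  define C where "C = {c \<in> {- T<..<L + T}. \<exists>\<sigma>\<in>{- 1, 1}. \<forall>s\<in>{0..L}. \<bar>s - c\<bar> \<le> T \<longrightarrow> W s = core_profile \<sigma> c s}"
  have "\<exists>\<sigma>. \<forall>c\<in>C. \<sigma> c \<in> {- 1, 1} \<and> (\<forall>s\<in>{0..L}. \<bar>s - c\<bar> \<le> T \<longrightarrow> W s = core_profile (\<sigma> c) c s)"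
    unfolding C_def by (intro bchoice) blast
  then obtain \<sigma> where \<sigma>: "\<And>c. c \<in> C \<Longrightarrow> \<sigma> c \<in> {- 1, 1}"
    "\<And>c s. c \<in> C \<Longrightarrow> s \<in> {0..L} \<Longrightarrow> \<bar>s - c\<bar> \<le> T \<Longrightarrow> W s = core_profile (\<sigma> c) c s"
    by blast
  have bounds: "- T < c" "c < L + T" if "c \<in> C" for c
    using that by (auto simp: C_def)
  have sep: "c + 2 * T \<le> c'" if "c \<in> C" "c' \<in> C" "c < c'" for c c'
    using cores_separated[OF L \<sigma>(1)[OF that(1)] \<sigma>(1)[OF that(2)] bounds(1)[OF that(1)]
        bounds(2)[OF that(2)] that(3) \<sigma>(2)[OF that(1)] \<sigma>(2)[OF that(2)]] .
  have core: "\<exists>c\<in>C. \<bar>s - c\<bar> < T" if s: "s \<in> {0..L}" "W s \<noteq> 0" for s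
  proof -
    obtain c \<sigma> where "\<sigma> \<in> {- 1, 1}" and near: "\<bar>s - c\<bar> < T"
      and "\<And>s. s \<in> {0..L} \<Longrightarrow> \<bar>s - c\<bar> \<le> T \<Longrightarrow> W s = core_profile \<sigma> c s"
      by (rule core_through[OF sol s E[OF s(1)]]) (rule that)
    moreover have "c \<in> {- T<..<L + T}"
      using near s by (auto simp: abs_less_iff)
    ultimately have "c \<in> C"
      unfolding C_def by blast
    then show ?thesis
      using near by blast
  qed
  \<comment> \<open>Centres differ by at least 2T, so the integer parts of c/(2T) are distinct; they
    are bounded because the centres are.\<close>
  have fin: "finite C"
  proof (rule finite_imageD)
    have "(\<lambda>c. \<lfloor>c / (2 * T)\<rfloor>) ` C \<subseteq> {\<lfloor>- T / (2 * T)\<rfloor>..\<lfloor>(L + T) / (2 * T)\<rfloor>}"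
    proof (rule image_subsetI)
      fix c assume "c \<in> C"
      then have "- T / (2 * T) \<le> c / (2 * T)" "c / (2 * T) \<le> (L + T) / (2 * T)"
        using bounds[of c] T_pos by (intro divide_right_mono; simp)+
      from floor_mono[OF this(1)] floor_mono[OF this(2)]
      show "\<lfloor>c / (2 * T)\<rfloor> \<in> {\<lfloor>- T / (2 * T)\<rfloor>..\<lfloor>(L + T) / (2 * T)\<rfloor>}"
        unfolding atLeastAtMost_iff by (rule conjI)
    qed
    then show "finite ((\<lambda>c. \<lfloor>c / (2 * T)\<rfloor>) ` C)"
      by (rule finite_subset) simp
    have less: "\<lfloor>c / (2 * T)\<rfloor> < \<lfloor>c' / (2 * T)\<rfloor>" if "c \<in> C" "c' \<in> C" "c < c'" for c c'
    proof -
      have "(c + 2 * T) / (2 * T) \<le> c' / (2 * T)"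
        using sep[OF that] T_pos by (intro divide_right_mono) auto
      then have "c / (2 * T) + 1 \<le> c' / (2 * T)"
        using T_pos by (simp add: add_divide_distrib)
      then show ?thesis
        by linarith
    qed
    show "inj_on (\<lambda>c. \<lfloor>c / (2 * T)\<rfloor>) C"
      using less by (intro inj_onI) (metis less_irrefl linorder_neqE_linordered_idom)
  qed
  define xs where "xs = sorted_list_of_set C"
  have xs: "set xs = C" "sorted_wrt (<) xs" "distinct xs"
    using fin by (simp_all add: xs_def)
  define N where "N = length xs"
  \<comment> \<open>\<open>flat_core_type\<close> counts the cores from 1, lists from 0.\<close>
  define c where "c i = xs ! (i - 1)" for i
  have cC: "c i \<in> C" if "i \<in> {1..N}" for i
    using that xs(1) by (auto simp: c_def N_def intro!: nth_mem)
  have Cc: "\<exists>i\<in>{1..N}. c i = b" if "b \<in> C" for b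
  proof -
    have "b \<in> set xs"
      using that xs(1) by simp
    then obtain j where "j < N" "xs ! j = b"
      unfolding in_set_conv_nth N_def by blast
    then have "c (Suc j) = b" "Suc j \<in> {1..N}"
      by (simp_all add: c_def)
    then show ?thesis
      by blast
  qed
  have c_inj: "c i \<noteq> c j" if "i \<in> {1..N}" "j \<in> {1..N}" "i \<noteq> j" for i j
    unfolding c_def using that nth_eq_iff_index_eq[OF xs(3), of "i - 1" "j - 1"] by (simp add: N_def) linarith
  have "N \<ge> 1"
  proof -
    obtain b where "b \<in> C"
      using nz core by blast
    then show ?thesis
      using Cc[of b] by auto
  qed
  have step: "c i + 2 * T \<le> c (i + 1)" if "i \<in> {1..<N}" for i
  proof (rule sep)
    show "c i < c (i + 1)"
      using sorted_wrt_nth_less[OF xs(2), of "i - 1" i] that by (simp add: c_def N_def)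
  qed (use that in \<open>auto intro!: cC\<close>)
  have formula: "u s = (\<Sum>i=1..N. \<sigma> (c i) * (2 * a) * sech_p p (a * (s - c i)))" if s: "s \<in> {0..L}" for s
  proof (cases "W s = 0")
    case True
    have "\<bar>s - b\<bar> \<ge> T" if "b \<in> C" for b
      using core_profile_nonzero[OF \<sigma>(1)[OF that], of s b] \<sigma>(2)[OF that s] True by force
    then have "(\<Sum>i=1..N. \<sigma> (c i) * (2 * a) * sech_p p (a * (s - c i))) = 0"
      using cC by (intro sum.neutral) (auto simp: sech_outside)
    then show ?thesis
      using u[OF s] True by simp
  next
    case False
    then obtain i where i: "i \<in> {1..N}" "\<bar>s - c i\<bar> < T"
      using core[OF s] Cc by blast
    \<comment> \<open>The other centres are at least 2T from c i, so s is beyond the reach of their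
      cores and a single summand survives.\<close>
    have "\<bar>s - c j\<bar> \<ge> T" if "j \<in> {1..N}" "j \<noteq> i" for j
      using sep[OF cC[OF i(1)] cC[OF that(1)]] sep[OF cC[OF that(1)] cC[OF i(1)]] c_inj[OF i(1) that(1)] that i
      by (cases "c i < c j") auto
    then have "(\<Sum>j=1..N. \<sigma> (c j) * (2 * a) * sech_p p (a * (s - c j)))
        = (\<Sum>j=1..N. if j = i then \<sigma> (c i) * (2 * a) * sech_p p (a * (s - c i)) else 0)"
      by (intro sum.cong) (auto simp: sech_outside)
    also have "\<dots> = \<sigma> (c i) * (2 * a) * sech_p p (a * (s - c i))"
      using i(1) by simp
    also have "\<dots> = u s"
      using \<sigma>(2)[OF cC[OF i(1)] s] i(2) u[OF s] core_profile_inverse[OF i(2), of "\<sigma> (c i)"] by simp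
    finally show ?thesis ..
  qed
  show ?thesis
    unfolding flat_core_type_def
  proof (intro conjI p2, rule exI[of _ lam], intro conjI lam0, rule exI[of _ N], intro conjI \<open>N \<ge> 1\<close>,
      rule exI[of _ "\<lambda>i. \<sigma> (c i)"], rule exI[of _ c], intro conjI ballI)
    show "u s = (\<Sum>i = 1..N. \<sigma> (c i) * (2 * A_p p lam) * sech_p p (A_p p lam * (s - c i)))"
      if "s \<in> {0..L}" for s
      using formula[OF that] unfolding a_def .
    show "\<sigma> (c i) \<in> {- 1, 1}" if "i \<in> {1..N}" for i
      using \<sigma>(1)[OF cC[OF that]] .
    show "c i \<in> {- T_p p lam<..<L + T_p p lam}" if "i \<in> {1..N}" for i
      using bounds[OF cC[OF that]] by (simp add: T_def)
    show "c i + 2 * T_p p lam \<le> c (i + 1)" if "i \<in> {1..<N}" for i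
      using step[OF that] by (simp add: T_def)
  qed
qed

text \<open>The first core meets the interior of {0..L} since its centre is less than T outside, and
  all later centres are at least 2T further right. So on an open interval the sum has one term and
  the solution can be compared with a smooth profile.\<close>

lemma first_core:
  assumes L: "L > 0" and N: "N \<ge> (1::nat)"
    and \<sigma>: "\<forall>i\<in>{1..N}. \<sigma> i \<in> {- 1, 1} \<and> c i \<in> {- T<..<L + T}"
    and c: "\<forall>i\<in>{1..<N}. c (i + 1) \<ge> c i + 2 * T"
    and u: "\<forall>s\<in>{0..L}. u s = (\<Sum>i=1..N. \<sigma> i * (2 * a) * sech_p p (a * (s - c i)))"
  obtains J where "open J" "J \<noteq> {}" "J \<subseteq> {0..L}" "\<sigma> 1 \<in> {- 1, 1}"
    "\<And>s. s \<in> J \<Longrightarrow> sgn_pow (p - 2) (u s) = core_profile (\<sigma> 1) (c 1) s"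
    "\<And>s. s \<in> J \<Longrightarrow> core_profile (\<sigma> 1) (c 1) s \<noteq> 0"
proof -
  define J where "J = {max 0 (c 1 - T)<..<min L (c 1 + T)}"
  have 1: "\<sigma> 1 \<in> {- 1, 1}" "- T < c 1" "c 1 < L + T"
    using \<sigma> N by auto
  have far: "c 1 + 2 * T \<le> c i" if "2 \<le> i" "i \<le> N" for i
    using that
  proof (induction i rule: dec_induct)
    case base
    then show ?case
      using c[rule_format, of 1] by (simp add: numeral_2_eq_2)
  next
    case (step n)
    then show ?case
      using c[rule_format, of n] T_pos by simp
  qed
  have J: "\<bar>s - c 1\<bar> < T" "s \<in> {0..L}" if "s \<in> J" for s
    using that by (auto simp: J_def abs_less_iff)
  have eq: "sgn_pow (p - 2) (u s) = core_profile (\<sigma> 1) (c 1) s" if s: "s \<in> J" for s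
  proof -
    have "u s = (\<Sum>i=1..N. \<sigma> i * (2 * a) * sech_p p (a * (s - c i)))"
      using u J[OF s] by blast
    also have "\<dots> = (\<Sum>i=1..N. if i = 1 then \<sigma> 1 * (2 * a) * sech_p p (a * (s - c 1)) else 0)"
    proof (rule sum.cong[OF refl])
      fix i assume i: "i \<in> {1..N}"
      show "\<sigma> i * (2 * a) * sech_p p (a * (s - c i))
          = (if i = 1 then \<sigma> 1 * (2 * a) * sech_p p (a * (s - c 1)) else 0)"
      proof (cases "i = 1")
        case False
        then have "\<bar>s - c i\<bar> \<ge> T"
          using far[of i] i J[OF s] by auto
        then show ?thesis
          using False by (simp add: sech_outside)
      qed simp
    qed
    also have "\<dots> = \<sigma> 1 * (2 * a) * sech_p p (a * (s - c 1))"
      using N by simp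
    finally have "u s = sgn_pow ((2 - p) / (p - 1)) (core_profile (\<sigma> 1) (c 1) s)"
      using core_profile_inverse[OF J(1)[OF s]] by simp
    then show ?thesis
      by (simp add: sgn_pow_inverse[OF p1])
  qed
  show ?thesis
  proof (rule that[of J])
    show "open J" "J \<subseteq> {0..L}"
      using J by (auto simp: J_def)
    show "J \<noteq> {}"
      using 1 L T_pos by (auto simp: J_def)
    show "core_profile (\<sigma> 1) (c 1) s \<noteq> 0" if "s \<in> J" for s
      using core_profile_nonzero[OF 1(1) J(1)[OF that]] .
  qed (use eq 1 in auto)
qed

end

text \<open>On an open set the derivatives of W are those of y. Comparing second derivatives turns
  an explicit formula into information on lam.\<close>

lemma ode_solution_eq_on_open:
  assumes sol: "ode_solution p lam S W W1" and J: "open J" "J \<subseteq> S" "s \<in> J"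
    and eq: "\<And>s. s \<in> J \<Longrightarrow> W s = y s"
    and y: "\<And>s. (y has_real_derivative y1 s) (at s)" "\<And>s. (y1 has_real_derivative y2 s) (at s)"
  shows "W1 s = y1 s \<and> ode_rhs p lam (W s) = y2 s"
proof -
  have at: "(W has_real_derivative W1 t) (at t)" "(W1 has_real_derivative ode_rhs p lam (W t)) (at t)"
    if "t \<in> J" for t
  proof -
    have "(W has_real_derivative W1 t) (at t within J)" "(W1 has_real_derivative ode_rhs p lam (W t)) (at t within J)"
      using sol J(2) that unfolding ode_solution_def by (blast intro: DERIV_subset)+
    then show "(W has_real_derivative W1 t) (at t)" "(W1 has_real_derivative ode_rhs p lam (W t)) (at t)"
      using at_within_open[OF that J(1)] by simp_all
  qed
  have 1: "W1 t = y1 t" if "t \<in> J" for t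
  proof -
    have "(y has_real_derivative W1 t) (at t)"
      by (rule has_field_derivative_transform_within_open[OF at(1)[OF that] J(1) that eq])
    then show ?thesis
      using y(1) DERIV_unique by blast
  qed
  have "(y1 has_real_derivative ode_rhs p lam (W s)) (at s)"
    by (rule has_field_derivative_transform_within_open[OF at(2)[OF J(3)] J(1) J(3) 1])
  then show ?thesis
    using y(2) DERIV_unique 1[OF J(3)] by blast
qed

text \<open>One point of one core suffices: there the profile has energy 0 for its own multiplier,
  and energy is conserved on the whole interval.\<close>

lemma flat_core_energy:
  assumes L: "L > 0" and sol: "ode_solution p lam {0..L} W W1" and flat: "flat_core_type p L u"
    and u: "\<And>s. s \<in> {0..L} \<Longrightarrow> W s = sgn_pow (p - 2) (u s)" and s: "s \<in> {0..L}"
  shows "energy p lam (W s) (W1 s) = 0" "\<exists>s\<in>{0..L}. W s \<noteq> 0"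
proof -
  obtain lam' N \<sigma> c where p2: "p > 2" and lam': "lam' > 0" and N: "N \<ge> (1::nat)"
    and \<sigma>: "\<forall>i\<in>{1..N}. \<sigma> i \<in> {- 1, 1} \<and> c i \<in> {- T_p p lam'<..<L + T_p p lam'}"
    and c: "\<forall>i\<in>{1..<N}. c (i + 1) \<ge> c i + 2 * T_p p lam'"
    and eq: "\<forall>s\<in>{0..L}. u s = (\<Sum>i=1..N. \<sigma> i * (2 * A_p p lam') * sech_p p (A_p p lam' * (s - c i)))"
    using flat unfolding flat_core_type_def by blast
  have p: "p > 1"
    using p2 by simp
  obtain J where J: "open J" "J \<noteq> {}" "J \<subseteq> {0..L}" and \<sigma>1: "\<sigma> 1 \<in> {- 1, 1}"
    and core: "\<And>s. s \<in> J \<Longrightarrow> sgn_pow (p - 2) (u s) = core_profile p lam' (\<sigma> 1) (c 1) s"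
    "\<And>s. s \<in> J \<Longrightarrow> core_profile p lam' (\<sigma> 1) (c 1) s \<noteq> 0"
    using first_core[OF p2 lam' L N \<sigma> c eq] by metis
  obtain t where t: "t \<in> J"
    using J(2) by blast
  have W: "W s = core_profile p lam' (\<sigma> 1) (c 1) s" if "s \<in> J" for s
    using core(1)[OF that] u J(3) that by auto
  have *: "W1 t = core_velocity p lam' (\<sigma> 1) (c 1) t"
    "ode_rhs p lam (W t) = ode_rhs p lam' (W t)"
    using ode_solution_eq_on_open[OF sol J(1,3) t W core_solution[OF p2 lam' \<sigma>1]] W[OF t] by auto
  have Wt: "W t \<noteq> 0"
    using core(2)[OF t] W[OF t] by simp
  then show "\<exists>s\<in>{0..L}. W s \<noteq> 0"
    using J(3) t by blast
  \<comment> \<open>The two right-hand sides agree at a nonzero W t and differ only in the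
    coefficient of the lower power.\<close>
  have "lam = lam'"
    using *(2) Wt p by (simp add: ode_rhs_def)
  then have "energy p lam (W t) (W1 t) = 0"
    using core_energy[OF p2 lam' \<sigma>1] W[OF t] *(1) by simp
  then show "energy p lam (W s) (W1 s) = 0"
    using energy_const[OF p sol is_interval_cc s] J(3) t by fastforce
qed

subsection \<open>Classification\<close>

text \<open>Completing the square in z = (p - 1) |x|^(p/(p-1)), which ranges over all nonnegative
  numbers. The minimum is thus at z = lam for lam > 0 and at z = 0 otherwise.\<close>

lemma F_pot_eq:
  assumes "p > 1"
  shows "F_pot p lam x = ((p - 1) * \<bar>x\<bar> powr (p / (p - 1)) - lam)\<^sup>2 - lam\<^sup>2"
proof -
  have "2 * p / (p - 1) = p / (p - 1) + p / (p - 1)"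
    by simp
  then have "\<bar>x\<bar> powr (2 * p / (p - 1)) = (\<bar>x\<bar> powr (p / (p - 1)))\<^sup>2"
    by (simp only: powr_add power2_eq_square)
  then show ?thesis
    by (simp add: F_pot_def power2_eq_square algebra_simps)
qed

lemma min_F_eq:
  assumes p: "p > 1"
  shows "min_F p lam = (if lam > 0 then - lam\<^sup>2 else 0)"
  unfolding min_F_def
proof (rule Least_equality)
  show "(if lam > 0 then - lam\<^sup>2 else 0) \<in> range (F_pot p lam)"
  proof (cases "lam > 0")
    case True
    \<comment> \<open>This argument is the positive solution of z = lam, where the square
      vanishes.\<close>
    then have "F_pot p lam ((lam / (p - 1)) powr ((p - 1) / p)) = - lam\<^sup>2"
      using p by (simp add: F_pot_eq powr_powr)
    then show ?thesis
      using True by (metis rangeI)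
  next
    case False
    have "F_pot p lam 0 = 0"
      by (simp add: F_pot_def)
    then show ?thesis
      using False by (metis rangeI)
  qed
  fix y assume "y \<in> range (F_pot p lam)"
  then obtain x where y: "y = ((p - 1) * \<bar>x\<bar> powr (p / (p - 1)) - lam)\<^sup>2 - lam\<^sup>2"
    using p by (auto simp: F_pot_eq)
  show "(if lam > 0 then - lam\<^sup>2 else 0) \<le> y"
  proof (cases "lam > 0")
    case False
    have "(- lam)\<^sup>2 \<le> ((p - 1) * \<bar>x\<bar> powr (p / (p - 1)) - lam)\<^sup>2"
      using False p by (intro power_mono) auto
    then show ?thesis
      using False by (simp add: y)
  qed (simp add: y)
qed

lemma energy_eq:
  assumes "p > 1"
  shows "energy p lam y v = p\<^sup>2 * v\<^sup>2 + ((p - 1) * \<bar>y\<bar> powr (p / (p - 1)) - lam)\<^sup>2 - lam\<^sup>2"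
  using assms by (simp add: energy_def F_pot_eq)

lemma energy_neg_imp:
  assumes p: "p > 1" and E: "energy p lam y v < 0"
  shows "lam > 0" "y \<noteq> 0"
proof -
  have "min_F p lam \<le> energy p lam y v"
  proof -
    have "0 \<le> p\<^sup>2 * v\<^sup>2"
      by simp
    moreover have "- lam\<^sup>2 \<le> F_pot p lam y"
      using p by (simp add: F_pot_eq)
    moreover have "0 \<le> F_pot p lam y" if "\<not> lam > 0"
      using power_mono[of "- lam" "(p - 1) * \<bar>y\<bar> powr (p / (p - 1)) - lam" 2] that p by (simp add: F_pot_eq)
    ultimately show ?thesis
      using p unfolding energy_def min_F_eq[OF p] by (auto intro: order_trans)
  qed
  then show "lam > 0"
    using E by (auto simp: min_F_eq[OF p] split: if_splits)
  show "y \<noteq> 0"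
  proof
    assume "y = 0"
    then have "energy p lam y v = p\<^sup>2 * v\<^sup>2"
      by (simp add: energy_def F_pot_def)
    moreover have "p\<^sup>2 * v\<^sup>2 \<ge> 0"
      by simp
    ultimately show False
      using E by linarith
  qed
qed

lemma energy_ge: "p > 1 \<Longrightarrow> - lam\<^sup>2 \<le> energy p lam y v"
  by (simp add: energy_eq)

text \<open>For lam \<le> 0 the energy is a sum of nonnegative terms, one of which is the square of
  z > 0.\<close>

lemma energy_zero_imp:
  assumes p: "p > 1" and E: "energy p lam y v = 0" and y: "y \<noteq> 0"
  shows "lam > 0"
proof (rule ccontr)
  assume lam: "\<not> lam > 0"
  define z where "z = (p - 1) * \<bar>y\<bar> powr (p / (p - 1))"
  have z: "z > 0"
    using p y by (simp add: z_def)
  have "energy p lam y v = p\<^sup>2 * v\<^sup>2 + z * z + z * (2 * (- lam))"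
    unfolding energy_eq[OF p] z_def[symmetric] by (simp add: power2_eq_square algebra_simps)
  moreover have "p\<^sup>2 * v\<^sup>2 \<ge> 0" "z * z > 0" "z * (2 * (- lam)) \<ge> 0"
    using z lam by (auto simp: mult_nonpos_nonneg)
  ultimately show False
    using E by linarith
qed

lemma energy_0_0: "energy p lam 0 0 = 0"
  by (simp add: energy_def F_pot_def)

lemma ode_solution_zero: "ode_solution p lam S (\<lambda>s. 0) (\<lambda>s. 0)"
  by (simp add: ode_solution_def ode_rhs_def)

lemma real_derivative_unique_within:
  assumes "(f has_real_derivative a) (at 0 within {0..L})" "(f has_real_derivative b) (at 0 within {0..L})" "L > 0"
  shows "a = b"
proof (rule vector_derivative_unique_within)
  have "at 0 within {0..L} = at_right 0"
    using assms(3) by (rule at_within_Icc_at_right)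
  then show "at 0 within {0..L} \<noteq> bot"
    using trivial_limit_at_right_real by simp
qed (use assms in \<open>simp_all add: has_real_derivative_iff_has_vector_derivative\<close>)

section \<open>The six cases for one classical solution W, with u the corresponding continuous
  curvature\<close>

locale cauchy_solution =
  fixes p L lam w0 w1 :: real and W W1 u :: "real \<Rightarrow> real"
  assumes p: "p > 1" and L: "L > 0" and sol: "ode_solution p lam {0..L} W W1"
    and W0: "W 0 = w0" and W10: "W1 0 = w1" and u: "\<And>s. u s = sgn_pow ((2 - p) / (p - 1)) (W s)"
begin

lemma W_eq: "W s = sgn_pow (p - 2) (u s)"
  by (simp add: u sgn_pow_inverse[OF p])

lemma u_eq_0_iff: "u s = 0 \<longleftrightarrow> W s = 0"
  by (simp add: u)

lemma D0_eq: "s \<in> {0..L} \<Longrightarrow> D0 p lam w0 w1 = energy p lam (W s) (W1 s)"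
  using energy_const[OF p sol is_interval_cc, of s 0] L
  by (simp add: D0_def energy_def[of p lam w0 w1, symmetric] W0 W10)

lemma D0_energy: "D0 p lam w0 w1 = energy p lam w0 w1"
  by (simp add: D0_def energy_def)

text \<open>The state (0, 0) has energy 0, so a comparison solution of nonzero energy never reaches
  it and uniqueness applies throughout. For zero energy this is available only when p \<le>
  2.\<close>

lemma agree:
  assumes "ode_solution p lam {0..L} z z1" "z 0 = w0" "z1 0 = w1" "p \<le> 2 \<or> D0 p lam w0 w1 \<noteq> 0" "s \<in> {0..L}"
  shows "W s = z s"
proof -
  have *: "0 \<in> {0..L}"
    using L by simp
  have "p \<le> 2 \<or> z t \<noteq> 0 \<or> z1 t \<noteq> 0" if "t \<in> {0..L}" for t
  proof -
    have "energy p lam (z t) (z1 t) = D0 p lam w0 w1"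
      using energy_const[OF p assms(1) is_interval_cc that *] assms(2,3) by (simp add: D0_energy)
    then show ?thesis
      using assms(4) energy_0_0 by metis
  qed
  from ode_uniqueness[OF p is_interval_cc * sol assms(1) _ _ this assms(5)] show ?thesis
    using assms(2,3) W0 W10 by simp
qed

lemma u_eq:
  assumes z: "\<And>s. ((\<lambda>s. sgn_pow (p - 2) (z s)) has_real_derivative z1 s) (at s)"
      "\<And>s. (z1 has_real_derivative ode_rhs p lam (sgn_pow (p - 2) (z s))) (at s)"
    and init: "z 0 = sgn_pow ((2 - p) / (p - 1)) w0" "z1 0 = w1"
    and reg: "p \<le> 2 \<or> D0 p lam w0 w1 \<noteq> 0" and s: "s \<in> {0..L}"
  shows "u s = z s"
proof -
  have "ode_solution p lam {0..L} (\<lambda>s. sgn_pow (p - 2) (z s)) z1"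
    using z by (simp add: ode_solution_def has_field_derivative_at_within)
  from agree[OF this _ init(2) reg s] have "W s = sgn_pow (p - 2) (z s)"
    by (simp add: init(1) sgn_pow_inverse[OF p])
  then show ?thesis
    by (simp add: u sgn_pow_inverse[OF p])
qed

text \<open>Energy and equation are read off at the midpoint, where the derivatives are two-sided,
  and conservation carries the energy back to the initial values.\<close>

lemma eq_on_interval:
  assumes "\<And>s. s \<in> {0..L} \<Longrightarrow> W s = y s" "\<And>s. (y has_real_derivative y1 s) (at s)"
    "\<And>s. (y1 has_real_derivative y2 s) (at s)"
  shows "D0 p lam w0 w1 = energy p lam (y (L / 2)) (y1 (L / 2)) \<and> ode_rhs p lam (y (L / 2)) = y2 (L / 2)"
proof -
  have s: "L / 2 \<in> {0<..<L}" "L / 2 \<in> {0..L}"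
    using L by auto
  have "W1 (L / 2) = y1 (L / 2) \<and> ode_rhs p lam (W (L / 2)) = y2 (L / 2)"
    by (rule ode_solution_eq_on_open[OF sol _ _ s(1) _ assms(2,3)]) (use assms(1) in auto)
  then show ?thesis
    using D0_eq[OF s(2)] assms(1)[OF s(2)] by simp
qed

lemma D0_zero_if_zero:
  assumes "\<forall>s\<in>{0..L}. u s = 0"
  shows "w0 = 0" "w1 = 0" "D0 p lam w0 w1 = 0"
proof -
  have "D0 p lam w0 w1 = energy p lam 0 0"
    using eq_on_interval[of "\<lambda>s. 0" "\<lambda>s. 0" "\<lambda>s. 0"] assms by (simp add: u_eq_0_iff)
  then show D: "D0 p lam w0 w1 = 0"
    by (simp add: energy_0_0)
  show "w0 = 0"
    using assms W0 L u_eq_0_iff[of 0] by simp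
  then show "w1 = 0"
    using D p by (simp add: D0_def F_pot_def)
qed

lemma case_I_iff: "case_I L u \<longleftrightarrow> cond_i p L w0 w1 u"
proof
  assume "case_I L u"
  then show "cond_i p L w0 w1 u"
    using D0_zero_if_zero by (auto simp: case_I_def cond_i_def)
next
  assume cond: "cond_i p L w0 w1 u"
  show "case_I L u"
  proof (cases "p \<le> 2")
    case True
    then have "w0 = 0" "w1 = 0"
      using cond by (auto simp: cond_i_def)
    then have "W s = 0" if "s \<in> {0..L}" for s
      using agree[OF ode_solution_zero, of s] True that by simp
    then show ?thesis
      by (simp add: case_I_def u_eq_0_iff)
  next
    case False
    then show ?thesis
      using cond by (simp add: cond_i_def case_I_def)
  qed
qed

text \<open>Forward, (w0, w1) is a point of a cn curve, whose energy is positive because q < 1.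
  Backward, D0 determines A, \<alpha> and q, the initial state determines the phase, and uniqueness
  identifies u.\<close>

lemma case_II_iff: "case_II p L lam w0 w1 u \<longleftrightarrow> cond_ii p lam w0 w1"
proof
  assume "case_II p L lam w0 w1 u"
  then obtain A \<beta> \<alpha> q where *: "\<alpha> > 0" "0 < q" "q < 1" "A\<^sup>2 = 4 * \<alpha>\<^sup>2 * q\<^sup>2"
      "lam = 2 * (p - 1) * \<bar>A\<bar> powr (p - 2) * \<alpha>\<^sup>2 * (2 * q\<^sup>2 - 1)"
    and w0: "A * cn_p p \<beta> q = sgn_pow ((2 - p) / (p - 1)) w0"
    and w1: "((\<lambda>s. sgn_pow (p - 2) (A * cn_p p (\<alpha> * s + \<beta>) q)) has_real_derivative w1) (at 0)"
    unfolding case_II_def by blast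
  have par: "cn_params p lam A \<alpha> q"
    unfolding cn_params_def using * by (intro conjI) auto
  have "w1 = cn_curve' p A \<alpha> q (am1 p \<beta> q)"
    using DERIV_unique[OF w1 cn_solution(1)[OF p par]] by simp
  moreover have "w0 = cn_curve p A (am1 p \<beta> q)"
    unfolding cn_curve_am1[OF p] w0 by (simp add: sgn_pow_inverse[OF p])
  ultimately have "D0 p lam w0 w1 = cn_energy p A \<alpha> q"
    using energy_cn_curve[OF p par] unfolding D0_energy by simp
  moreover have "A \<noteq> 0"
    using *(1,2,4) by auto
  moreover have "q\<^sup>2 < 1"
    using * by (simp add: power_less_one_iff)
  ultimately show "cond_ii p lam w0 w1"
    using p * by (simp add: cond_ii_def cn_energy_def)
next
  assume D: "cond_ii p lam w0 w1"
  then obtain A \<alpha> q where par: "cn_params p lam A \<alpha> q" and q: "q < 1" and en: "cn_energy p A \<alpha> q = D0 p lam w0 w1"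
    using cn_params_exist[OF p] unfolding cond_ii_def by metis
  obtain \<beta> where \<beta>: "A * cn_p p \<beta> q = sgn_pow ((2 - p) / (p - 1)) w0"
    "cn_curve' p A \<alpha> q (am1 p \<beta> q) = w1"
    using cn_match[OF p par, of w0 w1] q en unfolding D0_energy by metis
  note cn = cn_solution[OF p par, of \<beta>]
  have "u s = A * cn_p p (\<alpha> * s + \<beta>) q" if "s \<in> {0..L}" for s
    by (rule u_eq[OF cn _ _ _ that]) (use \<beta> D in \<open>auto simp: cond_ii_def\<close>)
  moreover have "((\<lambda>s. sgn_pow (p - 2) (A * cn_p p (\<alpha> * s + \<beta>) q)) has_real_derivative w1) (at 0)"
    using cn(1)[of 0] \<beta>(2) by simp
  ultimately show "case_II p L lam w0 w1 u"
    using par q \<beta>(1) unfolding case_II_def cn_params_def by blast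
qed

lemma case_IV_iff: "case_IV p L lam w0 w1 u \<longleftrightarrow> cond_iv p lam w0 w1"
proof
  assume "case_IV p L lam w0 w1 u"
  then obtain A \<beta> \<alpha> q where *: "\<alpha> > 0" "0 < q" "q < 1" "A\<^sup>2 = 4 * \<alpha>\<^sup>2"
      "lam = 2 * (p - 1) * \<bar>A\<bar> powr (p - 2) * \<alpha>\<^sup>2 * (2 - q\<^sup>2)"
    and w0: "A * dn_p p \<beta> q = sgn_pow ((2 - p) / (p - 1)) w0"
    and w1: "((\<lambda>s. sgn_pow (p - 2) (A * dn_p p (\<alpha> * s + \<beta>) q)) has_real_derivative w1) (at 0)"
    unfolding case_IV_def by blast
  have par: "dn_params p lam A \<alpha> q"
    unfolding dn_params_def using * by (intro conjI) auto
  have "w1 = dn_curve' p A \<alpha> q (am2 p \<beta> q)"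
    using DERIV_unique[OF w1 dn_solution(1)[OF p par]] by simp
  moreover have "w0 = dn_curve p A q (am2 p \<beta> q)"
    unfolding dn_curve_am2 w0 by (simp add: sgn_pow_inverse[OF p])
  ultimately have D: "D0 p lam w0 w1 = - cn_energy p A \<alpha> q"
    using energy_dn_curve[OF p par] unfolding D0_energy by simp
  have "A \<noteq> 0"
    using *(1,4) by auto
  then have P: "\<bar>A\<bar> powr (p - 2) > 0"
    by simp
  have q2: "q\<^sup>2 < 1"
    using * by (simp add: power_less_one_iff)
  then have "cn_energy p A \<alpha> q > 0"
    using p * P \<open>A \<noteq> 0\<close> by (simp add: cn_energy_def)
  moreover from this have "lam > 0"
    using energy_neg_imp(1)[OF p, of lam w0 w1] D by (simp add: D0_energy)
  \<comment> \<open>Under the dn relations this difference is a nonzero square, so D0 lies strictly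
    above - lam^2, the minimum of F.\<close>
  moreover have "lam\<^sup>2 - cn_energy p A \<alpha> q = 4 * (p - 1)\<^sup>2 * (\<bar>A\<bar> powr (p - 2))\<^sup>2 * (\<alpha>\<^sup>2)\<^sup>2 * (q\<^sup>2)\<^sup>2"
    unfolding *(5) cn_energy_def *(4) power_mult_distrib by algebra
  moreover have "4 * (p - 1)\<^sup>2 * (\<bar>A\<bar> powr (p - 2))\<^sup>2 * (\<alpha>\<^sup>2)\<^sup>2 * (q\<^sup>2)\<^sup>2 > 0"
    using p P * by simp
  ultimately have "0 < cn_energy p A \<alpha> q" "lam > 0" "cn_energy p A \<alpha> q < lam\<^sup>2"
    by linarith+
  then show "cond_iv p lam w0 w1"
    unfolding cond_iv_def min_F_eq[OF p] D by simp
next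
  assume D: "cond_iv p lam w0 w1"
  then have neg: "energy p lam w0 w1 < 0"
    by (simp add: cond_iv_def D0_energy)
  have lam: "lam > 0" and w0: "w0 \<noteq> 0"
    using energy_neg_imp[OF p neg] by auto
  have "- lam\<^sup>2 < D0 p lam w0 w1" "D0 p lam w0 w1 < 0"
    using D lam by (auto simp: cond_iv_def min_F_eq[OF p])
  from dn_params_exist[OF p lam this] obtain B \<alpha> q where B: "B > 0"
    "dn_params p lam B \<alpha> q" "dn_params p lam (- B) \<alpha> q"
    "- cn_energy p B \<alpha> q = D0 p lam w0 w1" "- cn_energy p (- B) \<alpha> q = D0 p lam w0 w1"
    by blast
  \<comment> \<open>The dn family does not change sign, so the sign of the amplitude is taken from
    w0.\<close>
  obtain A where par: "dn_params p lam A \<alpha> q" and en: "energy p lam w0 w1 = - cn_energy p A \<alpha> q" and A: "w0 * A > 0"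
  proof (cases "w0 > 0")
    case True
    then show ?thesis
      using B by (intro that[of B]) (simp_all add: D0_energy)
  next
    case False
    then have "w0 * (- B) > 0"
      using w0 B(1) by (intro mult_neg_neg) auto
    then show ?thesis
      using B by (intro that[of "- B"]) (simp_all add: D0_energy)
  qed
  obtain \<beta> where \<beta>: "A * dn_p p \<beta> q = sgn_pow ((2 - p) / (p - 1)) w0"
    "dn_curve' p A \<alpha> q (am2 p \<beta> q) = w1"
    using dn_match[OF p par A en] by blast
  note dn = dn_solution[OF p par, of \<beta>]
  have "u s = A * dn_p p (\<alpha> * s + \<beta>) q" if "s \<in> {0..L}" for s
    by (rule u_eq[OF dn _ _ _ that]) (use \<beta> D in \<open>auto simp: cond_iv_def\<close>)
  moreover have "((\<lambda>s. sgn_pow (p - 2) (A * dn_p p (\<alpha> * s + \<beta>) q)) has_real_derivative w1) (at 0)"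
    using dn(1)[of 0] \<beta>(2) by simp
  ultimately show "case_IV p L lam w0 w1 u"
    using par \<beta>(1) unfolding case_IV_def dn_params_def by blast
qed

lemma case_III_iff: "case_III p L lam w0 u \<longleftrightarrow> cond_iii p lam w0 w1"
proof
  assume "case_III p L lam w0 u"
  then obtain \<beta> where p2: "p \<le> 2" and lam: "lam > 0"
    and u_sech: "\<And>s. s \<in> {0..L} \<Longrightarrow> u s = 2 * sgn w0 * A_p p lam * sech_p p (A_p p lam * s + \<beta>)"
    and w0: "(2 * A_p p lam * sech_p p \<beta>) powr (p - 1) = \<bar>w0\<bar>"
    unfolding case_III_def by blast
  have sech: "sech_p p x = cn_p p x 1" "sech_p p x > 0" for x
    using cn_p_1_pos[OF p, of x] p2 by (simp_all add: sech_p_def K_p1_def)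
  have a: "A_p p lam > 0"
    using p lam by (simp add: A_p_def)
  have "w0 \<noteq> 0"
    using w0 a sech(2)[of \<beta>] by auto
  define A where "A = 2 * sgn w0 * A_p p lam"
  have "\<bar>A\<bar> = 2 * A_p p lam"
    using a \<open>w0 \<noteq> 0\<close> by (simp add: A_def abs_mult abs_sgn_eq)
  note par = sech_params(1,2)[OF p lam this]
  have "W s = sgn_pow (p - 2) (A * cn_p p (A_p p lam * s + \<beta>) 1)" if "s \<in> {0..L}" for s
    using W_eq[of s] u_sech[OF that] by (simp add: sech A_def)
  \<comment> \<open>Case III does not mention w1, so the energy is computed from the formula inside
    the interval.\<close>
  from eq_on_interval[OF this cn_solution[OF p par(1)]]
  have "D0 p lam w0 w1 = 0"
    using energy_cn_curve[OF p par(1)] par(2) unfolding cn_curve_am1[OF p, symmetric] by simp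
  then show "cond_iii p lam w0 w1"
    using p2 \<open>w0 \<noteq> 0\<close> by (simp add: cond_iii_def)
next
  assume cond: "cond_iii p lam w0 w1"
  then have p2: "p \<le> 2" and D: "energy p lam w0 w1 = 0"
    by (auto simp: cond_iii_def D0_energy)
  \<comment> \<open>At w0 = 0 the potential vanishes, so zero energy would give w1 = 0 as
    well.\<close>
  have "w0 \<noteq> 0"
  proof
    assume "w0 = 0"
    with D p have "w1 = 0"
      by (simp add: energy_def F_pot_def)
    with \<open>w0 = 0\<close> cond show False
      by (simp add: cond_iii_def)
  qed
  then have lam: "lam > 0"
    using energy_zero_imp[OF p D] by simp
  have sech: "sech_p p x = cn_p p x 1" "sech_p p x > 0" for x
    using cn_p_1_pos[OF p, of x] p2 by (simp_all add: sech_p_def K_p1_def)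
  have a: "A_p p lam > 0"
    using p lam by (simp add: A_p_def)
  define A where "A = 2 * sgn w0 * A_p p lam"
  have absA: "\<bar>A\<bar> = 2 * A_p p lam"
    using a \<open>w0 \<noteq> 0\<close> by (simp add: A_def abs_mult abs_sgn_eq)
  note par = sech_params(1,2)[OF p lam this]
  have "w0 * A > 0"
    using \<open>w0 \<noteq> 0\<close> a by (cases "w0 > 0") (auto simp: A_def mult_neg_pos)
  then obtain \<beta> where \<beta>: "A * cn_p p \<beta> 1 = sgn_pow ((2 - p) / (p - 1)) w0"
    "cn_curve' p A (A_p p lam) 1 (am1 p \<beta> 1) = w1"
    using cn_match[OF p par(1), of w0 w1] par(2) D by auto
  note cn = cn_solution[OF p par(1), of \<beta>]
  have "u s = 2 * sgn w0 * A_p p lam * sech_p p (A_p p lam * s + \<beta>)" if "s \<in> {0..L}" for s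
  proof -
    have "u s = A * cn_p p (A_p p lam * s + \<beta>) 1"
      by (rule u_eq[OF cn _ _ _ that]) (use \<beta> p2 in auto)
    then show ?thesis
      by (simp add: sech A_def)
  qed
  moreover have "(2 * A_p p lam * sech_p p \<beta>) powr (p - 1) = \<bar>w0\<bar>"
  proof -
    have "w0 = sgn_pow (p - 2) (A * cn_p p \<beta> 1)"
      unfolding \<beta>(1) by (simp add: sgn_pow_inverse[OF p])
    then have "\<bar>w0\<bar> = \<bar>A * cn_p p \<beta> 1\<bar> powr (p - 2 + 1)"
      by (metis abs_sgn_pow)
    then show ?thesis
      using sech(2)[of \<beta>] by (simp add: abs_mult absA sech(1))
  qed
  ultimately show "case_III p L lam w0 u"
    unfolding case_III_def using p2 lam by blast
qed

lemma case_III'_iff: "case_III' p L u \<longleftrightarrow> cond_iii' p L lam w0 w1 u"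
proof
  assume "case_III' p L u"
  then have p2: "p > 2" and flat: "flat_core_type p L u"
    by (auto simp: case_III'_def)
  have "0 \<in> {0..L}"
    using L by simp
  then show "cond_iii' p L lam w0 w1 u"
    using flat_core_energy[OF L sol flat W_eq] D0_eq p2 by (auto simp: cond_iii'_def u_eq_0_iff)
next
  assume "cond_iii' p L lam w0 w1 u"
  then have p2: "p > 2" and D: "D0 p lam w0 w1 = 0" and nz: "\<exists>s\<in>{0..L}. W s \<noteq> 0"
    by (auto simp: cond_iii'_def u_eq_0_iff)
  \<comment> \<open>\<open>A_p\<close> and the core width make sense only for positive lam; a
    nonzero state of zero energy enforces it.\<close>
  have "lam > 0"
    using nz D0_eq D energy_zero_imp[OF p] by metis
  then have "flat_core_type p L u"
    using D0_eq D by (intro core_decomposition[OF p2 _ L sol _ nz]) (auto simp: u)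
  then show "case_III' p L u"
    using p2 by (simp add: case_III'_def)
qed

text \<open>A nonzero constant is an equilibrium, so lam = (p - 1) |k0|^p and the energy is - lam^2.
  Conversely, at energy - lam^2 the two squares in \<open>energy_eq\<close> vanish at every s, so W
  has zero velocity.\<close>

lemma case_V_iff: "case_V L u \<longleftrightarrow> cond_v p lam w0 w1"
proof
  assume "case_V L u"
  then obtain k0 where k0: "k0 \<noteq> 0" "\<And>s. s \<in> {0..L} \<Longrightarrow> u s = k0"
    by (auto simp: case_V_def)
  have "W s = sgn_pow (p - 2) k0" if "s \<in> {0..L}" for s
    using W_eq k0(2)[OF that] by simp
  from eq_on_interval[OF this, of "\<lambda>s. 0" "\<lambda>s. 0"]
  have D: "D0 p lam w0 w1 = energy p lam (sgn_pow (p - 2) k0) 0"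
    and "ode_rhs p lam (sgn_pow (p - 2) k0) = 0"
    by auto
  then have lam: "lam = (p - 1) * \<bar>k0\<bar> powr p"
    using k0(1) p by (simp add: ode_rhs_sgn_pow)
  then have "lam > 0"
    using k0(1) p by simp
  moreover have "D0 p lam w0 w1 = ((p - 1) * \<bar>k0\<bar> powr p)\<^sup>2 - 2 * lam * ((p - 1) * \<bar>k0\<bar> powr p)"
    unfolding D by (simp add: energy_def F_pot_sgn_pow[OF p] power_mult_distrib)
  then have "D0 p lam w0 w1 = - lam\<^sup>2"
    unfolding lam[symmetric] by (simp add: power2_eq_square)
  ultimately show "cond_v p lam w0 w1"
    by (simp add: cond_v_def min_F_eq[OF p])
next
  assume "cond_v p lam w0 w1"
  then have lam: "lam > 0" and D: "D0 p lam w0 w1 = - lam\<^sup>2"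
    by (auto simp: cond_v_def min_F_eq[OF p] split: if_splits)
  have "W1 s = 0" if "s \<in> {0..L}" for s
  proof -
    have "p\<^sup>2 * (W1 s)\<^sup>2 + ((p - 1) * \<bar>W s\<bar> powr (p / (p - 1)) - lam)\<^sup>2 = 0"
      using D0_eq[OF that] D by (simp add: energy_eq[OF p])
    then have "p\<^sup>2 * (W1 s)\<^sup>2 = 0"
      by (simp add: add_nonneg_eq_0_iff)
    then show ?thesis
      using p by simp
  qed
  then have "(W has_real_derivative 0) (at s within {0..L})" if "s \<in> {0..L}" for s
    using sol that unfolding ode_solution_def by force
  then obtain c where c: "\<And>s. s \<in> {0..L} \<Longrightarrow> W s = c"
    using has_field_derivative_zero_constant[of "{0..L}" W] by auto
  have "energy p lam w0 w1 < 0"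
    using D lam by (simp add: D0_energy)
  then have "w0 \<noteq> 0"
    by (rule energy_neg_imp(2)[OF p])
  then have "c \<noteq> 0"
    using c[of 0] W0 L by simp
  then show "case_V L u"
    unfolding case_V_def using c by (intro exI[of _ "sgn_pow ((2 - p) / (p - 1)) c"]) (simp add: u)
qed

lemma conditions_cover:
  "cond_i p L w0 w1 u \<or> cond_ii p lam w0 w1 \<or> cond_iii p lam w0 w1 \<or> cond_iii' p L lam w0 w1 u \<or>
   cond_iv p lam w0 w1 \<or> cond_v p lam w0 w1"
proof -
  have "min_F p lam \<le> D0 p lam w0 w1" if "D0 p lam w0 w1 < 0"
    using that energy_neg_imp(1)[OF p, of lam w0 w1] energy_ge[OF p] by (simp add: D0_energy min_F_eq[OF p])
  then show ?thesis
    unfolding cond_i_def cond_ii_def cond_iii_def cond_iii'_def cond_iv_def cond_v_def by force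
qed

text \<open>Condition (i) forces D0 = 0, so the sign of D0 and its comparison with
  \<open>min_F\<close> separate most pairs. Among (i), (iii) and (iii') the exponent range and the
  nontriviality clauses decide.\<close>

lemma conditions_exclusive:
  "sorted_wrt (\<lambda>P Q. \<not> (P \<and> Q))
     [cond_i p L w0 w1 u, cond_ii p lam w0 w1, cond_iii p lam w0 w1,
      cond_iii' p L lam w0 w1 u, cond_iv p lam w0 w1, cond_v p lam w0 w1]"
proof -
  have i: "cond_i p L w0 w1 u \<Longrightarrow> D0 p lam w0 w1 = 0"
    using D0_zero_if_zero(3) energy_0_0 by (auto simp: cond_i_def D0_energy)
  show ?thesis
    using i by (auto simp: cond_i_def cond_ii_def cond_iii_def cond_iii'_def cond_iv_def cond_v_def)
qed

end

theorem theorem4p1: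
  fixes p L lam w0 w1 :: real and k :: "real \<Rightarrow> real"
  assumes "p > 1" and "L > 0" and "is_solution p L lam w0 w1 k"
  shows "\<exists>u. continuous_rep L k u \<and>
     (case_I L u \<or> case_II p L lam w0 w1 u \<or> case_III p L lam w0 u \<or> case_III' p L u \<or>
      case_IV p L lam w0 w1 u \<or> case_V L u) \<and>
     (case_I L u \<longleftrightarrow> cond_i p L w0 w1 u) \<and>
     (case_II p L lam w0 w1 u \<longleftrightarrow> cond_ii p lam w0 w1) \<and>
     (case_III p L lam w0 u \<longleftrightarrow> cond_iii p lam w0 w1) \<and>
     (case_III' p L u \<longleftrightarrow> cond_iii' p L lam w0 w1 u) \<and>
     (case_IV p L lam w0 w1 u \<longleftrightarrow> cond_iv p lam w0 w1) \<and>
     (case_V L u \<longleftrightarrow> cond_v p lam w0 w1) \<and>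
     sorted_wrt (\<lambda>P Q. \<not> (P \<and> Q))
       [cond_i p L w0 w1 u, cond_ii p lam w0 w1, cond_iii p lam w0 w1,
        cond_iii' p L lam w0 w1 u, cond_iv p lam w0 w1, cond_v p lam w0 w1]"
proof -
  define w where "w s = sgn_pow (p - 2) (k s)" for s
  have w: "w \<in> borel_measurable (lebesgue_on {0<..<L})" and weak: "weak_equation p L lam w"
    using assms(3) by (auto simp: is_solution_def Let_def Linf_def w_def[abs_def])
  obtain W where W: "continuous_rep L w W" "W 0 = w0" "(W has_real_derivative w1) (at 0 within {0..L})"
    using assms(3) by (auto simp: is_solution_def Let_def w_def[abs_def])
  obtain W1 where sol: "ode_solution p lam {0..L} W W1"
    using weak_solution_imp_ode_solution[OF assms(1,2) weak w W(1)] by blast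
  define u where "u s = sgn_pow ((2 - p) / (p - 1)) (W s)" for s
  have "(W has_real_derivative W1 0) (at 0 within {0..L})"
    using sol assms(2) by (simp add: ode_solution_def)
  \<comment> \<open>The one-sided derivative at 0 is unique, which ties the prescribed w1 to the
    velocity of the classical solution.\<close>
  then have "W1 0 = w1"
    using real_derivative_unique_within[OF _ W(3) assms(2)] by simp
  then interpret cauchy_solution p L lam w0 w1 W W1 u
    using assms sol W(2) by unfold_locales (auto simp: u_def)
  have "(2 - p) / (p - 1) > -1"
    using assms(1) by (simp add: field_simps)
  then have "continuous_on {0..L} u"
    unfolding u_def[abs_def]
    by (rule continuous_on_sgn_pow) (use W(1) in \<open>simp add: continuous_rep_def\<close>)
  moreover have "AE s in lebesgue_on {0<..<L}. W s = w s"
    using W(1) by (simp add: continuous_rep_def)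
  \<comment> \<open>Inverting the odd power shows that u is the continuous representative of k
    itself, not only of |k|^(p-2) k.\<close>
  then have "AE s in lebesgue_on {0<..<L}. u s = k s"
    by eventually_elim (simp add: u_def w_def sgn_pow_inverse[OF assms(1)])
  ultimately have "continuous_rep L k u"
    by (simp add: continuous_rep_def)
  then show ?thesis
    using case_I_iff case_II_iff case_III_iff case_III'_iff case_IV_iff case_V_iff
      conditions_cover conditions_exclusive by (intro exI[of _ u]) blast
qed

end
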